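(* Let $B^K_t=\int_0^t K(t,s)\,\mathrm{d}W_s$, $t\in[0,T]$, be a Volterra process whose $L^2$ kernel $K$ satisfies, for some $H\in(0,1)$ and $c\in(0,\infty)$, $\big(\int_{t-\varepsilon}^t K(t,s)^2\,\mathrm{d}s\big)^{1/2}\ge c\,\varepsilon^H$ for all $t\in(0,T]$ and $\varepsilon\in(0,t)$. Let $x_0\in\mathbb{R}$ and let $b\colon[0,T]\times\mathbb{R}\to\mathbb{R}$ be a measurable function such that $b(t,x)$ is piecewise uniformly continuous in the variable $x$, with finitely many discontinuity points $a_1,\dots,a_m\in\mathbb{R}$, $m\in\mathbb{N}$, and such that there is a constant $C$ with $|b(t,x)|\le C(1+|x|)$ for every $x\in\mathbb{R}$, uniformly in $t\in[0,T]$. Assume in addition that $b(t,x)$ is nonincreasing in $x$ for every $t$. Then the SDE $$\mathrm{d}X_t=b(t,X_t)\,\mathrm{d}t+\mathrm{d}B^K_t,\quad t\in[0,T],\qquad X_0=x_0,$$ admits a unique strong solution.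
   Context: $T\in(0,\infty)$ is fixed, $(\Omega,(\mathcal{A}_t)_{t\in[0,T]},\mathbb{P})$ is a filtered probability space, $(W_t)_{t\in[0,T]}$ is a standard one-dimensional Brownian motion on it, and $(\mathcal{A}_t)$ is the augmented filtration generated by $W$, satisfying the usual conditions. An $L^2$ kernel is a function $K\colon[0,T]\times[0,T]\to\mathbb{R}$ with $\int_0^T\int_0^T K(t,s)^2\,\mathrm{d}t\,\mathrm{d}s<\infty$ (the Wiener integrals defining $B^K_t$ are assumed well defined for each $t$). A strong solution is an $(\mathcal{A}_t)$-adapted process $X$ on the given space with $X_t=x_0+\int_0^t b(s,X_s)\,\mathrm{d}s+B^K_t$, $t\in[0,T]$, almost surely; uniqueness means that any two solutions $X^1,X^2$ satisfy $X^1_t=X^2_t$ for every $t\in[0,T]$ with probability one. Piecewise uniformly continuous in $x$ with discontinuity points $a_1<\dots<a_m$ means uniformly continuous in $x$ on each of the open intervals $(-\infty,a_1),(a_1,a_2),\dots,(a_m,\infty)$. *)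

theory Defs
  imports "HOL-Probability.Probability"
begin

definition square_integrable_on :: "'a measure \<Rightarrow> 'a set \<Rightarrow> ('a \<Rightarrow> real) \<Rightarrow> bool" where
  "square_integrable_on N S f \<longleftrightarrow>
     set_borel_measurable N S f \<and> set_integrable N S (\<lambda>x. (f x)\<^sup>2)"


section \<open>Brownian motion and its augmented filtration\<close>

definition brownian_motion :: "'a measure \<Rightarrow> real \<Rightarrow> (real \<Rightarrow> 'a \<Rightarrow> real) \<Rightarrow> bool" where
  "brownian_motion M T W \<longleftrightarrow>
     (\<forall>t\<in>{0..T}. W t \<in> borel_measurable M) \<and>
     (AE \<omega> in M. W 0 \<omega> = 0) \<and>
     (\<forall>s t. 0 \<le> s \<and> s < t \<and> t \<le> T \<longrightarrow>
        distributed M lborel (\<lambda>\<omega>. W t \<omega> - W s \<omega>) (normal_density 0 (sqrt (t - s)))) \<and>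
     (\<forall>(n::nat) p. (\<forall>i\<le>n. p i \<in> {0..T}) \<and> (\<forall>i<n. p i \<le> p (Suc i)) \<longrightarrow>
        prob_space.indep_vars M (\<lambda>_. borel) (\<lambda>i \<omega>. W (p (Suc i)) \<omega> - W (p i) \<omega>) {..<n}) \<and>
     (AE \<omega> in M. continuous_on {0..T} (\<lambda>t. W t \<omega>))"

text \<open>To be used with a complete measure \<open>M\<close>, so that adjoining \<^term>\<open>null_sets M\<close> adjoins all
  negligible sets.\<close>

definition augmented_filtration ::
    "'a measure \<Rightarrow> (real \<Rightarrow> 'a \<Rightarrow> real) \<Rightarrow> real \<Rightarrow> 'a measure" where
  "augmented_filtration M W t =
     sigma (space M)
       ((\<Union>s\<in>{0..t}. {W s -` A \<inter> space M | A. A \<in> sets borel}) \<union> null_sets M)"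

lemma augmented_filtration_generators:
  "(\<Union>s\<in>{0..t}. {W s -` A \<inter> space M | A. A \<in> sets borel}) \<union> null_sets M \<subseteq> Pow (space M)"
  using sets.sets_into_space[of _ M] by (auto dest!: null_setsD2)

lemma filtration_augmented_filtration: "filtration (space M) (augmented_filtration M W)"
proof
  show "space (augmented_filtration M W i) = space M" for i
    unfolding augmented_filtration_def
    by (intro space_measure_of augmented_filtration_generators)
  show "sets (augmented_filtration M W i) \<subseteq> sets (augmented_filtration M W j)" if "i \<le> j" for i j
    unfolding augmented_filtration_def sets_measure_of[OF augmented_filtration_generators]
    using that by (intro sigma_sets_mono') fastforce
qed


section \<open>Wiener integrals and Volterra processes\<close>

text \<open>A list of triples \<open>(c, u, v)\<close> encodes the step function given by the sum of
  \<open>c * indicator {u<..v}\<close>.\<close>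

definition step_function :: "(real \<times> real \<times> real) list \<Rightarrow> real \<Rightarrow> real" where
  "step_function \<phi> s = (\<Sum>(c, u, v)\<leftarrow>\<phi>. c * indicator {u<..v} s)"

definition step_wiener_integral ::
    "(real \<Rightarrow> 'a \<Rightarrow> real) \<Rightarrow> (real \<times> real \<times> real) list \<Rightarrow> 'a \<Rightarrow> real" where
  "step_wiener_integral W \<phi> \<omega> = (\<Sum>(c, u, v)\<leftarrow>\<phi>. c * (W v \<omega> - W u \<omega>))"

text \<open>\<open>Y\<close> is a version of the integral of \<open>f\<close> over \<open>[0, t]\<close> with respect to \<open>W\<close>: the mean-square
  limit of the elementary integrals of step functions converging to \<open>f\<close> in \<open>L\<^sup>2([0, t])\<close>. It is
  determined by \<open>f\<close> up to almost sure equality only.\<close>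

definition has_wiener_integral ::
    "'a measure \<Rightarrow> (real \<Rightarrow> 'a \<Rightarrow> real) \<Rightarrow> real \<Rightarrow> (real \<Rightarrow> real) \<Rightarrow> ('a \<Rightarrow> real) \<Rightarrow> bool" where
  "has_wiener_integral M W t f Y \<longleftrightarrow>
     square_integrable_on lebesgue {0..t} f \<and> Y \<in> borel_measurable M \<and>
     (\<exists>\<phi>. (\<forall>n::nat. \<forall>(c, u, v)\<in>set (\<phi> n). 0 \<le> u \<and> u \<le> v \<and> v \<le> t) \<and>
          (\<lambda>n. \<integral>\<^sup>+s\<in>{0..t}. ennreal ((f s - step_function (\<phi> n) s)\<^sup>2) \<partial>lebesgue)
             \<longlonglongrightarrow> 0 \<and>
          (\<lambda>n. \<integral>\<^sup>+\<omega>. ennreal ((Y \<omega> - step_wiener_integral W (\<phi> n) \<omega>)\<^sup>2) \<partial>M)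
             \<longlonglongrightarrow> 0)"

definition L2_kernel :: "real \<Rightarrow> (real \<Rightarrow> real \<Rightarrow> real) \<Rightarrow> bool" where
  "L2_kernel T K \<longleftrightarrow> square_integrable_on lebesgue ({0..T} \<times> {0..T}) (\<lambda>(t, s). K t s)"

text \<open>Since each Wiener integral is only determined almost surely, a Volterra process is a choice
  of versions for all times. As usual for processes whose paths are integrated in time, the choice
  is made jointly measurably in time and \<open>\<omega>\<close>; arbitrary versions need not have
  measurable paths.\<close>

definition volterra_process ::
    "'a measure \<Rightarrow> (real \<Rightarrow> 'a \<Rightarrow> real) \<Rightarrow> real \<Rightarrow> (real \<Rightarrow> real \<Rightarrow> real) \<Rightarrow> (real \<Rightarrow> 'a \<Rightarrow> real) \<Rightarrow> bool"
  where
  "volterra_process M W T K B \<longleftrightarrow>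
     (\<lambda>(t, \<omega>). B t \<omega>) \<in> borel_measurable (restrict_space borel {0..T} \<Otimes>\<^sub>M M) \<and>
     (\<forall>t\<in>{0..T}. has_wiener_integral M W t (K t) (B t))"


section \<open>Drift and solutions\<close>

definition piecewise_uniformly_continuous :: "nat \<Rightarrow> (nat \<Rightarrow> real) \<Rightarrow> (real \<Rightarrow> real) \<Rightarrow> bool" where
  "piecewise_uniformly_continuous m a f \<longleftrightarrow>
     uniformly_continuous_on {..<a 1} f \<and>
     (\<forall>i\<in>{1..<m}. uniformly_continuous_on {a i<..<a (Suc i)} f) \<and>
     uniformly_continuous_on {a m<..} f"

text \<open>The integrability requirement is needed because the Bochner integral of a
  non-integrable function is \<open>0\<close> by convention.\<close>

definition strong_solution ::
    "'a measure \<Rightarrow> (real \<Rightarrow> 'a measure) \<Rightarrow> real \<Rightarrow> real \<Rightarrow> (real \<Rightarrow> real \<Rightarrow> real) \<Rightarrow>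
      (real \<Rightarrow> 'a \<Rightarrow> real) \<Rightarrow> (real \<Rightarrow> 'a \<Rightarrow> real) \<Rightarrow> bool" where
  "strong_solution M F T x0 b B X \<longleftrightarrow>
     (\<forall>t\<in>{0..T}. X t \<in> borel_measurable (F t)) \<and>
     (AE \<omega> in M. \<forall>t\<in>{0..T}.
        set_integrable lebesgue {0..t} (\<lambda>s. b s (X s \<omega>)) \<and>
        X t \<omega> = x0 + (LINT s:{0..t}|lebesgue. b s (X s \<omega>)) + B t \<omega>)"

definition unique_strong_solution ::
    "'a measure \<Rightarrow> (real \<Rightarrow> 'a measure) \<Rightarrow> real \<Rightarrow> real \<Rightarrow> (real \<Rightarrow> real \<Rightarrow> real) \<Rightarrow>
      (real \<Rightarrow> 'a \<Rightarrow> real) \<Rightarrow> bool" where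
  "unique_strong_solution M F T x0 b B \<longleftrightarrow>
     (\<exists>X. strong_solution M F T x0 b B X) \<and>
     (\<forall>X1 X2. strong_solution M F T x0 b B X1 \<and> strong_solution M F T x0 b B X2 \<longrightarrow>
        (AE \<omega> in M. \<forall>t\<in>{0..T}. X1 t \<omega> = X2 t \<omega>))"

end

theory Submission
  imports Defs
begin

text \<open>Given the noise path, the drift is nonincreasing in the state, so a comparison argument gives
  pathwise uniqueness, and it also makes explicit Euler schemes, which freeze only the drift part of
  the state on each grid cell, converge pathwise without any continuity of the drift in the state.
  The limit \<open>X\<close> is adapted, and it solves the equation as soon as it meets the discontinuity points
  only on a null set of times. This holds almost surely: given the past up to \<open>t - \<epsilon>\<close>, the noise
  \<open>B t\<close> still has a Gaussian component of standard deviation at least \<open>c \<epsilon> powr H\<close>, while the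
  drift part moves by \<open>O(\<epsilon>)\<close> on average over \<open>t\<close>, and \<open>\<epsilon>\<close> is negligible against \<open>\<epsilon> powr H\<close>
  because \<open>H < 1\<close>.\<close>

section \<open>Euler schemes for dissipative equations\<close>

text \<open>The unknown is \<open>Y = X - x0 - B\<close>, which for fixed \<omega> solves
  \<open>Y' = f s Y\<close> with \<open>f s y = b s (x0 + B s + y)\<close>. Since \<open>B\<close>
  is only jointly measurable, its paths need be neither continuous nor bounded. So \<open>f\<close>
  is merely measurable in time, with growth \<open>p s + C * \<bar>y\<bar>\<close> for an integrable
  \<open>p\<close>, and moduli of continuity come from the absolute continuity of integrals. Almost
  sure integrability of \<open>p\<close> holds because the second moment of \<open>B t\<close>,
  integrated over \<open>t\<close>, is controlled by the square integral of the kernel.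
  Discontinuity of \<open>b s\<close> does not disturb the convergence of the schemes, which rests
  on monotonicity; it obstructs the identification of the limit of the drift integrals, and this is
  why the probability of \<open>X t = x\<close> has to be estimated. A Wiener integral is given only
  as a mean square limit of step integrals. Normality is proved for step integrals alone; second
  moment and small ball bounds then pass to the limit at the price of a constant, which is harmless
  because in the end only powers of \<epsilon> matter.\<close>

lemma set_integral_split:
  fixes g :: "real \<Rightarrow> real"
  assumes "a \<le> b" "b \<le> c" "set_integrable lborel {a..<c} g"
  shows "(LBINT s:{a..<c}. g s) = (LBINT s:{a..<b}. g s) + (LBINT s:{b..<c}. g s)"
proof -
  have "{a..<c} = {a..<b} \<union> {b..<c}" using assms by auto
  moreover have "set_integrable lborel {a..<b} g" "set_integrable lborel {b..<c} g"
    using assms by (auto intro: set_integrable_subset)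
  ultimately show ?thesis by (simp add: set_integral_Un)
qed

text \<open>Going back from \<open>t\<close> to the last time \<open>Sup S\<close> with value at
  most \<eta>, the function stays above \<eta> in between and so cannot have risen. The comparison
  of two schemes (level \<open>2 * e\<close>) and of two solutions (level 0) both rest on
  this.\<close>

lemma level_comparison:
  fixes D :: "real \<Rightarrow> real"
  assumes cont: "continuous_on {0..T} D" and "D 0 \<le> \<eta>"
    and decr: "\<And>s t. 0 \<le> s \<Longrightarrow> s \<le> t \<Longrightarrow> t \<le> T \<Longrightarrow> \<forall>r\<in>{s<..<t}. \<eta> < D r \<Longrightarrow> D t \<le> D s"
    and t: "t \<in> {0..T}"
  shows "D t \<le> \<eta>"
proof (rule ccontr)
  assume neg: "\<not> D t \<le> \<eta>"
  define S where "S = {0..t} \<inter> D -` {..\<eta>}"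
  have "continuous_on {0..t} D" using cont by (rule continuous_on_subset) (use t in auto)
  then have "closed S" unfolding S_def by (intro continuous_closed_preimage) auto
  moreover have ne: "0 \<in> S" using assms t by (auto simp: S_def)
  moreover have bdd: "bdd_above S" by (auto simp: S_def intro: bdd_aboveI[of _ t])
  ultimately have tau: "Sup S \<in> S" by (intro closed_contains_Sup) auto
  have "D t \<le> D (Sup S)"
  proof (rule decr)
    show "\<forall>r\<in>{Sup S<..<t}. \<eta> < D r"
    proof (rule ballI, rule ccontr)
      fix r assume r: "r \<in> {Sup S<..<t}" "\<not> \<eta> < D r"
      have "r \<in> S" using r tau by (auto simp: S_def)
      then show False using r cSup_upper[OF _ bdd] by fastforce
    qed
  qed (use tau t in \<open>auto simp: S_def\<close>)
  then show False using neg tau by (auto simp: S_def)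
qed

lemma set_integral_uniformly_small:
  fixes g :: "real \<Rightarrow> real"
  assumes g: "set_integrable lborel {0..T} g" and e: "0 < e"
  shows "\<exists>\<delta>>0. \<forall>s t. 0 \<le> s \<longrightarrow> s \<le> t \<longrightarrow> t \<le> T \<longrightarrow> t - s < \<delta> \<longrightarrow> (LBINT r:{s..<t}. g r) < e"
proof -
  have "g integrable_on {0..T}" using set_borel_integral_eq_integral(1)[OF g] .
  then have "continuous_on {0..T} (\<lambda>x. integral {0..x} g)" by (rule indefinite_integral_continuous_1)
  then have "uniformly_continuous_on {0..T} (\<lambda>x. integral {0..x} g)"
    by (rule compact_uniformly_continuous) auto
  then obtain \<delta> where \<delta>: "\<delta> > 0"
    "\<And>s t. s \<in> {0..T} \<Longrightarrow> t \<in> {0..T} \<Longrightarrow> dist t s < \<delta> \<Longrightarrow> dist (integral {0..t} g) (integral {0..s} g) < e"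
    unfolding uniformly_continuous_on_def using e by blast
  have "(LBINT r:{s..<t}. g r) < e" if st: "0 \<le> s" "s \<le> t" "t \<le> T" "t - s < \<delta>" for s t
  proof -
    have eq: "(LBINT r:{0..<x}. g r) = integral {0..x} g" if "0 \<le> x" "x \<le> T" for x
    proof -
      have "(LBINT r:{0..<x}. g r) = integral {0..<x} g"
        by (intro set_borel_integral_eq_integral(2) set_integrable_subset[OF g]) (use that in auto)
      also have "\<dots> = integral {0..x} g"
        by (rule integral_spike_set; rule negligible_subset[of "{x}"]) auto
      finally show ?thesis .
    qed
    have "(LBINT r:{0..<t}. g r) = (LBINT r:{0..<s}. g r) + (LBINT r:{s..<t}. g r)"
      by (intro set_integral_split set_integrable_subset[OF g]) (use st in auto)
    then have "(LBINT r:{s..<t}. g r) = integral {0..t} g - integral {0..s} g"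
      using eq st by auto
    also have "\<dots> < e" using \<delta>(2)[of s t] st by (auto simp: dist_real_def)
    finally show ?thesis .
  qed
  with \<delta>(1) show ?thesis by blast
qed

section \<open>Explicit Euler schemes, their Gronwall bound and their limit\<close>

primrec euler :: "(real \<Rightarrow> real \<Rightarrow> real) \<Rightarrow> real \<Rightarrow> nat \<Rightarrow> real" where
  "euler f h 0 = 0"
| "euler f h (Suc k) = euler f h k + (LBINT s:{real k * h..<real (Suc k) * h}. f s (euler f h k))"

definition euler_drift :: "(real \<Rightarrow> real \<Rightarrow> real) \<Rightarrow> real \<Rightarrow> real \<Rightarrow> real" where
  "euler_drift f h s = f s (euler f h (nat \<lfloor>s / h\<rfloor>))"

definition euler_path :: "(real \<Rightarrow> real \<Rightarrow> real) \<Rightarrow> real \<Rightarrow> real \<Rightarrow> real" where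
  "euler_path f h t = (LBINT s:{0..<t}. euler_drift f h s)"

text \<open>\<open>lim\<close> is total, so measurability and adaptedness of the limit follow from
  those of the schemes without knowing where they converge.\<close>

definition euler_limit :: "(real \<Rightarrow> real \<Rightarrow> real) \<Rightarrow> real \<Rightarrow> real" where
  "euler_limit f t = lim (\<lambda>n. euler_path f (1 / real (Suc n)) t)"

lemma grid_index:
  assumes "0 < h" "s \<in> {real k * h..<real (Suc k) * h}"
  shows "nat \<lfloor>s / h\<rfloor> = k"
proof -
  have "\<lfloor>s / h\<rfloor> = int k"
    using assms by (intro floor_unique) (auto simp: field_simps)
  then show ?thesis by simp
qed

lemma grid_point:
  assumes "0 < h" "0 \<le> s"
  shows "real (nat \<lfloor>s / h\<rfloor>) * h \<le> s" "s < real (nat \<lfloor>s / h\<rfloor>) * h + h"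
proof -
  have "real (nat \<lfloor>s / h\<rfloor>) = of_int \<lfloor>s / h\<rfloor>" using assms by simp
  then show "real (nat \<lfloor>s / h\<rfloor>) * h \<le> s" "s < real (nat \<lfloor>s / h\<rfloor>) * h + h"
    using assms floor_divide_lower[of h s] floor_divide_upper[of h s] by (auto simp: algebra_simps)
qed

text \<open>The equation for one fixed path of the noise. The function \<open>p\<close> absorbs the
  noise, which is integrable but possibly unbounded in time.\<close>

locale dissipative_ode =
  fixes f :: "real \<Rightarrow> real \<Rightarrow> real" and p :: "real \<Rightarrow> real" and C T :: real
  assumes measurable_f: "(\<lambda>(s, y). f s y) \<in> borel_measurable (borel \<Otimes>\<^sub>M borel)"
    and antimono_f: "antimono (f s)"
    and growth: "\<bar>f s y\<bar> \<le> p s + C * \<bar>y\<bar>"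
    and integrable_p: "integrable lborel p"
    and C_nonneg: "0 \<le> C"
begin

lemma p_nonneg: "0 \<le> p s"
  using growth[of s 0] by simp

lemma measurable_f_compose [measurable (raw)]:
  "g \<in> borel_measurable N \<Longrightarrow> k \<in> borel_measurable N \<Longrightarrow> (\<lambda>x. f (g x) (k x)) \<in> borel_measurable N"
  using measurable_compose[OF _ measurable_f, of "\<lambda>x. (g x, k x)" N] by simp

lemma set_integrable_const_growth: "set_integrable lborel {u..<v} (\<lambda>s. p s + c)"
proof -
  have "set_integrable lborel {u..<v} p"
    using integrable_p unfolding set_integrable_def by (intro integrable_mult_indicator) auto
  moreover have "set_integrable lborel {u..<v} (\<lambda>s. c)"
    by (cases "u \<le> v") (auto simp: set_integrable_def)
  ultimately show ?thesis by (rule set_integral_add)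
qed

lemma set_integrable_f: "set_integrable lborel {u..<v} (\<lambda>s. f s y)"
  unfolding set_integrable_def
  apply (rule Bochner_Integration.integrable_bound[OF
        set_integrable_const_growth[of u v "C * \<bar>y\<bar>", unfolded set_integrable_def]])
   apply measurable
  using growth[of _ y] by (auto simp: indicator_def intro: order_trans[OF _ abs_ge_self])

text \<open>Discrete Gronwall inequality: one step multiplies the modulus by at most
  \<open>1 + C * h \<le> exp (C * h)\<close> and adds the integral of \<open>p\<close> over the
  cell; the product of the exponentials depends only on \<open>k * h\<close>.\<close>

lemma abs_euler_le:
  assumes "0 < h"
  shows "\<bar>euler f h k\<bar> \<le> exp (C * (real k * h)) * (LBINT s:{0..<real k * h}. p s)"
proof (induction k)
  case 0
  then show ?case by (simp add: set_lebesgue_integral_def)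
next
  case (Suc k)
  let ?u = "real k * h" and ?v = "real (Suc k) * h" and ?e = "euler f h k"
  have uv: "0 \<le> ?u" "?u \<le> ?v" "?v = ?u + h" using assms by (auto simp: algebra_simps)
  have ip: "set_integrable lborel {u..<v} p" for u v
    using set_integrable_const_growth[of u v 0] by simp
  have nn: "0 \<le> (LBINT s:{u..<v}. p s)" for u v
    by (simp add: set_lebesgue_integral_def p_nonneg)
  have "\<bar>LBINT s:{?u..<?v}. f s ?e\<bar> \<le> (LBINT s:{?u..<?v}. \<bar>f s ?e\<bar>)"
    using set_integral_norm_bound[OF set_integrable_f] by (simp add: real_norm_def)
  also have "\<dots> \<le> (LBINT s:{?u..<?v}. p s + C * \<bar>?e\<bar>)"
    using growth by (intro set_integral_mono set_integrable_abs set_integrable_f set_integrable_const_growth) auto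
  also have "\<dots> = (LBINT s:{?u..<?v}. p s) + C * \<bar>?e\<bar> * h"
  proof -
    have "set_integrable lborel {?u..<?v} (\<lambda>s. C * \<bar>?e\<bar>)"
      using uv by (auto simp: set_integrable_def)
    then have "(LBINT s:{?u..<?v}. p s + C * \<bar>?e\<bar>)
      = (LBINT s:{?u..<?v}. p s) + (LBINT s:{?u..<?v}. C * \<bar>?e\<bar>)" using ip
      by (intro set_integral_add)
    moreover have "(LBINT s:{?u..<?v}. C * \<bar>?e\<bar>) = C * \<bar>?e\<bar> * h"
      using uv by (simp add: set_lebesgue_integral_def)
    ultimately show ?thesis by simp
  qed
  finally have 1: "\<bar>euler f h (Suc k)\<bar> \<le> (1 + C * h) * \<bar>?e\<bar> + (LBINT s:{?u..<?v}. p s)"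
    by (simp add: algebra_simps)
  have "(1 + C * h) * \<bar>?e\<bar> \<le> exp (C * h) * (exp (C * ?u) * (LBINT s:{0..<?u}. p s))"
    using assms C_nonneg by (intro mult_mono Suc exp_ge_add_one_self) auto
  also have "\<dots> = exp (C * ?v) * (LBINT s:{0..<?u}. p s)"
    using uv by (simp add: exp_add algebra_simps)
  finally have 2: "(1 + C * h) * \<bar>?e\<bar> \<le> exp (C * ?v) * (LBINT s:{0..<?u}. p s)" .
  have "1 * (LBINT s:{?u..<?v}. p s) \<le> exp (C * ?v) * (LBINT s:{?u..<?v}. p s)"
    using assms C_nonneg nn by (intro mult_right_mono) auto
  with 1 2 have "\<bar>euler f h (Suc k)\<bar> \<le> exp (C * ?v) * ((LBINT s:{0..<?u}. p s) + (LBINT s:{?u..<?v}. p s))"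
    by (simp add: algebra_simps)
  then show ?case using set_integral_split[of 0 ?u ?v p] uv ip by simp
qed

text \<open>The growth bound with the state replaced by its Gronwall bound at time \<open>T\<close>.
  It does not depend on the step \<open>h\<close>, so it gives a common modulus of continuity and a
  dominating function for all schemes.\<close>

definition bnd :: "real \<Rightarrow> real" where
  "bnd s = p s + C * (exp (C * T) * (\<integral>s. p s \<partial>lborel))"

lemma abs_euler_drift_le:
  assumes "0 < h" "s \<in> {0..T}"
  shows "\<bar>euler_drift f h s\<bar> \<le> bnd s"
proof -
  let ?k = "nat \<lfloor>s / h\<rfloor>"
  have k: "real ?k * h \<le> T" using grid_point[of h s] assms by auto
  have "(LBINT s:{0..<real ?k * h}. p s) \<le> (\<integral>s. p s \<partial>lborel)"
    unfolding set_lebesgue_integral_def using set_integrable_const_growth[of _ _ 0] integrable_p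
    by (intro integral_mono) (auto simp: indicator_def p_nonneg set_integrable_def)
  moreover have "0 \<le> (LBINT s:{0..<real ?k * h}. p s)"
    by (simp add: set_lebesgue_integral_def p_nonneg)
  ultimately have "\<bar>euler f h ?k\<bar> \<le> exp (C * T) * (\<integral>s. p s \<partial>lborel)"
    using k C_nonneg by (intro order_trans[OF abs_euler_le[OF assms(1)]] mult_mono) (auto intro: mult_left_mono)
  then show ?thesis
    unfolding euler_drift_def bnd_def using growth[of s "euler f h ?k"] C_nonneg
    by (intro order_trans[OF growth] add_left_mono mult_left_mono)
qed

lemma set_integrable_bnd: "set_integrable lborel {u..<v} bnd"
  unfolding bnd_def by (rule set_integrable_const_growth)

lemma bnd_nonneg: "0 \<le> bnd s"
  unfolding bnd_def using p_nonneg C_nonneg by (simp add: integral_nonneg)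

lemma measurable_euler_drift [measurable]: "euler_drift f h \<in> borel_measurable borel"
  unfolding euler_drift_def
  by (rule measurable_compose_countable[where g="\<lambda>s. nat \<lfloor>s / h\<rfloor>" and f="\<lambda>k s. f s (euler f h k)"]) measurable

lemma set_integrable_euler_drift:
  assumes "0 < h" "0 \<le> u" "v \<le> T"
  shows "set_integrable lborel {u..<v} (euler_drift f h)"
  unfolding set_integrable_def
  apply (rule Bochner_Integration.integrable_bound[OF
        set_integrable_bnd[of u v, unfolded set_integrable_def]])
   apply measurable
  using abs_euler_drift_le[OF assms(1)] assms bnd_nonneg by (auto simp: indicator_def)

lemma euler_path_diff:
  assumes "0 < h" "0 \<le> s" "s \<le> t" "t \<le> T"
  shows "euler_path f h t - euler_path f h s = (LBINT r:{s..<t}. euler_drift f h r)"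
  unfolding euler_path_def
  using set_integral_split[OF _ _ set_integrable_euler_drift, of 0 s t] assms by simp

lemma abs_euler_path_diff_le:
  assumes "0 < h" "0 \<le> s" "s \<le> t" "t \<le> T"
  shows "\<bar>euler_path f h t - euler_path f h s\<bar> \<le> (LBINT r:{s..<t}. bnd r)"
proof -
  have "\<bar>LBINT r:{s..<t}. euler_drift f h r\<bar> \<le> (LBINT r:{s..<t}. \<bar>euler_drift f h r\<bar>)"
    using set_integral_norm_bound[OF set_integrable_euler_drift] assms by (simp add: real_norm_def)
  also have "\<dots> \<le> (LBINT r:{s..<t}. bnd r)"
    using assms abs_euler_drift_le[OF assms(1)]
    by (intro set_integral_mono set_integrable_abs set_integrable_euler_drift set_integrable_bnd) auto
  finally show ?thesis using euler_path_diff[OF assms] by simp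
qed

lemma euler_path_grid:
  assumes "0 < h" "real k * h \<le> T"
  shows "euler_path f h (real k * h) = euler f h k"
  using assms(2)
proof (induction k)
  case 0
  then show ?case by (simp add: euler_path_def set_lebesgue_integral_def)
next
  case (Suc k)
  have le: "real k * h \<le> real (Suc k) * h" using assms(1) by (simp add: algebra_simps)
  have "euler_path f h (real (Suc k) * h) = euler_path f h (real k * h) +
      (LBINT r:{real k * h..<real (Suc k) * h}. euler_drift f h r)"
    using euler_path_diff[of h "real k * h" "real (Suc k) * h"] assms(1) Suc.prems le by simp
  also have "(LBINT r:{real k * h..<real (Suc k) * h}. euler_drift f h r)
      = (LBINT r:{real k * h..<real (Suc k) * h}. f r (euler f h k))"
    using grid_index[OF assms(1), of _ k] by (intro set_lebesgue_integral_cong) (auto simp: euler_drift_def)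
  finally show ?case using Suc le by simp
qed

text \<open>For fixed \<open>t\<close> the floor is a fixed number \<open>k\<close>, so the path
  becomes one grid value plus one integral with a single frozen state. Adaptedness of the path is
  read off from this form.\<close>

lemma euler_path_split:
  assumes "0 < h" "t \<in> {0..T}"
  defines "k \<equiv> nat \<lfloor>t / h\<rfloor>"
  shows "euler_path f h t = euler f h k + (LBINT r:{real k * h..<t}. f r (euler f h k))"
proof -
  note kt = grid_point[of h t, folded k_def]
  have "euler_path f h t = euler_path f h (real k * h) + (LBINT r:{real k * h..<t}. euler_drift f h r)"
    using euler_path_diff[of h "real k * h" t] assms(1,2) kt by simp
  also have "(LBINT r:{real k * h..<t}. euler_drift f h r) = (LBINT r:{real k * h..<t}. f r (euler f h k))"
    using grid_index[OF assms(1), of _ k] kt(2) assms(1,2)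
    by (intro set_lebesgue_integral_cong) (auto simp: euler_drift_def distrib_right)
  finally show ?thesis using euler_path_grid[of h k] assms(1,2) kt by simp
qed

lemma abs_euler_path_grid_le:
  assumes "0 < h" "t \<in> {0..T}"
  shows "\<bar>euler_path f h t - euler f h (nat \<lfloor>t / h\<rfloor>)\<bar> \<le> (LBINT r:{real (nat \<lfloor>t / h\<rfloor>) * h..<t}. bnd r)"
  using abs_euler_path_diff_le[of h "real (nat \<lfloor>t / h\<rfloor>) * h" t] grid_point[of h t] assms
    euler_path_grid[of h "nat \<lfloor>t / h\<rfloor>"] by simp

lemma small_bnd:
  assumes "0 < e"
  shows "\<exists>\<delta>>0. \<forall>s t. 0 \<le> s \<longrightarrow> s \<le> t \<longrightarrow> t \<le> T \<longrightarrow> t - s < \<delta> \<longrightarrow> (LBINT r:{s..<t}. bnd r) < e"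
  by (intro set_integral_uniformly_small assms set_integrable_subset[OF set_integrable_bnd[of 0 "T + 1"]]) auto

lemma continuous_euler_path:
  assumes "0 < h"
  shows "continuous_on {0..T} (euler_path f h)"
  unfolding continuous_on_iff
proof (intro ballI allI impI)
  fix t e :: real assume t: "t \<in> {0..T}" and "0 < e"
  then obtain \<delta> where \<delta>: "\<delta> > 0" "\<And>s t. 0 \<le> s \<Longrightarrow> s \<le> t \<Longrightarrow> t \<le> T \<Longrightarrow> t - s < \<delta> \<Longrightarrow> (LBINT r:{s..<t}. bnd r) < e"
    using small_bnd by metis
  have "dist (euler_path f h s) (euler_path f h t) < e" if "s \<in> {0..T}" "dist s t < \<delta>" for s
    using that t abs_euler_path_diff_le[OF assms, of s t] abs_euler_path_diff_le[OF assms, of t s]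
      \<delta>(2)[of s t] \<delta>(2)[of t s] by (cases "s \<le> t") (auto simp: dist_real_def)
  with \<delta>(1) show "\<exists>d>0. \<forall>x'\<in>{0..T}. dist x' t < d \<longrightarrow> dist (euler_path f h x') (euler_path f h t) < e" by blast
qed

lemma euler_path_close:
  assumes "0 < h" "0 < h'" "h \<le> \<delta>" "h' \<le> \<delta>"
    and \<delta>: "\<And>s t. 0 \<le> s \<Longrightarrow> s \<le> t \<Longrightarrow> t \<le> T \<Longrightarrow> t - s < \<delta> \<Longrightarrow> (LBINT r:{s..<t}. bnd r) < e"
    and t: "t \<in> {0..T}"
  shows "euler_path f h t - euler_path f h' t \<le> 2 * e"
proof -
  have near: "\<bar>euler_path f h t - euler f h (nat \<lfloor>t / h\<rfloor>)\<bar> < e" if "0 < h" "h \<le> \<delta>" "t \<in> {0..T}" for h t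
    using abs_euler_path_grid_le[OF that(1,3)] \<delta>[of "real (nat \<lfloor>t / h\<rfloor>) * h" t] grid_point[of h t] that
    by auto
  \<comment> \<open>The integral over the empty interval is 0, so the assumption on the modulus
    forces \<open>e\<close> to be positive.\<close>
  have e: "0 < e" using \<delta>[of 0 0] assms t by (auto simp: set_lebesgue_integral_def)
  \<comment> \<open>Each scheme evaluates the drift within \<open>e\<close> of its path, so the drifts are ordered wherever the
    paths differ by more than \<open>2 * e\<close>.\<close>
  show ?thesis
  proof (rule level_comparison[OF _ _ _ t, where D="\<lambda>t. euler_path f h t - euler_path f h' t"])
    show "continuous_on {0..T} (\<lambda>t. euler_path f h t - euler_path f h' t)"
      using assms by (intro continuous_on_diff continuous_euler_path)
    show "euler_path f h 0 - euler_path f h' 0 \<le> 2 * e" using e by (simp add: euler_path_def set_lebesgue_integral_def)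
    fix s t assume st: "0 \<le> s" "s \<le> t" "t \<le> T"
      and big: "\<forall>r\<in>{s<..<t}. 2 * e < euler_path f h r - euler_path f h' r"
    have le: "euler_drift f h r \<le> euler_drift f h' r" if "r \<in> {s<..<t}" for r
    proof -
      have "euler f h' (nat \<lfloor>r / h'\<rfloor>) \<le> euler f h (nat \<lfloor>r / h\<rfloor>)"
        using near[of h r] near[of h' r] big that assms st by fastforce
      then show ?thesis unfolding euler_drift_def using antimono_f[of r] by (auto dest: antimonoD)
    qed
    \<comment> \<open>The ordering of the drifts is known on the open interval only; the left end
      point is a null set.\<close>
    have "(LBINT r:{s..<t}. euler_drift f h r) \<le> (LBINT r:{s..<t}. euler_drift f h' r)"
      using st assms le AE_lborel_singleton[of s]
      by (intro set_integral_mono_AE set_integrable_euler_drift) (auto elim!: eventually_mono)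
    then show "euler_path f h t - euler_path f h' t \<le> euler_path f h s - euler_path f h' s"
      using euler_path_diff[of h s t] euler_path_diff[of h' s t] st assms by simp
  qed
qed

lemma euler_path_tendsto:
  assumes t: "t \<in> {0..T}"
  shows "(\<lambda>n. euler_path f (1 / real (Suc n)) t) \<longlonglongrightarrow> euler_limit f t"
proof -
  have "Cauchy (\<lambda>n. euler_path f (1 / real (Suc n)) t)"
  proof (rule metric_CauchyI)
    fix e :: real assume e: "0 < e"
    \<comment> \<open>A difference of paths is at most twice the modulus, so \<open>e / 3\<close>
      leaves room for a strict bound. The estimate is one-sided and is used in both orders.\<close>
    then obtain \<delta> where \<delta>: "\<delta> > 0" "\<And>s t. 0 \<le> s \<Longrightarrow> s \<le> t \<Longrightarrow> t \<le> T \<Longrightarrow> t - s < \<delta> \<Longrightarrow> (LBINT r:{s..<t}. bnd r) < e / 3"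
      using small_bnd[of "e / 3"] by auto
    obtain N where N: "1 / real (Suc N) < \<delta>" using \<delta>(1) nat_approx_posE by blast
    have le: "1 / real (Suc n) \<le> \<delta>" if "n \<ge> N" for n
    proof -
      have "1 / real (Suc n) \<le> 1 / real (Suc N)" using that by (intro divide_left_mono) auto
      then show ?thesis using N by simp
    qed
    have "dist (euler_path f (1 / real (Suc m)) t) (euler_path f (1 / real (Suc n)) t) < e"
      if "m \<ge> N" "n \<ge> N" for m n
      using euler_path_close[OF _ _ le[OF that(1)] le[OF that(2)] \<delta>(2) t]
        euler_path_close[OF _ _ le[OF that(2)] le[OF that(1)] \<delta>(2) t] e
      by (auto simp: dist_real_def abs_if)
    then show "\<exists>M. \<forall>m\<ge>M. \<forall>n\<ge>M. dist (euler_path f (1 / real (Suc m)) t) (euler_path f (1 / real (Suc n)) t) < e"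
      by blast
  qed
  then show ?thesis unfolding euler_limit_def by (simp add: Cauchy_convergent_iff convergent_LIMSEQ_iff)
qed

lemma abs_euler_limit_diff_le:
  assumes "0 \<le> s" "s \<le> t" "t \<le> T"
  shows "\<bar>euler_limit f t - euler_limit f s\<bar> \<le> (LBINT r:{s..<t}. bnd r)"
proof (rule LIMSEQ_le_const2)
  show "(\<lambda>n. \<bar>euler_path f (1 / real (Suc n)) t - euler_path f (1 / real (Suc n)) s\<bar>) \<longlonglongrightarrow> \<bar>euler_limit f t - euler_limit f s\<bar>"
    using assms by (intro tendsto_intros euler_path_tendsto) auto
qed (use abs_euler_path_diff_le assms in auto)

lemma euler_tendsto:
  assumes t: "t \<in> {0..T}"
  shows "(\<lambda>n. euler f (1 / real (Suc n)) (nat \<lfloor>t / (1 / real (Suc n))\<rfloor>)) \<longlonglongrightarrow> euler_limit f t"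
proof -
  let ?h = "\<lambda>n. 1 / real (Suc n)"
  have "(\<lambda>n. euler f (?h n) (nat \<lfloor>t / ?h n\<rfloor>) - euler_path f (?h n) t) \<longlonglongrightarrow> 0"
  proof (rule LIMSEQ_I)
    fix e :: real assume "0 < e"
    then obtain \<delta> where \<delta>: "\<delta> > 0" "\<And>s t. 0 \<le> s \<Longrightarrow> s \<le> t \<Longrightarrow> t \<le> T \<Longrightarrow> t - s < \<delta> \<Longrightarrow> (LBINT r:{s..<t}. bnd r) < e"
      using small_bnd by metis
    obtain N where N: "1 / real (Suc N) < \<delta>" using \<delta>(1) nat_approx_posE by blast
    have "norm (euler f (?h n) (nat \<lfloor>t / ?h n\<rfloor>) - euler_path f (?h n) t - 0) < e" if "n \<ge> N" for n
    proof -
      have "?h n \<le> ?h N" using that by (intro divide_left_mono) auto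
      then have "?h n \<le> \<delta>" using N by simp
      moreover have h: "0 < ?h n" by simp
      ultimately have "(LBINT r:{real (nat \<lfloor>t / ?h n\<rfloor>) * ?h n..<t}. bnd r) < e"
        using grid_point[OF h, of t] t by (intro \<delta>(2)) auto
      then show ?thesis
        using abs_euler_path_grid_le[OF h t] unfolding real_norm_def by linarith
    qed
    then show "\<exists>no. \<forall>n\<ge>no. norm (euler f (?h n) (nat \<lfloor>t / ?h n\<rfloor>) - euler_path f (?h n) t - 0) < e" by blast
  qed
  from tendsto_add[OF this euler_path_tendsto[OF t]] show ?thesis by simp
qed

text \<open>Dominated convergence with majorant \<open>bnd\<close>. Monotonicity already gives
  convergence of the paths; continuity at the limit, for almost every time, is what identifies the
  limit of the drifts.\<close>

lemma euler_limit_solution: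
  assumes t: "t \<in> {0..T}"
    and meas: "euler_limit f \<in> borel_measurable borel"
    and cont: "AE s in lborel. s \<in> {0..T} \<longrightarrow> isCont (f s) (euler_limit f s)"
  shows "set_integrable lborel {0..<t} (\<lambda>s. f s (euler_limit f s))"
    and "euler_limit f t = (LBINT s:{0..<t}. f s (euler_limit f s))"
proof -
  let ?h = "\<lambda>n. 1 / real (Suc n)"
  note [measurable] = meas
  have conv: "AE s in lborel. (\<lambda>n. indicator {0..<t} s *\<^sub>R euler_drift f (?h n) s)
      \<longlonglongrightarrow> indicator {0..<t} s *\<^sub>R f s (euler_limit f s)"
    using cont
  proof eventually_elim
    case (elim s)
    then show ?case
      unfolding euler_drift_def using t euler_tendsto[of s]
      by (cases "s \<in> {0..<t}") (auto intro!: tendsto_intros isCont_tendsto_compose[where g="f s"])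
  qed
  have dom: "AE s in lborel. norm (indicator {0..<t} s *\<^sub>R euler_drift f (?h n) s) \<le> indicator {0..<t} s *\<^sub>R bnd s" for n
    using abs_euler_drift_le[of "?h n"] t by (auto simp: indicator_def)
  have int: "integrable lborel (\<lambda>s. indicator {0..<t} s *\<^sub>R bnd s)"
    using set_integrable_bnd by (simp add: set_integrable_def)
  show "set_integrable lborel {0..<t} (\<lambda>s. f s (euler_limit f s))"
    unfolding set_integrable_def
    by (rule integrable_dominated_convergence[OF _ _ int conv dom]; measurable)
  have "(\<lambda>n. \<integral>s. indicator {0..<t} s *\<^sub>R euler_drift f (?h n) s \<partial>lborel)
      \<longlonglongrightarrow> (\<integral>s. indicator {0..<t} s *\<^sub>R f s (euler_limit f s) \<partial>lborel)"
    by (rule integral_dominated_convergence[OF _ _ int conv dom]; measurable)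
  then have "(\<lambda>n. euler_path f (?h n) t) \<longlonglongrightarrow> (LBINT s:{0..<t}. f s (euler_limit f s))"
    by (simp add: euler_path_def set_lebesgue_integral_def)
  from LIMSEQ_unique[OF euler_path_tendsto[OF t] this]
  show "euler_limit f t = (LBINT s:{0..<t}. f s (euler_limit f s))" .
qed

end

section \<open>Step functions and their Wiener integrals\<close>

text \<open>Cuts every interval at \<open>u\<close>. Since \<open>min a u\<close> and
  \<open>max a u\<close> are \<open>a\<close> and \<open>u\<close> in some order, the extra terms
  \<open>W u\<close> of each triple cancel. The first part will be known at time \<open>u\<close>,
  the second independent of the past.\<close>

lemma step_wiener_integral_min_max:
  "step_wiener_integral W \<phi> \<omega> =
     step_wiener_integral W (map (\<lambda>(c, a, b). (c, min a u, min b u)) \<phi>) \<omega> +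
     step_wiener_integral W (map (\<lambda>(c, a, b). (c, max a u, max b u)) \<phi>) \<omega>"
  by (induction \<phi>) (auto simp: step_wiener_integral_def algebra_simps min_def max_def)

lemma step_function_max:
  assumes "\<forall>(c, a, b)\<in>set \<phi>. a \<le> b"
  shows "step_function (map (\<lambda>(c, a, b). (c, max a u, max b u)) \<phi>) s = indicator {u<..} s * step_function \<phi> s"
  using assms
proof (induction \<phi>)
  case Nil
  then show ?case by (simp add: step_function_def)
next
  case (Cons x \<phi>)
  obtain c a b where x: "x = (c, a, b)" by (cases x)
  have "step_function (map (\<lambda>(c, a, b). (c, max a u, max b u)) \<phi>) s = indicator {u<..} s * step_function \<phi> s"
    using Cons.prems by (intro Cons.IH) auto
  moreover have "a \<le> b" using Cons.prems x by auto
  ultimately show ?case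
    by (auto simp: step_function_def x indicator_def algebra_simps max_def)
qed

lemma measurable_step_function [measurable]: "step_function \<phi> \<in> borel_measurable borel"
proof -
  have "step_function \<phi> = (\<lambda>s. \<Sum>i<length \<phi>. fst (\<phi> ! i) * indicator {fst (snd (\<phi> ! i))<..snd (snd (\<phi> ! i))} s)"
    by (simp add: fun_eq_iff step_function_def sum_list_sum_nth case_prod_unfold atLeast0LessThan)
  moreover have "\<dots> \<in> borel_measurable borel" by measurable
  ultimately show ?thesis by simp
qed

lemma sum_telescope_between:
  fixes V :: "real \<Rightarrow> real" and p :: "nat \<Rightarrow> real"
  assumes p: "strict_mono_on {..N} p" and ij: "i \<le> j" "j \<le> N"
  shows "V (p j) - V (p i) = (\<Sum>l<N. (if p i \<le> p l \<and> p (Suc l) \<le> p j then 1 else 0) * (V (p (Suc l)) - V (p l)))"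
proof -
  have "(\<Sum>l<N. (if p i \<le> p l \<and> p (Suc l) \<le> p j then 1 else 0) * (V (p (Suc l)) - V (p l)))
      = (\<Sum>l<N. if l \<in> {i..<j} then V (p (Suc l)) - V (p l) else 0)"
    using strict_mono_on_leD[OF p] strict_mono_on_less_eq[OF p] ij
    by (intro sum.cong) auto
  also have "\<dots> = (\<Sum>l\<in>{i..<j}. V (p (Suc l)) - V (p l))"
    using ij by (intro sum.mono_neutral_cong_right) auto
  also have "\<dots> = V (p j) - V (p i)" using ij(1) by (rule sum_Suc_diff')
  finally show ?thesis by simp
qed

lemma finite_grid:
  fixes E :: "real set"
  assumes "finite E" "E \<noteq> {}"
  obtains p N where "strict_mono_on {..N} p" "p ` {..N::nat} = E"
proof -
  let ?l = "sorted_list_of_set E"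
  define N where "N = card E - 1"
  have N: "{..N} = {..<length ?l}" using assms unfolding N_def
    using card_gt_0_iff[of E] by (auto simp: less_Suc_eq_le[symmetric])
  have "strict_mono_on {..N} (nth ?l)"
    unfolding N using strict_sorted_list_of_set[of E]
    by (intro strict_mono_onI) (auto simp: sorted_wrt_iff_nth_less)
  moreover have "nth ?l ` {..N} = E"
    unfolding N using assms nth_image[of "length ?l" ?l] by (simp add: atLeast0LessThan)
  ultimately show ?thesis by (rule that)
qed

text \<open>Stated for an arbitrary function \<open>V\<close> so that it applies to the integral
  (\<open>V\<close> a path of \<open>W\<close>) and to the step function itself (\<open>V\<close> an
  indicator) with the same coefficients \<open>d\<close>.\<close>

lemma step_grid:
  fixes \<phi> :: "(real \<times> real \<times> real) list"
  assumes p: "strict_mono_on {..N} p"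
    and \<phi>: "\<forall>(c, a, b)\<in>set \<phi>. a \<le> b \<and> a \<in> p ` {..N} \<and> b \<in> p ` {..N}"
  defines "d \<equiv> (\<lambda>j. \<Sum>(c, a, b)\<leftarrow>\<phi>. c * (if a \<le> p j \<and> p (Suc j) \<le> b then 1 else 0))"
  shows "(\<Sum>(c, a, b)\<leftarrow>\<phi>. c * (V b - V a)) = (\<Sum>j<N. d j * (V (p (Suc j)) - V (p j)))"
  using \<phi> unfolding d_def
proof (induction \<phi>)
  case Nil
  then show ?case by simp
next
  case (Cons x \<phi>)
  obtain c a b where x: "x = (c, a, b)" by (cases x)
  obtain i j where ij: "a = p i" "b = p j" "i \<le> N" "j \<le> N" "p i \<le> p j" using Cons.prems x by auto
  then have le: "i \<le> j" using strict_mono_on_less_eq[OF p] by auto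
  have eq: "V b - V a = (\<Sum>l<N. (if a \<le> p l \<and> p (Suc l) \<le> b then 1 else 0) * (V (p (Suc l)) - V (p l)))"
    unfolding ij(1,2) by (rule sum_telescope_between[OF p le ij(4)])
  have "(\<Sum>(c, a, b)\<leftarrow>\<phi>. c * (V b - V a)) = (\<Sum>j<N. (\<Sum>(c, a, b)\<leftarrow>\<phi>. c * (if a \<le> p j \<and> p (Suc j) \<le> b then 1 else 0)) * (V (p (Suc j)) - V (p j)))"
    using Cons.prems by (intro Cons.IH) auto
  then show ?case
    by (simp add: x eq sum_distrib_left distrib_right sum.distrib mult.assoc)
qed

lemma step_function_grid:
  assumes p: "strict_mono_on {..N} p"
    and \<phi>: "\<forall>(c, a, b)\<in>set \<phi>. a \<le> b \<and> a \<in> p ` {..N} \<and> b \<in> p ` {..N}"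
  defines "d \<equiv> (\<lambda>j. \<Sum>(c, a, b)\<leftarrow>\<phi>. c * (if a \<le> p j \<and> p (Suc j) \<le> b then 1 else 0))"
  shows "step_function \<phi> s = (\<Sum>j<N. d j * indicator {p j<..p (Suc j)} s)"
proof -
  \<comment> \<open>At a fixed \<open>s\<close> the indicator of an interval is an increment of
    \<open>V = indicator {s..}\<close>, which makes \<open>step_grid\<close> applicable.\<close>
  have *: "indicator {a<..b} s = (indicator {s..} b - indicator {s..} a :: real)" if "a \<le> b" for a b
    using that by (auto simp: indicator_def)
  have "step_function \<phi> s = (\<Sum>(c, a, b)\<leftarrow>\<phi>. c * (indicator {s..} b - indicator {s..} a))"
    unfolding step_function_def using \<phi> * by (intro arg_cong[where f=sum_list] map_cong refl) (auto simp del: indicator_simps)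
  also have "\<dots> = (\<Sum>j<N. d j * (indicator {s..} (p (Suc j)) - indicator {s..} (p j)))"
    unfolding d_def by (rule step_grid[OF p \<phi>])
  also have "\<dots> = (\<Sum>j<N. d j * indicator {p j<..p (Suc j)} s)"
    using strict_mono_on_leD[OF p] by (intro sum.cong) (auto simp: *)
  finally show ?thesis .
qed

text \<open>The cells are disjoint, so the square has no mixed terms. The right-hand side is also
  the variance of the corresponding combination of Brownian increments, which is the Ito
  isometry.\<close>

lemma nn_integral_step_function_square:
  assumes p: "strict_mono_on {..N} p"
    and \<phi>: "\<forall>(c, a, b)\<in>set \<phi>. a \<le> b \<and> a \<in> p ` {..N} \<and> b \<in> p ` {..N}"
  defines "d \<equiv> (\<lambda>j. \<Sum>(c, a, b)\<leftarrow>\<phi>. c * (if a \<le> p j \<and> p (Suc j) \<le> b then 1 else 0))"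
  shows "(\<integral>\<^sup>+s. ennreal ((step_function \<phi> s)\<^sup>2) \<partial>lborel) = ennreal (\<Sum>j<N. (d j)\<^sup>2 * (p (Suc j) - p j))"
proof -
  let ?I = "\<lambda>j. indicator {p j<..p (Suc j)} :: real \<Rightarrow> real"
  have ple: "p j \<le> p (Suc j)" if "j < N" for j using strict_mono_on_leD[OF p] that by auto
  have disj: "?I i s * ?I j s = 0" if "i < N" "j < N" "i \<noteq> j" for i j s
  proof -
    have "p (Suc i) \<le> p j \<or> p (Suc j) \<le> p i"
      using that strict_mono_on_leD[OF p, of "Suc i" j] strict_mono_on_leD[OF p, of "Suc j" i] by (cases "i < j") auto
    then show ?thesis by (auto simp: indicator_def)
  qed
  have eq: "step_function \<phi> s = (\<Sum>j<N. d j * ?I j s)" for s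
    unfolding d_def by (rule step_function_grid[OF p \<phi>])
  have "(step_function \<phi> s)\<^sup>2 = (\<Sum>j<N. (d j)\<^sup>2 * ?I j s)" for s
  proof -
    have "(step_function \<phi> s)\<^sup>2 = (\<Sum>i<N. \<Sum>j<N. (d i * ?I i s) * (d j * ?I j s))"
      unfolding eq power2_eq_square by (rule sum_product)
    also have "\<dots> = (\<Sum>i<N. \<Sum>j<N. if j = i then (d i)\<^sup>2 * ?I i s else 0)"
    proof (intro sum.cong refl)
      fix i j assume "i \<in> {..<N}" "j \<in> {..<N}"
      then show "(d i * ?I i s) * (d j * ?I j s) = (if j = i then (d i)\<^sup>2 * ?I i s else 0)"
        using disj[of i j s] by (auto simp: power2_eq_square indicator_def)
    qed
    finally show ?thesis by (simp add: sum.delta)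
  qed
  then have "(\<integral>\<^sup>+s. ennreal ((step_function \<phi> s)\<^sup>2) \<partial>lborel) = (\<integral>\<^sup>+s. (\<Sum>j<N. ennreal ((d j)\<^sup>2) * indicator {p j<..p (Suc j)} s) \<partial>lborel)"
    by (intro nn_integral_cong) (auto simp: sum_nonneg ennreal_mult' ennreal_indicator simp flip: sum_ennreal)
  also have "\<dots> = (\<Sum>j<N. ennreal ((d j)\<^sup>2) * ennreal (p (Suc j) - p j))"
    by (subst nn_integral_sum) (auto intro!: sum.cong simp: nn_integral_cmult ple)
  also have "\<dots> = ennreal (\<Sum>j<N. (d j)\<^sup>2 * (p (Suc j) - p j))"
    using ple by (subst sum_ennreal[symmetric]) (auto simp: ennreal_mult' intro!: sum.cong)
  finally show ?thesis .
qed

section \<open>The augmented filtration modulo null sets\<close>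

lemma sets_augmented_filtration:
  "sets (augmented_filtration M W t) = sigma_sets (space M)
     ((\<Union>s\<in>{0..t}. {W s -` A \<inter> space M | A. A \<in> sets borel}) \<union> null_sets M)"
  unfolding augmented_filtration_def sets_measure_of[OF augmented_filtration_generators] ..

lemma space_augmented_filtration [simp]: "space (augmented_filtration M W t) = space M"
  using filtration_augmented_filtration[of M W] by (simp add: filtration_def)

lemma augmented_filtration_mono:
  assumes "s \<le> t" "Z \<in> borel_measurable (augmented_filtration M W s)"
  shows "Z \<in> borel_measurable (augmented_filtration M W t)"
proof -
  have "sets (augmented_filtration M W s) \<subseteq> sets (augmented_filtration M W t)"
    using filtration.sets_F_mono[OF filtration_augmented_filtration assms(1)] .
  then show ?thesis using assms(2) by (intro measurableI) (auto dest!: measurable_sets)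
qed

text \<open>The null set where the two functions differ, and its intersection with any preimage,
  belong to every \<sigma>-algebra of the filtration. Hence limits that exist only almost surely
  preserve adaptedness.\<close>

lemma augmented_filtration_AE_cong:
  fixes Y Z :: "'a \<Rightarrow> real"
  assumes Z: "Z \<in> borel_measurable (augmented_filtration M W t)"
    and ZM: "Z \<in> borel_measurable M" and Y: "Y \<in> borel_measurable M"
    and ae: "AE \<omega> in M. Z \<omega> = Y \<omega>"
  shows "Y \<in> borel_measurable (augmented_filtration M W t)"
proof (rule measurableI)
  note [measurable] = ZM Y
  let ?F = "augmented_filtration M W t"
  have null: "A \<in> sets ?F" if "A \<in> null_sets M" for A
    using that unfolding sets_augmented_filtration by (intro sigma_sets.Basic) auto
  define N where "N = {\<omega>\<in>space M. Z \<omega> \<noteq> Y \<omega>}"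
  have N: "N \<in> null_sets M" using ae unfolding N_def by (subst (asm) AE_iff_null) auto
  fix D :: "real set" assume D: "D \<in> sets borel"
  note [measurable] = D
  have "N \<inter> Y -` D = N \<inter> (Y -` D \<inter> space M)" by (auto simp: N_def)
  then have "N \<inter> Y -` D \<in> null_sets M" using null_set_Int2[OF N, of "Y -` D \<inter> space M"]
    by (metis D Y measurable_sets Int_commute null_set_Int1[OF N])
  then have "N \<inter> Y -` D \<in> sets ?F" by (rule null)
  moreover have "Z -` D \<inter> space M \<in> sets ?F" using measurable_sets[OF Z D] by simp
  moreover have "Y -` D \<inter> space M = (Z -` D \<inter> space M - N) \<union> (N \<inter> Y -` D)" by (auto simp: N_def)
  ultimately show "Y -` D \<inter> space ?F \<in> sets ?F" using null[OF N] by auto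
qed simp

section \<open>Law and independence of step integrals\<close>

locale brownian = prob_space M for M :: "'a measure" +
  fixes W :: "real \<Rightarrow> 'a \<Rightarrow> real" and T :: real
  assumes brownian: "brownian_motion M T W"
begin

abbreviation "F \<equiv> augmented_filtration M W"

lemma measurable_W: "t \<in> {0..T} \<Longrightarrow> W t \<in> borel_measurable M"
  using brownian by (auto simp: brownian_motion_def)

lemma sets_F_subset: "t \<le> T \<Longrightarrow> sets (F t) \<subseteq> events"
  unfolding sets_augmented_filtration
  by (intro sets.sigma_sets_subset) (auto intro!: measurable_sets measurable_W)

lemma measurable_F_M: "t \<le> T \<Longrightarrow> Z \<in> borel_measurable (F t) \<Longrightarrow> Z \<in> borel_measurable M"
  using sets_F_subset[of t] by (intro measurableI) (auto dest!: measurable_sets)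

lemma W_adapted: "0 \<le> s \<Longrightarrow> s \<le> t \<Longrightarrow> W s \<in> borel_measurable (F t)"
  by (intro measurableI) (auto simp: sets_augmented_filtration intro!: sigma_sets.Basic)

lemma increments_normal:
  "0 \<le> s \<Longrightarrow> s < t \<Longrightarrow> t \<le> T \<Longrightarrow>
     distributed M lborel (\<lambda>\<omega>. W t \<omega> - W s \<omega>) (normal_density 0 (sqrt (t - s)))"
  using brownian by (auto simp: brownian_motion_def)

lemma increments_indep:
  assumes "strict_mono_on {..N} p" "p ` {..N} \<subseteq> {0..T}"
  shows "indep_vars (\<lambda>_. borel) (\<lambda>i \<omega>. W (p (Suc i)) \<omega> - W (p i) \<omega>) {..<N}"
proof -
  have "\<forall>i\<le>N. p i \<in> {0..T}" "\<forall>i<N. p i \<le> p (Suc i)"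
    using assms strict_mono_on_leD[OF assms(1)] by auto
  then show ?thesis using brownian unfolding brownian_motion_def by blast
qed

lemma step_wiener_adapted:
  assumes "\<forall>(c, a, b)\<in>set \<phi>. 0 \<le> a \<and> a \<le> b \<and> b \<le> t"
  shows "step_wiener_integral W \<phi> \<in> borel_measurable (F t)"
proof -
  have "step_wiener_integral W \<phi> = (\<lambda>\<omega>. \<Sum>i<length \<phi>. fst (\<phi> ! i) * (W (snd (snd (\<phi> ! i))) \<omega> - W (fst (snd (\<phi> ! i))) \<omega>))"
    by (simp add: fun_eq_iff step_wiener_integral_def sum_list_sum_nth case_prod_unfold atLeast0LessThan)
  moreover have "\<dots> \<in> borel_measurable (F t)"
  proof (intro borel_measurable_sum borel_measurable_times borel_measurable_diff borel_measurable_const W_adapted)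
    fix i assume "i \<in> {..<length \<phi>}"
    then have "\<phi> ! i \<in> set \<phi>" by simp
    then have "(fst (\<phi> ! i), fst (snd (\<phi> ! i)), snd (snd (\<phi> ! i))) \<in> set \<phi>" by simp
    from bspec[OF assms this]
    show "0 \<le> snd (snd (\<phi> ! i))" "snd (snd (\<phi> ! i)) \<le> t" "0 \<le> fst (snd (\<phi> ! i))" "fst (snd (\<phi> ! i)) \<le> t" by auto
  qed
  ultimately show ?thesis by simp
qed

text \<open>The set \<open>I\<close> adds times that must be grid points besides the end points of
  the intervals; being nonempty, it also covers the empty list of triples.\<close>

lemma grid_containing:
  fixes \<phi> :: "(real \<times> real \<times> real) list"
  assumes "\<forall>(c, a, b)\<in>set \<phi>. 0 \<le> a \<and> a \<le> b \<and> b \<le> T"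
    and "finite I" "I \<noteq> {}" "I \<subseteq> {0..T}"
  obtains p N where "strict_mono_on {..N} p" "p ` {..N::nat} \<subseteq> {0..T}" "I \<subseteq> p ` {..N}"
    "\<forall>(c, a, b)\<in>set \<phi>. a \<le> b \<and> a \<in> p ` {..N} \<and> b \<in> p ` {..N}"
proof -
  define E where "E = I \<union> (\<Union>(c, a, b)\<in>set \<phi>. {a, b})"
  have "finite E" "E \<noteq> {}" using assms by (auto simp: E_def)
  then obtain p N where pN: "strict_mono_on {..N} p" "p ` {..N::nat} = E" by (rule finite_grid)
  show ?thesis
  proof (rule that[OF pN(1)])
    have \<phi>: "a \<in> {0..T} \<and> b \<in> {0..T} \<and> a \<le> b" if "(c, a, b) \<in> set \<phi>" for c a b
      using bspec[OF assms(1) that] by auto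
    show "p ` {..N} \<subseteq> {0..T}" unfolding pN(2) E_def using \<phi> assms(4) by blast
    show "I \<subseteq> p ` {..N}" unfolding pN(2) E_def by auto
    have "a \<le> b \<and> a \<in> E \<and> b \<in> E" if "(c, a, b) \<in> set \<phi>" for c a b
      using \<phi>[OF that] that unfolding E_def by blast
    then show "\<forall>(c, a, b)\<in>set \<phi>. a \<le> b \<and> a \<in> p ` {..N} \<and> b \<in> p ` {..N}"
      unfolding pN(2) by blast
  qed
qed

lemma nn_integral_step_function_square_finite:
  assumes \<phi>: "\<forall>(c, a, b)\<in>set \<phi>. 0 \<le> a \<and> a \<le> b \<and> b \<le> T" and "0 \<le> T"
  shows "(\<integral>\<^sup>+s. ennreal ((step_function \<phi> s)\<^sup>2) \<partial>lborel) < \<infinity>"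
proof -
  have *: "finite {0::real}" "{0::real} \<noteq> {}" "{0} \<subseteq> {0..T}" using \<open>0 \<le> T\<close> by auto
  obtain p N where p: "strict_mono_on {..N} p" "p ` {..N::nat} \<subseteq> {0..T}" "{0} \<subseteq> p ` {..N}"
    and p\<phi>: "\<forall>(c, a, b)\<in>set \<phi>. a \<le> b \<and> a \<in> p ` {..N} \<and> b \<in> p ` {..N}"
    by (rule grid_containing[OF \<phi> *])
  show ?thesis using nn_integral_step_function_square[OF p(1) p\<phi>] by simp
qed

text \<open>On a grid the integral is a linear combination of independent centred normal increments.
  Zero variance is a separate case because \<open>normal_density 0 0\<close> is not a probability
  density; then all coefficients vanish and the integral is 0 everywhere.\<close>

lemma step_wiener_normal:
  assumes \<phi>: "\<forall>(c, a, b)\<in>set \<phi>. 0 \<le> a \<and> a \<le> b \<and> b \<le> T" and "0 \<le> T"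
    and \<sigma>: "(\<integral>\<^sup>+s. ennreal ((step_function \<phi> s)\<^sup>2) \<partial>lborel) = ennreal (\<sigma>\<^sup>2)" "0 \<le> \<sigma>"
  shows "if \<sigma> = 0 then step_wiener_integral W \<phi> = (\<lambda>_. 0)
    else distributed M lborel (step_wiener_integral W \<phi>) (normal_density 0 \<sigma>)"
proof -
  have *: "finite {0::real}" "{0::real} \<noteq> {}" "{0} \<subseteq> {0..T}" using \<open>0 \<le> T\<close> by auto
  obtain p N where p: "strict_mono_on {..N} p" "p ` {..N::nat} \<subseteq> {0..T}" "{0} \<subseteq> p ` {..N}"
    and p\<phi>: "\<forall>(c, a, b)\<in>set \<phi>. a \<le> b \<and> a \<in> p ` {..N} \<and> b \<in> p ` {..N}"
    by (rule grid_containing[OF \<phi> *])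
  define d where "d = (\<lambda>j. \<Sum>(c, a, b)\<leftarrow>\<phi>. c * (if a \<le> p j \<and> p (Suc j) \<le> b then 1 else (0::real)))"
  let ?X = "\<lambda>j \<omega>. W (p (Suc j)) \<omega> - W (p j) \<omega>"
  have plt: "p j < p (Suc j)" if "j < N" for j
    using that strict_mono_onD[OF p(1), of j "Suc j"] by auto
  have eq: "step_wiener_integral W \<phi> \<omega> = (\<Sum>j<N. d j * ?X j \<omega>)" for \<omega>
    unfolding step_wiener_integral_def d_def using p\<phi> by (intro step_grid[OF p(1)])
  \<comment> \<open>The sum rule for independent normal variables asks for positive standard
    deviations, so cells with coefficient 0 are dropped first.\<close>
  define J where "J = {j\<in>{..<N}. d j \<noteq> 0}"
  have eqJ: "step_wiener_integral W \<phi> = (\<lambda>\<omega>. \<Sum>j\<in>J. d j * ?X j \<omega>)"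
    unfolding eq J_def by (intro ext sum.mono_neutral_right) auto
  have "ennreal (\<sigma>\<^sup>2) = ennreal (\<Sum>j<N. (d j)\<^sup>2 * (p (Suc j) - p j))"
    unfolding \<sigma>(1)[symmetric] d_def using p\<phi> by (intro nn_integral_step_function_square[OF p(1)])
  moreover have "0 \<le> (\<Sum>j<N. (d j)\<^sup>2 * (p (Suc j) - p j))"
    using plt by (intro sum_nonneg mult_nonneg_nonneg) (auto intro: less_imp_le)
  ultimately have "\<sigma>\<^sup>2 = (\<Sum>j<N. (d j)\<^sup>2 * (p (Suc j) - p j))" by simp
  also have "\<dots> = (\<Sum>j\<in>J. (d j)\<^sup>2 * (p (Suc j) - p j))"
    unfolding J_def by (intro sum.mono_neutral_right) auto
  finally have var: "\<sigma>\<^sup>2 = (\<Sum>j\<in>J. (d j)\<^sup>2 * (p (Suc j) - p j))" .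
  have pos: "0 < (d j)\<^sup>2 * (p (Suc j) - p j)" if "j \<in> J" for j
    using that plt[of j] by (auto simp: J_def)
  have finJ: "finite J" by (simp add: J_def)
  show ?thesis
  proof (cases "J = {}")
    case True
    then show ?thesis using var eqJ by simp
  next
    case False
    then have "0 < \<sigma>\<^sup>2" unfolding var using pos finJ by (intro sum_pos) auto
    then have "\<sigma> \<noteq> 0" by auto
    have "distributed M lborel (\<lambda>\<omega>. \<Sum>j\<in>J. d j * ?X j \<omega>)
       (normal_density (\<Sum>j\<in>J. 0) (sqrt (\<Sum>j\<in>J. (\<bar>d j\<bar> * sqrt (p (Suc j) - p j))\<^sup>2)))"
    proof (rule sum_indep_normal[OF finJ False])
      have "indep_vars (\<lambda>_. borel) ?X J"
        using increments_indep[OF p(1,2)] by (rule indep_vars_subset) (auto simp: J_def)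
      then show "indep_vars (\<lambda>_. borel) (\<lambda>j \<omega>. d j * ?X j \<omega>) J"
        by (rule indep_vars_compose2[where Y="\<lambda>j x. d j * x"]) auto
      fix j assume j: "j \<in> J"
      then have jN: "j < N" "d j \<noteq> 0" by (auto simp: J_def)
      then show "0 < \<bar>d j\<bar> * sqrt (p (Suc j) - p j)" using plt[of j] by auto
      have "p j \<in> {0..T}" "p (Suc j) \<in> {0..T}" using subsetD[OF p(2) imageI[of _ _ p]] jN by auto
      then have "distributed M lborel (?X j) (normal_density 0 (sqrt (p (Suc j) - p j)))"
        using plt[OF jN(1)] by (intro increments_normal) auto
      from normal_density_affine[OF this _ jN(2), of 0] plt[OF jN(1)]
      show "distributed M lborel (\<lambda>\<omega>. d j * ?X j \<omega>) (normal_density 0 (\<bar>d j\<bar> * sqrt (p (Suc j) - p j)))"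
        by simp
    qed
    moreover have "(\<Sum>j\<in>J. (\<bar>d j\<bar> * sqrt (p (Suc j) - p j))\<^sup>2) = \<sigma>\<^sup>2"
      unfolding var using plt by (intro sum.cong) (auto simp: power_mult_distrib J_def less_imp_le)
    ultimately show ?thesis using \<sigma>(2) \<open>\<sigma> \<noteq> 0\<close> unfolding eqJ by simp
  qed
qed

text \<open>Ito isometry for step functions, read off from the variance of the normal law.\<close>

lemma step_wiener_second_moment:
  assumes \<phi>: "\<forall>(c, a, b)\<in>set \<phi>. 0 \<le> a \<and> a \<le> b \<and> b \<le> T" and "0 \<le> T"
  shows "(\<integral>\<^sup>+\<omega>. ennreal ((step_wiener_integral W \<phi> \<omega>)\<^sup>2) \<partial>M) = (\<integral>\<^sup>+s. ennreal ((step_function \<phi> s)\<^sup>2) \<partial>lborel)"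
proof -
  have "(\<integral>\<^sup>+s. ennreal ((step_function \<phi> s)\<^sup>2) \<partial>lborel) < \<infinity>"
    using assms by (rule nn_integral_step_function_square_finite)
  then obtain v where v: "0 \<le> v" "(\<integral>\<^sup>+s. ennreal ((step_function \<phi> s)\<^sup>2) \<partial>lborel) = ennreal v"
    by (metis ennreal_cases infinity_ennreal_def less_irrefl)
  then have \<sigma>: "(\<integral>\<^sup>+s. ennreal ((step_function \<phi> s)\<^sup>2) \<partial>lborel) = ennreal ((sqrt v)\<^sup>2)" "0 \<le> sqrt v" by auto
  note normal = step_wiener_normal[OF \<phi> \<open>0 \<le> T\<close> \<sigma>]
  show ?thesis
  proof (cases "sqrt v = 0")
    case True
    then show ?thesis using normal \<sigma> by simp
  next
    case False
    then have dist: "distributed M lborel (step_wiener_integral W \<phi>) (normal_density 0 (sqrt v))" and pos: "0 < sqrt v"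
      using normal v by auto
    have "(\<integral>\<^sup>+\<omega>. ennreal ((step_wiener_integral W \<phi> \<omega>)\<^sup>2) \<partial>M)
        = (\<integral>\<^sup>+x. ennreal (normal_density 0 (sqrt v) x) * ennreal (x\<^sup>2) \<partial>lborel)"
      by (rule distributed_nn_integral[OF dist, symmetric]) simp
    also have "\<dots> = (\<integral>\<^sup>+x. ennreal (normal_density 0 (sqrt v) x * (x - 0) ^ (2 * 1)) \<partial>lborel)"
      by (simp add: ennreal_mult')
    also have "\<dots> = ennreal (fact (2 * 1) / ((2 / (sqrt v)\<^sup>2) ^ 1 * fact 1))"
      using normal_moment_even[OF pos, of 0 1]
      by (intro nn_integral_eq_integral[THEN trans] arg_cong[where f=ennreal])
        (auto simp: has_bochner_integral_iff)
    also have "\<dots> = ennreal v" using v pos by simp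
    finally show ?thesis using v by simp
  qed
qed

text \<open>On a grid through 0, \<open>u\<close> and the cylinder times, the values of
  \<open>W\<close> at these times are sums of increments before \<open>u\<close>, while the integral
  uses only increments after \<open>u\<close>. Disjoint families of increments are
  independent.\<close>

lemma cylinder_indep:
  assumes \<phi>: "\<forall>(c, a, b)\<in>set \<phi>. u \<le> a \<and> a \<le> b \<and> b \<le> T" and u: "0 \<le> u" "u \<le> T"
    and I: "finite I" "I \<subseteq> {0..u}" and A: "\<And>s. A s \<in> sets borel" and D: "D \<in> sets borel"
  shows "prob ({\<omega>\<in>space M. \<forall>s\<in>I. W s \<omega> \<in> A s} \<inter> {\<omega>\<in>space M. step_wiener_integral W \<phi> \<omega> \<in> D}) =
    prob {\<omega>\<in>space M. \<forall>s\<in>I. W s \<omega> \<in> A s} * prob {\<omega>\<in>space M. step_wiener_integral W \<phi> \<omega> \<in> D}"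
proof -
  have \<phi>0: "\<forall>(c, a, b)\<in>set \<phi>. 0 \<le> a \<and> a \<le> b \<and> b \<le> T" using \<phi> u by fastforce
  have *: "finite ({0, u} \<union> I)" "{0, u} \<union> I \<noteq> {}" "{0, u} \<union> I \<subseteq> {0..T}" using I u by auto
  obtain p N where p: "strict_mono_on {..N} p" "p ` {..N::nat} \<subseteq> {0..T}" "{0, u} \<union> I \<subseteq> p ` {..N}"
    and p\<phi>: "\<forall>(c, a, b)\<in>set \<phi>. a \<le> b \<and> a \<in> p ` {..N} \<and> b \<in> p ` {..N}"
    by (rule grid_containing[OF \<phi>0 *])
  define d where "d = (\<lambda>j. \<Sum>(c, a, b)\<leftarrow>\<phi>. c * (if a \<le> p j \<and> p (Suc j) \<le> b then 1 else (0::real)))"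
  define X where "X = (\<lambda>j \<omega>. W (p (Suc j)) \<omega> - W (p j) \<omega>)"
  obtain k where k: "k \<le> N" "p k = u" using p(3) by auto
  have p0: "p 0 = 0"
  proof -
    obtain j where "j \<le> N" "p j = 0" using p(3) by auto
    then show ?thesis using strict_mono_on_leD[OF p(1), of 0 j] p(2) by fastforce
  qed
  have eq: "step_wiener_integral W \<phi> \<omega> = (\<Sum>j<N. d j * X j \<omega>)" for \<omega>
    unfolding step_wiener_integral_def d_def X_def using p\<phi> by (intro step_grid[OF p(1)])
  \<comment> \<open>A cell that starts before \<open>u\<close> is contained in none of the intervals
    of \<phi>, all of which start at \<open>u\<close> or later.\<close>
  have d0: "d j = 0" if "j < k" for j
  proof -
    have "p j < u" using strict_mono_onD[OF p(1), of j k] that k by auto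
    then have "map (\<lambda>(c, a, b). c * (if a \<le> p j \<and> p (Suc j) \<le> b then 1 else (0::real))) \<phi> = map (\<lambda>_. 0) \<phi>"
      using \<phi> by (intro map_cong) fastforce+
    then show ?thesis unfolding d_def by (simp only: sum_list_0)
  qed
  have eqk: "step_wiener_integral W \<phi> \<omega> = (\<Sum>j\<in>{k..<N}. d j * X j \<omega>)" for \<omega>
    unfolding eq using d0 by (intro sum.mono_neutral_right) auto
  have "\<forall>s\<in>I. \<exists>i\<le>k. p i = s"
  proof
    fix s assume s: "s \<in> I"
    then obtain i where "i \<le> N" "p i = s" using p(3) by auto
    then show "\<exists>i\<le>k. p i = s" using s I(2) k strict_mono_on_less_eq[OF p(1), of i k] by auto
  qed
  then obtain i where i: "\<And>s. s \<in> I \<Longrightarrow> i s \<le> k \<and> p (i s) = s" by metis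
  \<comment> \<open>The cylinder event as a 0-1 valued function of the increments, so that
    independence can be used for real random variables. Partial sums of increments give
    \<open>W s - W 0\<close> and not \<open>W s\<close>.\<close>
  define c :: "(nat \<Rightarrow> real) \<Rightarrow> real" where "c = (\<lambda>x. if \<forall>s\<in>I. (\<Sum>j<i s. x j) \<in> A s then 1 else 0)"
  define g where "g = (\<lambda>x::nat \<Rightarrow> real. \<Sum>j\<in>{k..<N}. d j * x j)"
  have ind: "indep_vars (\<lambda>_. borel) X {..<N}"
    unfolding X_def by (rule increments_indep[OF p(1,2)])
  have "indep_var (PiM {..<k} (\<lambda>_. borel)) (\<lambda>\<omega>. restrict (\<lambda>j. X j \<omega>) {..<k})
      (PiM {k..<N} (\<lambda>_. borel)) (\<lambda>\<omega>. restrict (\<lambda>j. X j \<omega>) {k..<N})"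
    using k by (intro indep_var_restrict[OF ind]) auto
  then have "indep_var borel (c \<circ> (\<lambda>\<omega>. restrict (\<lambda>j. X j \<omega>) {..<k})) borel (g \<circ> (\<lambda>\<omega>. restrict (\<lambda>j. X j \<omega>) {k..<N}))"
  proof (rule indep_var_compose)
    have "{x \<in> space (PiM {..<k} (\<lambda>_. borel)). \<forall>s\<in>I. (\<Sum>j<i s. x j) \<in> A s} \<in> sets (PiM {..<k} (\<lambda>_. borel))"
    proof (intro sets.sets_Collect_finite_All I)
      fix s assume "s \<in> I"
      then have [measurable]: "(\<lambda>x. \<Sum>j<i s. x j) \<in> borel_measurable (PiM {..<k} (\<lambda>_. borel :: real measure))"
        using i[of s] by (intro borel_measurable_sum measurable_component_singleton) auto
      note [measurable] = A
      show "{x \<in> space (PiM {..<k} (\<lambda>_. borel)). (\<Sum>j<i s. x j) \<in> A s} \<in> sets (PiM {..<k} (\<lambda>_. borel))"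
        by measurable
    qed
    then show "c \<in> borel_measurable (PiM {..<k} (\<lambda>_. borel))"
      unfolding c_def by (intro measurable_If) auto
    show "g \<in> borel_measurable (PiM {k..<N} (\<lambda>_. borel))"
      unfolding g_def by (intro borel_measurable_sum borel_measurable_times borel_measurable_const measurable_component_singleton) auto
  qed
  moreover have "g (restrict (\<lambda>j. X j \<omega>) {k..<N}) = step_wiener_integral W \<phi> \<omega>" for \<omega>
    unfolding g_def eqk by (intro sum.cong) auto
  moreover have "c (restrict (\<lambda>j. X j \<omega>) {..<k}) = (if \<forall>s\<in>I. W s \<omega> - W 0 \<omega> \<in> A s then 1 else 0)" for \<omega>
  proof -
    have "(\<Sum>j<i s. restrict (\<lambda>j. X j \<omega>) {..<k} j) = W s \<omega> - W 0 \<omega>" if "s \<in> I" for s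
    proof -
      have "(\<Sum>j<i s. restrict (\<lambda>j. X j \<omega>) {..<k} j) = (\<Sum>j<i s. X j \<omega>)"
        using i[OF that] by (intro sum.cong) auto
      also have "\<dots> = W (p (i s)) \<omega> - W (p 0) \<omega>"
        unfolding X_def by (rule sum_lessThan_telescope)
      finally show ?thesis using i[OF that] p0 by simp
    qed
    then show ?thesis unfolding c_def by (auto simp: Ball_def)
  qed
  ultimately have "indep_var borel (\<lambda>\<omega>. if \<forall>s\<in>I. W s \<omega> - W 0 \<omega> \<in> A s then 1 else 0) borel (step_wiener_integral W \<phi>)"
    by (simp only: comp_def)
  from indep_varD[OF this, of "{1}" D] D
  have prod: "prob ({\<omega>\<in>space M. \<forall>s\<in>I. W s \<omega> - W 0 \<omega> \<in> A s} \<inter> {\<omega>\<in>space M. step_wiener_integral W \<phi> \<omega> \<in> D}) =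
    prob {\<omega>\<in>space M. \<forall>s\<in>I. W s \<omega> - W 0 \<omega> \<in> A s} * prob {\<omega>\<in>space M. step_wiener_integral W \<phi> \<omega> \<in> D}"
    by (simp add: vimage_def Int_def conj_ac if_splits cong: conj_cong split: if_splits)
  have [measurable]: "W s \<in> borel_measurable M" if "s \<in> I \<union> {0}" for s
    using that I u by (intro measurable_W) auto
  have [measurable]: "step_wiener_integral W \<phi> \<in> borel_measurable M"
    using measurable_F_M[OF order_refl step_wiener_adapted] \<phi>0 by blast
  note [measurable] = A D
  have ev: "{\<omega>\<in>space M. \<forall>s\<in>I. W s \<omega> - W 0 \<omega> \<in> A s} \<in> events" "{\<omega>\<in>space M. \<forall>s\<in>I. W s \<omega> \<in> A s} \<in> events"
    by (intro sets.sets_Collect_finite_All I; measurable)+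
  \<comment> \<open>\<open>W 0 = 0\<close> holds only almost surely, so passing from
    \<open>W s - W 0\<close> back to \<open>W s\<close> changes events by null sets.\<close>
  have ae: "AE \<omega> in M. W 0 \<omega> = 0" using brownian by (auto simp: brownian_motion_def)
  have "prob {\<omega>\<in>space M. \<forall>s\<in>I. W s \<omega> \<in> A s} = prob {\<omega>\<in>space M. \<forall>s\<in>I. W s \<omega> - W 0 \<omega> \<in> A s}"
    using ae ev by (intro finite_measure_eq_AE) auto
  moreover have "prob ({\<omega>\<in>space M. \<forall>s\<in>I. W s \<omega> \<in> A s} \<inter> {\<omega>\<in>space M. step_wiener_integral W \<phi> \<omega> \<in> D})
      = prob ({\<omega>\<in>space M. \<forall>s\<in>I. W s \<omega> - W 0 \<omega> \<in> A s} \<inter> {\<omega>\<in>space M. step_wiener_integral W \<phi> \<omega> \<in> D})"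
    using ae ev by (intro finite_measure_eq_AE) (auto elim!: eventually_mono)
  ultimately show ?thesis using prod by simp
qed

lemma step_wiener_indep:
  assumes \<phi>: "\<forall>(c, a, b)\<in>set \<phi>. u \<le> a \<and> a \<le> b \<and> b \<le> T" and u: "0 \<le> u" "u \<le> T"
    and Z: "Z \<in> borel_measurable (F u)"
  shows "indep_var borel Z borel (step_wiener_integral W \<phi>)"
proof -
  let ?G = "step_wiener_integral W \<phi>"
  have \<phi>0: "\<forall>(c, a, b)\<in>set \<phi>. 0 \<le> a \<and> a \<le> b \<and> b \<le> T" using \<phi> u by fastforce
  have G: "?G \<in> borel_measurable M"
    using measurable_F_M[OF order_refl step_wiener_adapted] \<phi>0 by blast
  have ZM: "Z \<in> borel_measurable M" using Z u by (intro measurable_F_M)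
  \<comment> \<open>Working with cylinder sets up to null sets gives a \<open>\<pi>\<close>-system that contains \<open>null_sets M\<close>.\<close>
  define Q where "Q = {E\<in>events. \<exists>I A. finite I \<and> I \<subseteq> {0..u} \<and> (\<forall>s. A s \<in> sets (borel::real measure)) \<and>
    (AE \<omega> in M. \<omega> \<in> E \<longleftrightarrow> (\<forall>s\<in>I. W s \<omega> \<in> A s))}"
  let ?R = "{?G -` D \<inter> space M | D. D \<in> sets borel}"
  have "indep_set Q ?R"
    unfolding indep_sets2_eq
  proof (intro conjI ballI)
    show "Q \<subseteq> events" by (auto simp: Q_def)
    show "?R \<subseteq> events" using G by (auto intro: measurable_sets)
    fix E R assume "E \<in> Q" "R \<in> ?R"
    then obtain I A D where E: "E \<in> events" and I: "finite I" "I \<subseteq> {0..u}" and A: "\<And>s. A s \<in> sets (borel::real measure)"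
      and ae: "AE \<omega> in M. \<omega> \<in> E \<longleftrightarrow> (\<forall>s\<in>I. W s \<omega> \<in> A s)"
      and R: "R = {\<omega>\<in>space M. ?G \<omega> \<in> D}" and D: "D \<in> sets borel"
      unfolding Q_def by blast
    let ?C = "{\<omega>\<in>space M. \<forall>s\<in>I. W s \<omega> \<in> A s}"
    have [measurable]: "W s \<in> borel_measurable M" if "s \<in> I" for s
      using that I u by (intro measurable_W) auto
    note [measurable] = A D G
    have C: "?C \<in> events"
      by (intro sets.sets_Collect_finite_All I; measurable)
    have "R \<in> events" unfolding R by measurable
    moreover have "AE \<omega> in M. \<omega> \<in> E \<longleftrightarrow> \<omega> \<in> ?C"
      using ae AE_space by eventually_elim auto
    moreover from this have "AE \<omega> in M. \<omega> \<in> E \<inter> R \<longleftrightarrow> \<omega> \<in> ?C \<inter> R"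
      by eventually_elim auto
    ultimately have "prob (E \<inter> R) = prob (?C \<inter> R)" "prob E = prob ?C"
      using C E by (intro finite_measure_eq_AE; auto)+
    then show "prob (E \<inter> R) = prob E * prob R"
      unfolding R using cylinder_indep[OF \<phi> u I A D] by simp
  qed
  moreover have "Int_stable Q"
  proof (rule Int_stableI)
    fix E E' assume "E \<in> Q" "E' \<in> Q"
    then obtain I A I' A' where E: "E \<in> events" "finite I" "I \<subseteq> {0..u}" "\<And>s. A s \<in> sets (borel::real measure)"
        "AE \<omega> in M. \<omega> \<in> E \<longleftrightarrow> (\<forall>s\<in>I. W s \<omega> \<in> A s)"
      and E': "E' \<in> events" "finite I'" "I' \<subseteq> {0..u}" "\<And>s. A' s \<in> sets (borel::real measure)"
        "AE \<omega> in M. \<omega> \<in> E' \<longleftrightarrow> (\<forall>s\<in>I'. W s \<omega> \<in> A' s)"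
      unfolding Q_def by blast
    \<comment> \<open>A time that occurs in only one of the two cylinders is left unconstrained by
      the other.\<close>
    define A'' where "A'' = (\<lambda>s. (if s \<in> I then A s else UNIV) \<inter> (if s \<in> I' then A' s else UNIV))"
    have "AE \<omega> in M. \<omega> \<in> E \<inter> E' \<longleftrightarrow> (\<forall>s\<in>I \<union> I'. W s \<omega> \<in> A'' s)"
      using E(5) E'(5) by eventually_elim (auto simp: A''_def split: if_splits)
    moreover have "\<forall>s. A'' s \<in> sets borel" unfolding A''_def using E(4) E'(4) by auto
    moreover have "finite (I \<union> I')" "I \<union> I' \<subseteq> {0..u}" "E \<inter> E' \<in> events" using E E' by auto
    ultimately show "E \<inter> E' \<in> Q" unfolding Q_def by blast
  qed
  moreover have "Int_stable ?R"
  proof (rule Int_stableI)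
    fix R R' assume "R \<in> ?R" "R' \<in> ?R"
    then obtain D D' where "R = ?G -` D \<inter> space M" "R' = ?G -` D' \<inter> space M" "D \<in> sets borel" "D' \<in> sets borel" by blast
    then show "R \<inter> R' \<in> ?R" by (auto intro!: exI[of _ "D \<inter> D'"])
  qed
  ultimately have ind: "indep_set (sigma_sets (space M) Q) (sigma_sets (space M) ?R)"
    by (rule indep_set_sigma_sets)
  have FQ: "sets (F u) \<subseteq> sigma_sets (space M) Q"
    unfolding sets_augmented_filtration
  proof (intro sigma_sets_mono')
    have "W s -` A \<inter> space M \<in> Q" if "s \<in> {0..u}" "A \<in> sets borel" for s A
    proof -
      have "W s -` A \<inter> space M \<in> events" using that u by (intro measurable_sets[OF measurable_W]) auto
      moreover have "AE \<omega> in M. \<omega> \<in> W s -` A \<inter> space M \<longleftrightarrow> (\<forall>s\<in>{s}. W s \<omega> \<in> A)" by auto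
      ultimately show ?thesis unfolding Q_def using that
        by (intro CollectI conjI exI[of _ "{s}"] exI[of _ "\<lambda>_. A"]) auto
    qed
    moreover have "N \<in> Q" if "N \<in> null_sets M" for N
    proof -
      \<comment> \<open>A null set is almost surely equal to the empty cylinder, written as a
        constraint on \<open>W 0\<close> that cannot be met.\<close>
      have "AE \<omega> in M. \<omega> \<in> N \<longleftrightarrow> (\<forall>s\<in>{0}. W s \<omega> \<in> {})" using AE_not_in[OF that] by simp
      then show ?thesis unfolding Q_def using that u
        by (intro CollectI conjI exI[of _ "{0}"] exI[of _ "\<lambda>_. {}"]) auto
    qed
    ultimately show "(\<Union>s\<in>{0..u}. {W s -` A \<inter> space M | A. A \<in> sets borel}) \<union> null_sets M \<subseteq> Q" by blast
  qed
  have "sigma_sets (space M) {Z -` A \<inter> space M | A. A \<in> sets borel} \<subseteq> sets (F u)"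
    using sets.sigma_sets_subset[of "{Z -` A \<inter> space M | A. A \<in> sets borel}" "F u"] measurable_sets[OF Z] by auto
  then have "indep_set (sigma_sets (space M) {Z -` A \<inter> space M | A. A \<in> sets borel}) (sigma_sets (space M) ?R)"
    using ind FQ unfolding indep_sets2_eq by blast
  then show ?thesis unfolding indep_var_eq using ZM G by blast
qed

end

section \<open>Small balls and second moments of Wiener integrals\<close>

text \<open>The defect is \<open>(x - 2 * y)\<^sup>2\<close>. Integrated, this stands in for the
  triangle inequality in mean square; it also makes sense for infinite integrals and costs a factor
  2.\<close>

lemma ennreal_square_le: "ennreal ((x::real)\<^sup>2) \<le> 2 * ennreal ((x - y)\<^sup>2) + 2 * ennreal (y\<^sup>2)"
proof -
  have "0 \<le> (x - y - y)\<^sup>2" by simp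
  then have "x\<^sup>2 \<le> 2 * (x - y)\<^sup>2 + 2 * y\<^sup>2" by (simp add: power2_eq_square algebra_simps)
  then have "ennreal (x\<^sup>2) \<le> ennreal (2 * (x - y)\<^sup>2 + 2 * y\<^sup>2)" by (rule ennreal_leI)
  then show ?thesis by (simp add: ennreal_mult')
qed

lemma nn_integral_square_le:
  fixes x y :: "'b \<Rightarrow> real"
  assumes [measurable]: "x \<in> borel_measurable N" "y \<in> borel_measurable N"
  shows "(\<integral>\<^sup>+s. ennreal ((x s)\<^sup>2) \<partial>N) \<le> 2 * (\<integral>\<^sup>+s. ennreal ((x s - y s)\<^sup>2) \<partial>N) + 2 * (\<integral>\<^sup>+s. ennreal ((y s)\<^sup>2) \<partial>N)"
proof -
  have "(\<integral>\<^sup>+s. ennreal ((x s)\<^sup>2) \<partial>N) \<le> (\<integral>\<^sup>+s. 2 * ennreal ((x s - y s)\<^sup>2) + 2 * ennreal ((y s)\<^sup>2) \<partial>N)"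
    by (intro nn_integral_mono ennreal_square_le)
  also have "\<dots> = 2 * (\<integral>\<^sup>+s. ennreal ((x s - y s)\<^sup>2) \<partial>N) + 2 * (\<integral>\<^sup>+s. ennreal ((y s)\<^sup>2) \<partial>N)"
    by (simp add: nn_integral_add nn_integral_cmult)
  finally show ?thesis .
qed

lemma step_function_support:
  assumes "\<forall>(c, a, b)\<in>set \<phi>. u \<le> a \<and> a \<le> b \<and> b \<le> v" and "s \<notin> {u..v}"
  shows "step_function \<phi> s = 0"
  using assms by (induction \<phi>) (auto simp: step_function_def indicator_def)

lemma measurable_step_function_lebesgue [measurable]: "step_function \<phi> \<in> borel_measurable lebesgue"
  by (rule measurable_completion) simp

lemma has_wiener_integral_measurable:
  assumes "has_wiener_integral M W t f Y"
  shows "(\<lambda>s. indicator {0..t} s * f s) \<in> borel_measurable lebesgue"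
  using assms by (simp add: has_wiener_integral_def square_integrable_on_def set_borel_measurable_def)

context brownian
begin

text \<open>Conditionally on \<open>Z = z\<close> the event asks \<open>G\<close> to lie in an
  interval of length \<open>2 * \<rho>\<close>, and the normal density is at most
  \<open>1 / (2 * \<sigma>)\<close> because \<open>2 * pi \<ge> 4\<close>.\<close>

lemma normal_small_ball:
  assumes G: "distributed M lborel G (normal_density 0 \<sigma>)" and \<sigma>: "0 < \<sigma>" and \<rho>: "0 \<le> \<rho>"
    and ind: "indep_var borel Z borel G"
  shows "emeasure M {\<omega>\<in>space M. \<bar>Z \<omega> + G \<omega>\<bar> \<le> \<rho>} \<le> ennreal (\<rho> / \<sigma>)"
proof -
  have Gm: "G \<in> borel_measurable M" and Zm: "Z \<in> borel_measurable M"
    using indep_var_rv1[OF ind] indep_var_rv2[OF ind] by auto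
  let ?Q = "{x. \<bar>fst x + snd x\<bar> \<le> \<rho>} :: (real \<times> real) set"
  interpret DG: prob_space "distr M borel G" by (rule prob_space_distr) fact
  interpret DZ: prob_space "distr M borel Z" by (rule prob_space_distr) fact
  have Q: "?Q \<in> sets (borel \<Otimes>\<^sub>M borel)"
  proof -
    have "{x \<in> space (borel \<Otimes>\<^sub>M borel). \<bar>fst x + snd x\<bar> \<le> \<rho>} \<in> sets (borel \<Otimes>\<^sub>M borel)" by measurable
    then show ?thesis by (simp add: space_pair_measure)
  qed
  have slice: "emeasure (distr M borel G) {y. \<bar>z + y\<bar> \<le> \<rho>} \<le> ennreal (\<rho> / \<sigma>)" for z
  proof -
    have set: "{y. \<bar>z + y\<bar> \<le> \<rho>} = {- z - \<rho>..- z + \<rho>}" by auto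
    have dens: "normal_density 0 \<sigma> x \<le> 1 / (2 * \<sigma>)" for x
    proof -
      have "2 * \<sigma> = sqrt (4 * \<sigma>\<^sup>2)" using \<sigma> by (simp add: real_sqrt_mult)
      also have "\<dots> \<le> sqrt (2 * pi * \<sigma>\<^sup>2)" using pi_gt3 by (intro real_sqrt_le_mono mult_right_mono) auto
      finally have "1 / sqrt (2 * pi * \<sigma>\<^sup>2) \<le> 1 / (2 * \<sigma>)" using \<sigma> by (intro divide_left_mono) auto
      moreover have "1 / sqrt (2 * pi * \<sigma>\<^sup>2) * exp (- (x - 0)\<^sup>2 / (2 * \<sigma>\<^sup>2)) \<le> 1 / sqrt (2 * pi * \<sigma>\<^sup>2) * 1"
        by (intro mult_left_mono) auto
      ultimately show ?thesis unfolding normal_density_def by linarith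
    qed
    have "emeasure (distr M borel G) {y. \<bar>z + y\<bar> \<le> \<rho>} = emeasure M (G -` {- z - \<rho>..- z + \<rho>} \<inter> space M)"
      unfolding set using Gm by (simp add: emeasure_distr)
    also have "\<dots> = (\<integral>\<^sup>+x. ennreal (normal_density 0 \<sigma> x) * indicator {- z - \<rho>..- z + \<rho>} x \<partial>lborel)"
      by (rule distributed_emeasure[OF G]) simp
    also have "\<dots> \<le> (\<integral>\<^sup>+x. ennreal (1 / (2 * \<sigma>)) * indicator {- z - \<rho>..- z + \<rho>} x \<partial>lborel)"
      by (intro nn_integral_mono mult_right_mono ennreal_leI dens) auto
    also have "\<dots> = ennreal (1 / (2 * \<sigma>)) * ennreal (2 * \<rho>)"
      using \<rho> by (subst nn_integral_cmult_indicator) auto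
    also have "\<dots> = ennreal (\<rho> / \<sigma>)" using \<rho> \<sigma> by (simp flip: ennreal_mult')
    finally show ?thesis .
  qed
  have "emeasure M {\<omega>\<in>space M. \<bar>Z \<omega> + G \<omega>\<bar> \<le> \<rho>} = emeasure (distr M (borel \<Otimes>\<^sub>M borel) (\<lambda>x. (Z x, G x))) ?Q"
    using Gm Zm Q by (subst emeasure_distr) (auto intro!: arg_cong[where f="emeasure M"])
  also have "\<dots> = emeasure (distr M borel Z \<Otimes>\<^sub>M distr M borel G) ?Q"
    using ind unfolding indep_var_distribution_eq by simp
  also have "\<dots> = (\<integral>\<^sup>+z. emeasure (distr M borel G) (Pair z -` ?Q) \<partial>distr M borel Z)"
    using Q by (intro DG.emeasure_pair_measure_alt) (simp cong: sets_pair_measure_cong)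
  also have "\<dots> \<le> (\<integral>\<^sup>+z. ennreal (\<rho> / \<sigma>) \<partial>distr M borel Z)"
    using slice by (intro nn_integral_mono) (simp add: vimage_def)
  also have "\<dots> = ennreal (\<rho> / \<sigma>)" using DZ.emeasure_space_1 by simp
  finally show ?thesis .
qed

text \<open>A mean square limit of step integrals is an almost sure limit along a subsequence, and
  adaptedness survives modification on null sets.\<close>

lemma has_wiener_integral_adapted:
  assumes Y: "has_wiener_integral M W t f Y" and t: "0 \<le> t" "t \<le> T"
  shows "Y \<in> borel_measurable (F t)"
proof -
  obtain \<phi> where \<phi>: "\<And>n. \<forall>(c, a, b)\<in>set (\<phi> n). 0 \<le> a \<and> a \<le> b \<and> b \<le> t"
    and lim: "(\<lambda>n. \<integral>\<^sup>+\<omega>. ennreal ((Y \<omega> - step_wiener_integral W (\<phi> n) \<omega>)\<^sup>2) \<partial>M) \<longlonglongrightarrow> 0"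
    and Ym: "Y \<in> borel_measurable M"
    using Y unfolding has_wiener_integral_def by blast
  let ?S = "\<lambda>n. step_wiener_integral W (\<phi> n)"
  have SF: "?S n \<in> borel_measurable (F t)" for n using \<phi> by (rule step_wiener_adapted)
  have SM [measurable]: "?S n \<in> borel_measurable M" for n using measurable_F_M[OF t(2) SF] .
  note [measurable] = Ym
  \<comment> \<open>The distances converge in \<open>ennreal\<close> and may be infinite for small
    \<open>n\<close>; beyond \<open>N\<close> they are finite, so the squares are
    integrable.\<close>
  have "eventually (\<lambda>n. (\<integral>\<^sup>+\<omega>. ennreal ((Y \<omega> - ?S n \<omega>)\<^sup>2) \<partial>M) < 1) sequentially"
    using lim by (intro order_tendstoD) auto
  then obtain N where N: "\<And>n. n \<ge> N \<Longrightarrow> (\<integral>\<^sup>+\<omega>. ennreal ((Y \<omega> - ?S n \<omega>)\<^sup>2) \<partial>M) < 1"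
    unfolding eventually_sequentially by blast
  have int: "integrable M (\<lambda>\<omega>. (Y \<omega> - ?S (n + N) \<omega>)\<^sup>2)" for n
    using less_trans[OF N[of "n + N"] ennreal_one_less_top] by (intro integrableI_bounded) auto
  have "(\<lambda>n. enn2real (\<integral>\<^sup>+\<omega>. ennreal ((Y \<omega> - ?S (n + N) \<omega>)\<^sup>2) \<partial>M)) \<longlonglongrightarrow> 0"
    using LIMSEQ_ignore_initial_segment[OF lim, of N] by (intro tendsto_enn2real) auto
  then have "(\<lambda>n. \<integral>\<omega>. norm ((Y \<omega> - ?S (n + N) \<omega>)\<^sup>2) \<partial>M) \<longlonglongrightarrow> 0"
    by (simp add: integral_eq_nn_integral)
  with int have "\<exists>r. strict_mono r \<and> (AE \<omega> in M. (\<lambda>n. (Y \<omega> - ?S (r n + N) \<omega>)\<^sup>2) \<longlonglongrightarrow> 0)"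
    by (intro tendsto_L1_AE_subseq[of M "\<lambda>n \<omega>. (Y \<omega> - ?S (n + N) \<omega>)\<^sup>2"])
  then obtain r where r: "AE \<omega> in M. (\<lambda>n. (Y \<omega> - ?S (r n + N) \<omega>)\<^sup>2) \<longlonglongrightarrow> 0" by blast
  show ?thesis
  proof (rule augmented_filtration_AE_cong[OF _ _ Ym])
    show "(\<lambda>\<omega>. lim (\<lambda>n. ?S (r n + N) \<omega>)) \<in> borel_measurable (F t)"
      by (intro borel_measurable_lim_metric SF)
    show "(\<lambda>\<omega>. lim (\<lambda>n. ?S (r n + N) \<omega>)) \<in> borel_measurable M"
      by (intro borel_measurable_lim_metric SM)
    show "AE \<omega> in M. lim (\<lambda>n. ?S (r n + N) \<omega>) = Y \<omega>"
      using r
    proof eventually_elim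
      case (elim \<omega>)
      then have "(\<lambda>n. sqrt ((Y \<omega> - ?S (r n + N) \<omega>)\<^sup>2)) \<longlonglongrightarrow> sqrt 0" by (intro tendsto_real_sqrt)
      then have "(\<lambda>n. \<bar>Y \<omega> - ?S (r n + N) \<omega>\<bar>) \<longlonglongrightarrow> 0" by simp
      then have "(\<lambda>n. Y \<omega> - ?S (r n + N) \<omega>) \<longlonglongrightarrow> 0" by (simp add: tendsto_rabs_zero_iff)
      from tendsto_diff[OF tendsto_const[of "Y \<omega>"] this]
      show ?case by (intro limI) simp
    qed
  qed
qed

text \<open>The isometry would give the constant 1. The value 4 comes from applying the factor 2
  inequality twice and suffices, since the bound serves to prove finiteness.\<close>

lemma has_wiener_integral_second_moment:
  assumes Y: "has_wiener_integral M W t f Y" and t: "0 \<le> t" "t \<le> T"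
  shows "(\<integral>\<^sup>+\<omega>. ennreal ((Y \<omega>)\<^sup>2) \<partial>M) \<le> 4 * (\<integral>\<^sup>+s\<in>{0..t}. ennreal ((f s)\<^sup>2) \<partial>lebesgue)"
proof -
  obtain \<phi> where \<phi>: "\<And>n. \<forall>(c, a, b)\<in>set (\<phi> n). 0 \<le> a \<and> a \<le> b \<and> b \<le> t"
    and limf: "(\<lambda>n. \<integral>\<^sup>+s\<in>{0..t}. ennreal ((f s - step_function (\<phi> n) s)\<^sup>2) \<partial>lebesgue) \<longlonglongrightarrow> 0"
    and lim: "(\<lambda>n. \<integral>\<^sup>+\<omega>. ennreal ((Y \<omega> - step_wiener_integral W (\<phi> n) \<omega>)\<^sup>2) \<partial>M) \<longlonglongrightarrow> 0"
    and Ym: "Y \<in> borel_measurable M"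
    using Y unfolding has_wiener_integral_def by blast
  let ?S = "\<lambda>n. step_wiener_integral W (\<phi> n)" and ?\<phi> = "\<lambda>n. step_function (\<phi> n)"
  have SM [measurable]: "?S n \<in> borel_measurable M" for n
    using measurable_F_M[OF t(2) step_wiener_adapted[OF \<phi>]] .
  note [measurable] = Ym has_wiener_integral_measurable[OF Y]
  define e where "e n = (\<integral>\<^sup>+s\<in>{0..t}. ennreal ((f s - ?\<phi> n s)\<^sup>2) \<partial>lebesgue)" for n
  define e' where "e' n = (\<integral>\<^sup>+\<omega>. ennreal ((Y \<omega> - ?S n \<omega>)\<^sup>2) \<partial>M)" for n
  define V where "V = (\<integral>\<^sup>+s\<in>{0..t}. ennreal ((f s)\<^sup>2) \<partial>lebesgue)"
  have "(\<integral>\<^sup>+\<omega>. ennreal ((Y \<omega>)\<^sup>2) \<partial>M) \<le> 2 * e' n + 2 * (2 * e n + 2 * V)" for n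
  proof -
    have "(\<integral>\<^sup>+s. ennreal ((?\<phi> n s)\<^sup>2) \<partial>lebesgue)
      \<le> 2 * (\<integral>\<^sup>+s. ennreal ((?\<phi> n s - indicator {0..t} s * f s)\<^sup>2) \<partial>lebesgue)
       + 2 * (\<integral>\<^sup>+s. ennreal ((indicator {0..t} s * f s)\<^sup>2) \<partial>lebesgue)"
      by (intro nn_integral_square_le) measurable
    also have "(\<integral>\<^sup>+s. ennreal ((?\<phi> n s - indicator {0..t} s * f s)\<^sup>2) \<partial>lebesgue) = e n"
      unfolding e_def using step_function_support[OF \<phi>, of _ n]
      by (intro nn_integral_cong) (auto simp: indicator_def power2_commute)
    also have "(\<integral>\<^sup>+s. ennreal ((indicator {0..t} s * f s)\<^sup>2) \<partial>lebesgue) = V"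
      unfolding V_def by (intro nn_integral_cong) (auto simp: indicator_def)
    finally have 1: "(\<integral>\<^sup>+s. ennreal ((?\<phi> n s)\<^sup>2) \<partial>lebesgue) \<le> 2 * e n + 2 * V" .
    have "\<forall>(c, a, b)\<in>set (\<phi> n). 0 \<le> a \<and> a \<le> b \<and> b \<le> T" using \<phi>[of n] t by fastforce
    from step_wiener_second_moment[OF this] t
    have 2: "(\<integral>\<^sup>+\<omega>. ennreal ((?S n \<omega>)\<^sup>2) \<partial>M) = (\<integral>\<^sup>+s. ennreal ((?\<phi> n s)\<^sup>2) \<partial>lebesgue)"
      by (simp add: nn_integral_completion)
    have "(\<integral>\<^sup>+\<omega>. ennreal ((Y \<omega>)\<^sup>2) \<partial>M) \<le> 2 * e' n + 2 * (\<integral>\<^sup>+\<omega>. ennreal ((?S n \<omega>)\<^sup>2) \<partial>M)"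
      unfolding e'_def by (intro nn_integral_square_le) measurable
    also have "\<dots> \<le> 2 * e' n + 2 * (2 * e n + 2 * V)"
      unfolding 2 by (intro add_left_mono mult_left_mono 1) auto
    finally show ?thesis .
  qed
  moreover have "(\<lambda>n. 2 * e' n + 2 * (2 * e n + 2 * V)) \<longlonglongrightarrow> 2 * 0 + 2 * (2 * 0 + 2 * V)"
    using lim limf unfolding e_def e'_def
    by (intro tendsto_add ennreal_tendsto_cmult tendsto_const) auto
  ultimately have "(\<integral>\<^sup>+\<omega>. ennreal ((Y \<omega>)\<^sup>2) \<partial>M) \<le> 2 * 0 + 2 * (2 * 0 + 2 * V)"
    by (intro LIMSEQ_le_const) auto
  also have "\<dots> = 4 * V" by (simp flip: mult.assoc)
  finally show ?thesis unfolding V_def .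
qed

text \<open>Approximate \<open>Y\<close> by a step integral and cut it at \<open>u\<close>. The past
  part joins \<open>Z\<close>; the future part is normal, independent of it, with standard deviation
  above \<open>\<sigma> / 2\<close>. Replacing \<open>Y\<close> by the step integral doubles the
  radius, up to a Chebyshev error that vanishes in the limit; hence the bound
  \<open>2 * \<rho> / (\<sigma> / 2)\<close>.\<close>

lemma has_wiener_integral_small_ball:
  assumes Y: "has_wiener_integral M W t f Y" and t: "0 \<le> u" "u \<le> t" "t \<le> T"
    and Z: "Z \<in> borel_measurable (F u)"
    and \<sigma>: "0 < \<sigma>" "ennreal (\<sigma>\<^sup>2) \<le> (\<integral>\<^sup>+s\<in>{u..t}. ennreal ((f s)\<^sup>2) \<partial>lebesgue)" and \<rho>: "0 < \<rho>"
  shows "emeasure M {\<omega>\<in>space M. \<bar>Z \<omega> + Y \<omega>\<bar> \<le> \<rho>} \<le> ennreal (4 * \<rho> / \<sigma>)"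
proof -
  obtain \<phi> where \<phi>: "\<And>n. \<forall>(c, a, b)\<in>set (\<phi> n). 0 \<le> a \<and> a \<le> b \<and> b \<le> t"
    and limf: "(\<lambda>n. \<integral>\<^sup>+s\<in>{0..t}. ennreal ((f s - step_function (\<phi> n) s)\<^sup>2) \<partial>lebesgue) \<longlonglongrightarrow> 0"
    and lim: "(\<lambda>n. \<integral>\<^sup>+\<omega>. ennreal ((Y \<omega> - step_wiener_integral W (\<phi> n) \<omega>)\<^sup>2) \<partial>M) \<longlonglongrightarrow> 0"
    and Ym: "Y \<in> borel_measurable M"
    using Y unfolding has_wiener_integral_def by blast
  let ?S = "\<lambda>n. step_wiener_integral W (\<phi> n)" and ?\<phi> = "\<lambda>n. step_function (\<phi> n)"
  have SM [measurable]: "?S n \<in> borel_measurable M" for n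
    using measurable_F_M[OF t(3) step_wiener_adapted[OF \<phi>]] .
  have ZM: "Z \<in> borel_measurable M" using t Z by (intro measurable_F_M[of u]) auto
  note [measurable] = Ym ZM has_wiener_integral_measurable[OF Y]
  define past where "past n = map (\<lambda>(c, a, b). (c, min a u, min b u)) (\<phi> n)" for n
  define future where "future n = map (\<lambda>(c, a, b). (c, max a u, max b u)) (\<phi> n)" for n
  have past: "\<forall>(c, a, b)\<in>set (past n). 0 \<le> a \<and> a \<le> b \<and> b \<le> u" for n
    using \<phi>[of n] t unfolding past_def by fastforce
  have future: "\<forall>(c, a, b)\<in>set (future n). u \<le> a \<and> a \<le> b \<and> b \<le> T" for n
    using \<phi>[of n] t unfolding future_def by fastforce
  have futf: "step_function (future n) s = indicator {u<..} s * ?\<phi> n s" for n s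
    unfolding future_def using \<phi>[of n] by (intro step_function_max) auto
  define e where "e n = (\<integral>\<^sup>+s\<in>{0..t}. ennreal ((f s - ?\<phi> n s)\<^sup>2) \<partial>lebesgue)" for n
  define e' where "e' n = (\<integral>\<^sup>+\<omega>. ennreal ((Y \<omega> - ?S n \<omega>)\<^sup>2) \<partial>M)" for n
  define v where "v n = (\<integral>\<^sup>+s. ennreal ((step_function (future n) s)\<^sup>2) \<partial>lborel)" for n
  have var: "ennreal (\<sigma>\<^sup>2) \<le> 2 * e n + 2 * v n" for n
  proof -
    have "(\<lambda>s. indicator {u<..t} s * f s) = (\<lambda>s. indicator {u<..} s * (indicator {0..t} s * f s))"
      using t by (auto simp: indicator_def fun_eq_iff)
    moreover have "(\<lambda>s. indicator {u<..} s * (indicator {0..t} s * f s)) \<in> borel_measurable lebesgue"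
      by (rule borel_measurable_times[OF borel_measurable_indicator has_wiener_integral_measurable[OF Y]]) simp
    ultimately have fut: "(\<lambda>s. indicator {u<..t} s * f s) \<in> borel_measurable lebesgue" by simp
    have "ennreal (\<sigma>\<^sup>2) \<le> (\<integral>\<^sup>+s. ennreal ((indicator {u<..t} s * f s)\<^sup>2) \<partial>lebesgue)"
    proof -
      \<comment> \<open>The future step function lives on intervals open at \<open>u\<close>,
        whereas the square integral of \<open>f\<close> is given over the closed interval.\<close>
      have "AE s in lebesgue. s \<noteq> u" using AE_completion[OF AE_lborel_singleton[of u]] .
      then have "(\<integral>\<^sup>+s\<in>{u..t}. ennreal ((f s)\<^sup>2) \<partial>lebesgue) = (\<integral>\<^sup>+s. ennreal ((indicator {u<..t} s * f s)\<^sup>2) \<partial>lebesgue)"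
        by (intro nn_integral_cong_AE) (auto elim!: eventually_mono simp: indicator_def)
      then show ?thesis using \<sigma> by simp
    qed
    also have "\<dots> \<le> 2 * (\<integral>\<^sup>+s. ennreal ((indicator {u<..t} s * f s - step_function (future n) s)\<^sup>2) \<partial>lebesgue)
       + 2 * (\<integral>\<^sup>+s. ennreal ((step_function (future n) s)\<^sup>2) \<partial>lebesgue)"
      using fut by (intro nn_integral_square_le measurable_step_function_lebesgue)
    also have "(\<integral>\<^sup>+s. ennreal ((indicator {u<..t} s * f s - step_function (future n) s)\<^sup>2) \<partial>lebesgue) \<le> e n"
      unfolding e_def futf using step_function_support[OF \<phi>, of _ n] t
      by (intro nn_integral_mono) (auto simp: indicator_def)
    finally show ?thesis unfolding v_def by (simp add: nn_integral_completion add_mono mult_left_mono)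
  qed
  \<comment> \<open>By \<open>var\<close>, the threshold \<open>\<sigma>\<^sup>2 / 4\<close> for the
    approximation error leaves more than \<open>\<sigma>\<^sup>2 / 4\<close> for the variance of the
    future part.\<close>
  have main: "emeasure M {\<omega>\<in>space M. \<bar>Z \<omega> + Y \<omega>\<bar> \<le> \<rho>} \<le> ennreal (4 * \<rho> / \<sigma>) + ennreal (1 / \<rho>\<^sup>2) * e' n"
    if small: "e n < ennreal (\<sigma>\<^sup>2 / 4)" for n
  proof -
    have "\<forall>(c, a, b)\<in>set (future n). 0 \<le> a \<and> a \<le> b \<and> b \<le> T" using future[of n] t by fastforce
    note * = this
    note normal = step_wiener_normal[OF *]
    have "v n < \<infinity>"
      unfolding v_def using \<open>0 \<le> u\<close> t * by (intro nn_integral_step_function_square_finite) auto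
    then obtain x where x: "v n = ennreal x" "0 \<le> x" by (metis ennreal_cases infinity_ennreal_def less_irrefl)
    define \<tau> where "\<tau> = sqrt x"
    have "ennreal (\<sigma>\<^sup>2) < 2 * ennreal (\<sigma>\<^sup>2 / 4) + 2 * ennreal x"
    proof -
      have "2 * e n < 2 * ennreal (\<sigma>\<^sup>2 / 4)" using small by (intro ennreal_mult_strict_left_mono) auto
      then have "2 * e n + 2 * ennreal x < 2 * ennreal (\<sigma>\<^sup>2 / 4) + 2 * ennreal x"
        by (simp add: ennreal_mult_eq_top_iff)
      then show ?thesis by (rule order.strict_trans1[OF var[of n, unfolded x(1)]])
    qed
    also have "\<dots> = ennreal (\<sigma>\<^sup>2 / 2 + 2 * x)"
    proof -
      have "2 * ennreal y = ennreal (2 * y)" for y by (simp add: ennreal_mult')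
      then have "2 * ennreal (\<sigma>\<^sup>2 / 4) + 2 * ennreal x = ennreal (2 * (\<sigma>\<^sup>2 / 4)) + ennreal (2 * x)"
        by (simp only:)
      also have "\<dots> = ennreal (2 * (\<sigma>\<^sup>2 / 4) + 2 * x)" using x by (intro ennreal_plus[symmetric]) auto
      finally show ?thesis by simp
    qed
    finally have "\<sigma>\<^sup>2 < \<sigma>\<^sup>2 / 2 + 2 * x" using x by (subst (asm) ennreal_less_iff) auto
    then have "(\<sigma> / 2)\<^sup>2 < x" by (simp add: power2_eq_square)
    then have \<tau>: "\<sigma> / 2 < \<tau>" unfolding \<tau>_def by (rule real_less_rsqrt)
    have "distributed M lborel (step_wiener_integral W (future n)) (normal_density 0 \<tau>)"
    proof -
      have "v n = ennreal (\<tau>\<^sup>2)" "0 \<le> \<tau>" "\<tau> \<noteq> 0" "0 \<le> T" using x \<tau> \<sigma> t by (auto simp: \<tau>_def)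
      then show ?thesis using normal[of \<tau>] unfolding v_def by simp
    qed
    moreover have "(\<lambda>\<omega>. Z \<omega> + step_wiener_integral W (past n) \<omega>) \<in> borel_measurable (F u)"
      using Z step_wiener_adapted[OF past] by (rule borel_measurable_add)
    then have "indep_var borel (\<lambda>\<omega>. Z \<omega> + step_wiener_integral W (past n) \<omega>) borel (step_wiener_integral W (future n))"
      using t by (intro step_wiener_indep[OF future]) auto
    ultimately have "emeasure M {\<omega>\<in>space M. \<bar>Z \<omega> + step_wiener_integral W (past n) \<omega> + step_wiener_integral W (future n) \<omega>\<bar> \<le> 2 * \<rho>} \<le> ennreal (2 * \<rho> / \<tau>)"
      using \<tau> \<sigma> \<rho> by (intro normal_small_ball) auto
    also have "\<dots> \<le> ennreal (4 * \<rho> / \<sigma>)"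
    proof (rule ennreal_leI)
      have "2 * \<rho> / \<tau> \<le> 2 * \<rho> / (\<sigma> / 2)" using \<tau> \<sigma> \<rho> by (intro divide_left_mono) auto
      then show "2 * \<rho> / \<tau> \<le> 4 * \<rho> / \<sigma>" by simp
    qed
    finally have 1: "emeasure M {\<omega>\<in>space M. \<bar>Z \<omega> + ?S n \<omega>\<bar> \<le> 2 * \<rho>} \<le> ennreal (4 * \<rho> / \<sigma>)"
      unfolding step_wiener_integral_min_max[of W "\<phi> n" _ u] past_def[symmetric] future_def[symmetric] add.assoc .
    have "emeasure M {\<omega>\<in>space M. 1 \<le> ennreal (1 / \<rho>\<^sup>2) * ennreal ((Y \<omega> - ?S n \<omega>)\<^sup>2)}
        \<le> ennreal (1 / \<rho>\<^sup>2) * (\<integral>\<^sup>+\<omega>. ennreal ((Y \<omega> - ?S n \<omega>)\<^sup>2) * indicator (space M) \<omega> \<partial>M)"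
      by (rule nn_integral_Markov_inequality) auto
    also have "\<dots> = ennreal (1 / \<rho>\<^sup>2) * e' n"
      unfolding e'_def by (intro arg_cong2[where f="(*)"] nn_integral_cong refl) auto
    finally have 2: "emeasure M {\<omega>\<in>space M. 1 \<le> ennreal (1 / \<rho>\<^sup>2) * ennreal ((Y \<omega> - ?S n \<omega>)\<^sup>2)} \<le> ennreal (1 / \<rho>\<^sup>2) * e' n" .
    have "{\<omega>\<in>space M. \<bar>Z \<omega> + Y \<omega>\<bar> \<le> \<rho>} \<subseteq> {\<omega>\<in>space M. \<bar>Z \<omega> + ?S n \<omega>\<bar> \<le> 2 * \<rho>}
        \<union> {\<omega>\<in>space M. 1 \<le> ennreal (1 / \<rho>\<^sup>2) * ennreal ((Y \<omega> - ?S n \<omega>)\<^sup>2)}"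
    proof safe
      fix \<omega> assume *: "\<bar>Z \<omega> + Y \<omega>\<bar> \<le> \<rho>" "\<not> 1 \<le> ennreal (1 / \<rho>\<^sup>2) * ennreal ((Y \<omega> - ?S n \<omega>)\<^sup>2)"
      then have "ennreal ((Y \<omega> - ?S n \<omega>)\<^sup>2 / \<rho>\<^sup>2) < ennreal 1" by (simp flip: ennreal_mult')
      then have "(Y \<omega> - ?S n \<omega>)\<^sup>2 / \<rho>\<^sup>2 < 1" by (subst (asm) ennreal_less_iff) auto
      then have "(Y \<omega> - ?S n \<omega>)\<^sup>2 < \<rho>\<^sup>2" using \<rho> by (simp add: divide_less_eq)
      then have "\<bar>Y \<omega> - ?S n \<omega>\<bar>\<^sup>2 < \<rho>\<^sup>2" by simp
      then have "\<bar>Y \<omega> - ?S n \<omega>\<bar> < \<rho>" using \<rho> by (rule power2_less_imp_less[OF _ less_imp_le])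
      then show "\<bar>Z \<omega> + ?S n \<omega>\<bar> \<le> 2 * \<rho>" using * by linarith
    qed
    then have "emeasure M {\<omega>\<in>space M. \<bar>Z \<omega> + Y \<omega>\<bar> \<le> \<rho>} \<le> emeasure M {\<omega>\<in>space M. \<bar>Z \<omega> + ?S n \<omega>\<bar> \<le> 2 * \<rho>}
        + emeasure M {\<omega>\<in>space M. 1 \<le> ennreal (1 / \<rho>\<^sup>2) * ennreal ((Y \<omega> - ?S n \<omega>)\<^sup>2)}"
      by (rule order_trans[OF emeasure_mono emeasure_subadditive]) auto
    also have "\<dots> \<le> ennreal (4 * \<rho> / \<sigma>) + ennreal (1 / \<rho>\<^sup>2) * e' n" using 1 2 by (intro add_mono)
    finally show ?thesis .
  qed
  have "eventually (\<lambda>n. e n < ennreal (\<sigma>\<^sup>2 / 4)) sequentially"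
    using limf \<sigma> unfolding e_def by (intro order_tendstoD) auto
  then have "eventually (\<lambda>n. emeasure M {\<omega>\<in>space M. \<bar>Z \<omega> + Y \<omega>\<bar> \<le> \<rho>} \<le> ennreal (4 * \<rho> / \<sigma>) + ennreal (1 / \<rho>\<^sup>2) * e' n) sequentially"
    by eventually_elim (rule main)
  moreover have "(\<lambda>n. ennreal (4 * \<rho> / \<sigma>) + ennreal (1 / \<rho>\<^sup>2) * e' n) \<longlonglongrightarrow> ennreal (4 * \<rho> / \<sigma>) + ennreal (1 / \<rho>\<^sup>2) * 0"
    using lim unfolding e'_def by (intro tendsto_add ennreal_tendsto_cmult tendsto_const) auto
  ultimately show ?thesis
    by (intro tendsto_lowerbound[of _ _ sequentially]) auto
qed

end

section \<open>Uniqueness, and adaptedness of time integrals\<close>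

lemma piecewise_uniformly_continuous_isCont:
  assumes g: "piecewise_uniformly_continuous m a g" and m: "1 \<le> m" and x: "x \<notin> a ` {1..m}"
  shows "isCont g x"
proof -
  have cont: "isCont g x" if "uniformly_continuous_on S g" "x \<in> S" "open S" for S
    using uniformly_continuous_imp_continuous[OF that(1)] that(2,3) by (simp add: continuous_on_eq_continuous_at)
  show ?thesis
  proof (cases "x < a 1")
    case True
    then show ?thesis using g by (intro cont[of "{..<a 1}"]) (auto simp: piecewise_uniformly_continuous_def)
  next
    case False
    define I where "I = {i\<in>{1..m}. a i < x}"
    have "1 \<in> I" using False x m by (auto simp: I_def image_iff) (metis atLeastAtMost_iff le_refl linorder_neqE_linordered_idom)
    then have I: "finite I" "I \<noteq> {}" by (auto simp: I_def)
    \<comment> \<open>The last breakpoint to the left of \<open>x\<close>. If there is a next one,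
      it is not to the left by maximality and differs from \<open>x\<close>, so \<open>x\<close>
      lies in the open piece between the two.\<close>
    define i where "i = Max I"
    have i: "i \<in> I" unfolding i_def using I by (rule Max_in)
    show ?thesis
    proof (cases "i = m")
      case True
      then show ?thesis using g i by (intro cont[of "{a m<..}"]) (auto simp: piecewise_uniformly_continuous_def I_def)
    next
      case False
      then have im: "i < m" "1 \<le> i" using i by (auto simp: I_def)
      have "Suc i \<notin> I" using Max_ge[OF I(1), of "Suc i"] unfolding i_def by auto
      then have "\<not> a (Suc i) < x" using im by (auto simp: I_def)
      moreover have "x \<noteq> a (Suc i)" using x im by auto
      ultimately have "x \<in> {a i<..<a (Suc i)}" using i by (auto simp: I_def)
      moreover have "uniformly_continuous_on {a i<..<a (Suc i)} g"
        using g im by (auto simp: piecewise_uniformly_continuous_def)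
      ultimately show ?thesis by (intro cont[of "{a i<..<a (Suc i)}"]) auto
    qed
  qed
qed

text \<open>The noise cancels in \<open>X - Y\<close>, so this difference is continuous even where
  \<open>X\<close> and \<open>Y\<close> are not. While it is positive, its density \<open>d\<close>
  is at most 0 by monotonicity, so it cannot rise above 0.\<close>

lemma monotone_solution_le:
  fixes b :: "real \<Rightarrow> real \<Rightarrow> real"
  assumes anti: "\<And>s. s \<in> {0..T} \<Longrightarrow> antimono (b s)"
    and X: "\<And>t. t \<in> {0..T} \<Longrightarrow> set_integrable lebesgue {0..t} (\<lambda>s. b s (X s)) \<and>
        X t = z + (LINT s:{0..t}|lebesgue. b s (X s)) + w t"
    and Y: "\<And>t. t \<in> {0..T} \<Longrightarrow> set_integrable lebesgue {0..t} (\<lambda>s. b s (Y s)) \<and>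
        Y t = z + (LINT s:{0..t}|lebesgue. b s (Y s)) + w t"
    and t: "t \<in> {0..T}"
  shows "X t \<le> Y t"
proof -
  define d where "d s = b s (X s) - b s (Y s)" for s
  have d: "set_integrable lebesgue {0..t} d" "X t - Y t = integral {0..t} d" if "t \<in> {0..T}" for t
  proof -
    show *: "set_integrable lebesgue {0..t} d"
      unfolding d_def using X[OF that] Y[OF that] by (intro set_integral_diff) auto
    have "X t - Y t = (LINT s:{0..t}|lebesgue. d s)"
      using X[OF that] Y[OF that] unfolding d_def by (subst set_integral_diff) auto
    also have "\<dots> = integral {0..t} d" using set_lebesgue_integral_eq_integral(2)[OF *] .
    finally show "X t - Y t = integral {0..t} d" .
  qed
  have int: "d integrable_on {0..T}"
    using set_lebesgue_integral_eq_integral(1)[OF d(1)[of T]] t by auto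
  have "X t - Y t \<le> 0"
  proof (rule level_comparison[OF _ _ _ t, where D="\<lambda>t. X t - Y t"])
    have "continuous_on {0..T} (\<lambda>t. integral {0..t} d)" by (rule indefinite_integral_continuous_1[OF int])
    then show "continuous_on {0..T} (\<lambda>t. X t - Y t)"
      by (subst continuous_on_cong[OF refl d(2)]) auto
    show "X 0 - Y 0 \<le> 0" using d(2)[of 0] t by auto
    fix s t assume st: "0 \<le> s" "s \<le> t" "t \<le> T" and pos: "\<forall>r\<in>{s<..<t}. 0 < X r - Y r"
    have le: "d r \<le> 0" if "r \<in> {s<..<t}" for r
      using pos that st antimonoD[OF anti[of r], of "Y r" "X r"] by (force simp: d_def)
    have i: "d integrable_on {s..t}" "d integrable_on {0..t}"
      using integrable_on_subinterval[OF int] st by auto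
    have "integral {0..t} d = integral {0..s} d + integral {s..t} d"
      using Henstock_Kurzweil_Integration.integral_combine[OF st(1,2) i(2)] by simp
    moreover have "integral {s..t} d \<le> 0"
    proof -
      have "integral {s..t} d = integral {s<..<t} d" by (rule integral_open_interval_real)
      also have "\<dots> \<le> integral {s<..<t} (\<lambda>_. 0)"
        using i(1) le by (intro integral_le) (auto simp: integrable_on_open_interval_real)
      finally show ?thesis by simp
    qed
    ultimately show "X t - Y t \<le> X s - Y s" using d(2)[of t] d(2)[of s] st by auto
  qed
  then show ?thesis by simp
qed

section \<open>Adaptedness of time integrals\<close>

context brownian
begin

text \<open>No progressively measurable version of \<open>V\<close> is needed: with \<open>Z\<close> the integral and \<open>Z'\<close> its
  conditional expectation given \<open>F t\<close>, Fubini and the adaptedness of each \<open>V s\<close> give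
  \<open>E (Z Z) = E (Z Z') = E (Z' Z')\<close>, so \<open>Z = Z'\<close> almost surely.\<close>

lemma bounded_integral_adapted:
  fixes V :: "real \<Rightarrow> 'a \<Rightarrow> real"
  assumes V [measurable]: "(\<lambda>(s, \<omega>). V s \<omega>) \<in> borel_measurable (borel \<Otimes>\<^sub>M M)"
    and VF: "\<And>s. s \<in> {r..<t} \<Longrightarrow> V s \<in> borel_measurable (F t)"
    and bound: "\<And>s \<omega>. \<bar>V s \<omega>\<bar> \<le> N" and t: "t \<le> T"
  shows "(\<lambda>\<omega>. LBINT s:{r..<t}. V s \<omega>) \<in> borel_measurable (F t)"
proof -
  interpret S: finite_measure_subalgebra M "F t"
    using sets_F_subset[OF t] by unfold_locales (auto simp: subalgebra_def)
  interpret P: pair_sigma_finite lborel M by unfold_locales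
  define U where "U s \<omega> = indicator {r..<t} s * V s \<omega>" for s \<omega>
  have U [measurable]: "(\<lambda>(s, \<omega>). U s \<omega>) \<in> borel_measurable (borel \<Otimes>\<^sub>M M)"
    unfolding U_def by measurable
  have UF: "U s \<in> borel_measurable (F t)" for s
    unfolding U_def using VF[of s] by (cases "s \<in> {r..<t}") auto
  have UM [measurable]: "U s \<in> borel_measurable M" for s using measurable_F_M[OF t UF] .
  have N: "0 \<le> N" using order_trans[OF abs_ge_zero bound] .
  have Ub: "\<bar>U s \<omega>\<bar> \<le> N * indicator {r..<t} s" for s \<omega> using bound[of s \<omega>] N by (auto simp: U_def indicator_def)
  have ii: "integrable lborel (\<lambda>s. c * indicator {r..<t} s)" for c :: real
    by (cases "r \<le> t") auto
  define Z where "Z \<omega> = (\<integral>s. U s \<omega> \<partial>lborel)" for \<omega>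
  have Z [measurable]: "Z \<in> borel_measurable M" unfolding Z_def by measurable
  have Zb: "\<bar>Z \<omega>\<bar> \<le> (\<integral>s. N * indicator {r..<t} s \<partial>lborel)" if "\<omega> \<in> space M" for \<omega>
  proof -
    have "integrable lborel (\<lambda>s. U s \<omega>)"
      using Ub that by (intro Bochner_Integration.integrable_bound[OF ii[of N]]) (auto intro: order_trans[OF Ub abs_ge_self])
    then show ?thesis unfolding Z_def using Ub
      by (intro order_trans[OF integral_abs_bound] integral_mono ii) auto
  qed
  have Zi: "integrable M Z" using Zb by (intro integrable_const_bound) auto
  define Z' where "Z' = real_cond_exp M (F t) Z"
  have Z'F: "Z' \<in> borel_measurable (F t)" unfolding Z'_def by simp
  have [measurable]: "Z' \<in> borel_measurable M" using measurable_F_M[OF t Z'F] .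
  have Z'i: "integrable M Z'" unfolding Z'_def using S.real_cond_exp_int(1)[OF Zi] .
  have mult_bounded: "integrable M (\<lambda>\<omega>. G \<omega> * Y \<omega>)"
    if "integrable M Y" "G \<in> borel_measurable M" and bounded: "\<And>\<omega>. \<omega> \<in> space M \<Longrightarrow> \<bar>G \<omega>\<bar> \<le> k" for G Y :: "'a \<Rightarrow> real" and k :: real
  proof -
    have "\<bar>G \<omega>\<bar> \<le> \<bar>k\<bar>" if "\<omega> \<in> space M" for \<omega> using bounded[OF that] by linarith
    then have "AE \<omega> in M. norm (G \<omega> * Y \<omega>) \<le> norm (k * Y \<omega>)"
      by (intro AE_I2) (simp add: abs_mult mult_right_mono)
    moreover have "integrable M (\<lambda>\<omega>. k * Y \<omega>)" using that(1) by simp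
    moreover have "(\<lambda>\<omega>. G \<omega> * Y \<omega>) \<in> borel_measurable M" using that(1,2) by simp
    ultimately show ?thesis by (rule Bochner_Integration.integrable_bound[rotated 2])
  qed
  have fub: "(\<integral>\<omega>. Z \<omega> * Y \<omega> \<partial>M) = (\<integral>s. (\<integral>\<omega>. U s \<omega> * Y \<omega> \<partial>M) \<partial>lborel)" if Y: "integrable M Y" for Y
  proof -
    have [measurable]: "Y \<in> borel_measurable M" using Y by simp
    have Uint: "integrable M (\<lambda>\<omega>. U s \<omega> * Y \<omega>)" for s
      using Y UM Ub by (rule mult_bounded)
    have "integrable lborel (\<lambda>s. \<integral>\<omega>. norm (U s \<omega> * Y \<omega>) \<partial>M)"
    proof (rule Bochner_Integration.integrable_bound[OF ii[of "N * (\<integral>\<omega>. \<bar>Y \<omega>\<bar> \<partial>M)"]])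
      show "AE s in lborel. norm (\<integral>\<omega>. norm (U s \<omega> * Y \<omega>) \<partial>M) \<le> norm (N * (\<integral>\<omega>. \<bar>Y \<omega>\<bar> \<partial>M) * indicator {r..<t} s)"
      proof (intro AE_I2)
        fix s
        have "(\<integral>\<omega>. norm (U s \<omega> * Y \<omega>) \<partial>M) \<le> (\<integral>\<omega>. (N * indicator {r..<t} s) * \<bar>Y \<omega>\<bar> \<partial>M)"
        proof (rule integral_mono)
          show "integrable M (\<lambda>\<omega>. norm (U s \<omega> * Y \<omega>))" by (rule integrable_norm[OF Uint])
          show "integrable M (\<lambda>\<omega>. (N * indicator {r..<t} s) * \<bar>Y \<omega>\<bar>)" using Y by simp
          show "norm (U s \<omega> * Y \<omega>) \<le> N * indicator {r..<t} s * \<bar>Y \<omega>\<bar>" for \<omega>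
            unfolding real_norm_def abs_mult by (rule mult_right_mono[OF Ub]) simp
        qed
        also have "\<dots> = N * (\<integral>\<omega>. \<bar>Y \<omega>\<bar> \<partial>M) * indicator {r..<t} s" by simp
        finally show "norm (\<integral>\<omega>. norm (U s \<omega> * Y \<omega>) \<partial>M) \<le> norm (N * (\<integral>\<omega>. \<bar>Y \<omega>\<bar> \<partial>M) * indicator {r..<t} s)"
          using N by (simp add: integral_nonneg)
      qed
    qed measurable
    then have "integrable (lborel \<Otimes>\<^sub>M M) (\<lambda>(s, \<omega>). U s \<omega> * Y \<omega>)"
      using Uint by (intro P.Fubini_integrable) auto
    then have "(\<integral>\<omega>. \<integral>s. U s \<omega> * Y \<omega> \<partial>lborel \<partial>M) = (\<integral>s. \<integral>\<omega>. U s \<omega> * Y \<omega> \<partial>M \<partial>lborel)"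
      by (rule P.Fubini_integral)
    then show ?thesis by (simp add: Z_def)
  qed
  have "(\<integral>\<omega>. Z \<omega> * Z \<omega> \<partial>M) = (\<integral>s. (\<integral>\<omega>. U s \<omega> * Z \<omega> \<partial>M) \<partial>lborel)" using Zi by (rule fub)
  also have "\<dots> = (\<integral>s. (\<integral>\<omega>. U s \<omega> * Z' \<omega> \<partial>M) \<partial>lborel)"
  proof -
    have "(\<integral>\<omega>. U s \<omega> * Z' \<omega> \<partial>M) = (\<integral>\<omega>. U s \<omega> * Z \<omega> \<partial>M)" for s
      unfolding Z'_def by (intro S.real_cond_exp_intg(2) mult_bounded[OF Zi UM Ub] UF Z)
    then show ?thesis by simp
  qed
  also have "\<dots> = (\<integral>\<omega>. Z \<omega> * Z' \<omega> \<partial>M)" using fub[OF Z'i] by simp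
  finally have 1: "(\<integral>\<omega>. Z \<omega> * Z \<omega> \<partial>M) = (\<integral>\<omega>. Z \<omega> * Z' \<omega> \<partial>M)" .
  have iZZ': "integrable M (\<lambda>\<omega>. Z \<omega> * Z' \<omega>)" using Z'i Z Zb by (rule mult_bounded)
  have iZZ: "integrable M (\<lambda>\<omega>. Z \<omega> * Z \<omega>)" using Zi Z Zb by (rule mult_bounded)
  have iZ'Z: "integrable M (\<lambda>\<omega>. Z' \<omega> * Z \<omega>)" using iZZ' by (simp add: mult.commute)
  note 2 = S.real_cond_exp_intg[OF iZ'Z Z'F Z, folded Z'_def]
  have "(\<integral>\<omega>. (Z \<omega> - Z' \<omega>)\<^sup>2 \<partial>M) = (\<integral>\<omega>. Z \<omega> * Z \<omega> - 2 * (Z \<omega> * Z' \<omega>) + Z' \<omega> * Z' \<omega> \<partial>M)"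
    by (intro Bochner_Integration.integral_cong) (auto simp: power2_eq_square algebra_simps)
  also have "\<dots> = 0" using iZZ iZZ' 2 1 by (simp add: mult.commute)
  finally have "(\<integral>\<omega>. (Z \<omega> - Z' \<omega>)\<^sup>2 \<partial>M) = 0" .
  moreover have "integrable M (\<lambda>\<omega>. (Z \<omega> - Z' \<omega>)\<^sup>2)"
  proof -
    have "integrable M (\<lambda>\<omega>. Z \<omega> * Z \<omega> - 2 * (Z \<omega> * Z' \<omega>) + Z' \<omega> * Z' \<omega>)"
      using iZZ iZZ' 2(1) by auto
    then show ?thesis by (simp add: power2_eq_square algebra_simps)
  qed
  ultimately have "AE \<omega> in M. (Z \<omega> - Z' \<omega>)\<^sup>2 = 0"
    by (subst (asm) integral_nonneg_eq_0_iff_AE) auto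
  then have "AE \<omega> in M. Z' \<omega> = Z \<omega>" by eventually_elim auto
  then have "Z \<in> borel_measurable (F t)"
    by (intro augmented_filtration_AE_cong[OF Z'F]) auto
  then show ?thesis by (simp add: Z_def[abs_def] U_def set_lebesgue_integral_def)
qed

text \<open>Truncation at level \<open>n\<close> reduces to the bounded case, and dominated
  convergence removes it on the almost sure event where the integral exists.\<close>

lemma integral_adapted:
  fixes V :: "real \<Rightarrow> 'a \<Rightarrow> real"
  assumes V [measurable]: "(\<lambda>(s, \<omega>). V s \<omega>) \<in> borel_measurable (borel \<Otimes>\<^sub>M M)"
    and VF: "\<And>s. s \<in> {r..<t} \<Longrightarrow> V s \<in> borel_measurable (F t)"
    and int: "AE \<omega> in M. set_integrable lborel {r..<t} (\<lambda>s. V s \<omega>)" and t: "t \<le> T"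
  shows "(\<lambda>\<omega>. LBINT s:{r..<t}. V s \<omega>) \<in> borel_measurable (F t)"
proof -
  define Vn where "Vn n s \<omega> = max (- real n) (min (real n) (V s \<omega>))" for n s \<omega>
  have [measurable]: "(\<lambda>(s, \<omega>). Vn n s \<omega>) \<in> borel_measurable (borel \<Otimes>\<^sub>M M)" for n
    unfolding Vn_def by measurable
  have F: "(\<lambda>\<omega>. LBINT s:{r..<t}. Vn n s \<omega>) \<in> borel_measurable (F t)" for n
  proof (rule bounded_integral_adapted[where N="real n"])
    show "Vn n s \<in> borel_measurable (F t)" if "s \<in> {r..<t}" for s
      unfolding Vn_def by (intro borel_measurable_max borel_measurable_min borel_measurable_const VF that)
  qed (auto simp: Vn_def t)
  have M: "(\<lambda>\<omega>. LBINT s:{r..<t}. V s \<omega>) \<in> borel_measurable M"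
    unfolding set_lebesgue_integral_def by measurable
  show ?thesis
  proof (rule augmented_filtration_AE_cong[OF _ _ M])
    show "(\<lambda>\<omega>. lim (\<lambda>n. LBINT s:{r..<t}. Vn n s \<omega>)) \<in> borel_measurable (F t)"
      by (intro borel_measurable_lim_metric F)
    then show "(\<lambda>\<omega>. lim (\<lambda>n. LBINT s:{r..<t}. Vn n s \<omega>)) \<in> borel_measurable M"
      by (rule measurable_F_M[OF t])
    show "AE \<omega> in M. lim (\<lambda>n. LBINT s:{r..<t}. Vn n s \<omega>) = (LBINT s:{r..<t}. V s \<omega>)"
      using int AE_space
    proof eventually_elim
      case (elim \<omega>)
      have conv: "(\<lambda>n. Vn n s \<omega>) \<longlonglongrightarrow> V s \<omega>" for s
      proof (rule tendsto_eventually)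
        show "\<forall>\<^sub>F n in sequentially. Vn n s \<omega> = V s \<omega>"
          using eventually_ge_at_top[of "nat \<lceil>\<bar>V s \<omega>\<bar>\<rceil>"]
          by eventually_elim (auto simp: Vn_def min_def max_def abs_if nat_le_iff ceiling_le_iff split: if_splits)
      qed
      have "(\<lambda>n. \<integral>s. indicator {r..<t} s *\<^sub>R Vn n s \<omega> \<partial>lborel) \<longlonglongrightarrow> (\<integral>s. indicator {r..<t} s *\<^sub>R V s \<omega> \<partial>lborel)"
      proof (rule integral_dominated_convergence[where w="\<lambda>s. \<bar>indicator {r..<t} s *\<^sub>R V s \<omega>\<bar>"])
        show "integrable lborel (\<lambda>s. \<bar>indicator {r..<t} s *\<^sub>R V s \<omega>\<bar>)"
          using elim by (intro integrable_abs) (simp add: set_integrable_def)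
        show "AE s in lborel. norm (indicator {r..<t} s *\<^sub>R Vn n s \<omega>) \<le> \<bar>indicator {r..<t} s *\<^sub>R V s \<omega>\<bar>" for n
          by (intro AE_I2) (auto simp: Vn_def indicator_def)
        show "AE s in lborel. (\<lambda>n. indicator {r..<t} s *\<^sub>R Vn n s \<omega>) \<longlonglongrightarrow> indicator {r..<t} s *\<^sub>R V s \<omega>"
          by (intro AE_I2 tendsto_intros conv)
      qed (use elim(2) in measurable)
      then show ?case unfolding set_lebesgue_integral_def by (rule limI)
    qed
  qed
qed

end

section \<open>The solution\<close>

text \<open>The kernel is only Lebesgue measurable, so its sections need not depend measurably on \<open>t\<close>;
  hence the Borel majorant.\<close>

lemma L2_kernel_majorant:
  assumes "L2_kernel T K"
  shows "\<exists>\<kappa>\<in>borel_measurable lborel. (\<integral>\<^sup>+t. \<kappa> t \<partial>lborel) < \<infinity> \<and>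
    (AE t in lborel. indicator {0..T} t * (\<integral>\<^sup>+s\<in>{0..t}. ennreal ((K t s)\<^sup>2) \<partial>lebesgue) \<le> \<kappa> t)"
proof -
  let ?Q = "{0..T} \<times> {0..T}"
  define k where "k = (\<lambda>z. indicator ?Q z * (case z of (t, s) \<Rightarrow> K t s))"
  have km: "k \<in> borel_measurable lebesgue"
    using assms unfolding L2_kernel_def square_integrable_on_def set_borel_measurable_def k_def by simp
  then obtain k' where k': "k' \<in> borel_measurable lborel" and eq: "AE z in lborel. k z = k' z"
    using completion_ex_borel_measurable_real by blast
  have k'm [measurable]: "k' \<in> borel_measurable (borel \<Otimes>\<^sub>M borel)" using k' by (simp add: borel_prod)
  \<comment> \<open>Read as a statement about a product measure, equality almost everywhere passes
    to the sections at almost every \<open>t\<close>.\<close>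
  have "AE z in lborel \<Otimes>\<^sub>M lborel. k z = k' z" unfolding lborel_prod by (rule eq)
  then have ae: "AE t in lborel. AE s in lborel. k (t, s) = k' (t, s)" by (rule lborel_pair.AE_pair)
  have "AE t in lborel. indicator {0..T} t * (\<integral>\<^sup>+s\<in>{0..t}. ennreal ((K t s)\<^sup>2) \<partial>lebesgue) \<le> (\<integral>\<^sup>+s. ennreal ((k' (t, s))\<^sup>2) \<partial>lborel)"
    using ae
  proof eventually_elim
    case (elim t)
    have "(\<integral>\<^sup>+s\<in>{0..t}. ennreal ((K t s)\<^sup>2) \<partial>lebesgue) \<le> (\<integral>\<^sup>+s. ennreal ((k' (t, s))\<^sup>2) \<partial>lborel)" if t: "t \<in> {0..T}"
      unfolding nn_integral_completion using elim
      by (intro nn_integral_mono_AE) (use t in \<open>auto elim!: eventually_mono simp: k_def indicator_def split: if_splits\<close>)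
    then show ?case by (auto simp: indicator_def)
  qed
  moreover have "(\<integral>\<^sup>+t. \<integral>\<^sup>+s. ennreal ((k' (t, s))\<^sup>2) \<partial>lborel \<partial>lborel) < \<infinity>"
  proof -
    have "(\<integral>\<^sup>+t. \<integral>\<^sup>+s. ennreal ((k' (t, s))\<^sup>2) \<partial>lborel \<partial>lborel) = (\<integral>\<^sup>+z. ennreal ((k' z)\<^sup>2) \<partial>(lborel \<Otimes>\<^sub>M lborel))"
      by (rule lborel.nn_integral_fst) simp
    also have "\<dots> = (\<integral>\<^sup>+z. ennreal ((k z)\<^sup>2) \<partial>lebesgue)"
      unfolding lborel_prod nn_integral_completion using eq by (intro nn_integral_cong_AE) auto
    also have "\<dots> = (\<integral>\<^sup>+z. ennreal (norm (indicator ?Q z *\<^sub>R (case z of (t, s) \<Rightarrow> K t s)\<^sup>2)) \<partial>lebesgue)"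
      by (intro nn_integral_cong) (auto simp: k_def indicator_def)
    also have "\<dots> < \<infinity>"
      using assms unfolding L2_kernel_def square_integrable_on_def set_integrable_def integrable_iff_bounded by blast
    finally show ?thesis .
  qed
  moreover have "(\<lambda>t. \<integral>\<^sup>+s. ennreal ((k' (t, s))\<^sup>2) \<partial>lborel) \<in> borel_measurable lborel" by measurable
  ultimately show ?thesis by blast
qed

text \<open>Bridge between the schemes, which integrate over half-open intervals with
  \<open>lborel\<close>, and the notion of solution, which uses closed intervals and
  \<open>lebesgue\<close>.\<close>

lemma set_integral_lebesgue_closed:
  fixes g :: "real \<Rightarrow> real"
  assumes g: "set_integrable lborel {0..<t} g" and eq: "\<And>s. s \<in> {0..t} \<Longrightarrow> g s = g' s"
  shows "set_integrable lebesgue {0..t} g'" "(LINT s:{0..t}|lebesgue. g' s) = (LBINT s:{0..<t}. g s)"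
proof -
  let ?g = "\<lambda>s. indicator {0..<t} s *\<^sub>R g s" and ?h = "\<lambda>s. indicator {0..t} s *\<^sub>R g' s"
  have m: "?g \<in> borel_measurable lborel" and i: "integrable lborel ?g" using g by (simp_all add: set_integrable_def)
  \<comment> \<open>The value at \<open>t\<close> enters as a constant times the indicator of
    \<open>{t}\<close>, so Borel measurability of \<open>?h\<close> follows from that of
    \<open>?g\<close>.\<close>
  have h: "?h = (\<lambda>s. ?g s + indicator {t} s * (indicator {0..t} t * g' t))"
    using eq by (auto simp: fun_eq_iff indicator_def)
  have m': "?h \<in> borel_measurable lborel" unfolding h using m by measurable
  have ae: "AE s in lborel. ?g s = ?h s"
    using AE_lborel_singleton[of t] by eventually_elim (auto simp: indicator_def eq)
  have "integrable lborel ?h" using integrable_cong_AE_imp[OF i m' ae] .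
  then show "set_integrable lebesgue {0..t} g'"
    unfolding set_integrable_def using m' by (simp add: integrable_completion)
  show "(LINT s:{0..t}|lebesgue. g' s) = (LBINT s:{0..<t}. g s)"
    unfolding set_lebesgue_integral_def integral_completion[OF m'] using m' m ae by (intro integral_cong_AE[symmetric])
qed

section \<open>The equation as an ordinary differential equation with random coefficients\<close>

locale volterra_sde = brownian M W T for M :: "'a measure" and W T +
  fixes K b :: "real \<Rightarrow> real \<Rightarrow> real" and B :: "real \<Rightarrow> 'a \<Rightarrow> real" and H c C x0 :: real
  assumes T_pos: "0 < T"
    and kernel: "L2_kernel T K"
    and volterra: "volterra_process M W T K B"
    and H_less: "H < 1" and c_pos: "0 < c"
    and nondegenerate: "\<And>t \<epsilon>. t \<in> {0<..T} \<Longrightarrow> \<epsilon> \<in> {0<..<t} \<Longrightarrow>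
           c * \<epsilon> powr H \<le> sqrt (LINT s:{t-\<epsilon>..t}|lebesgue. (K t s)\<^sup>2)"
    and b_measurable: "set_borel_measurable borel ({0..T} \<times> UNIV) (\<lambda>(t, x). b t x)"
    and b_growth: "\<And>t x. t \<in> {0..T} \<Longrightarrow> \<bar>b t x\<bar> \<le> C * (1 + \<bar>x\<bar>)"
    and b_antimono: "\<And>t. t \<in> {0..T} \<Longrightarrow> antimono (b t)"
begin

text \<open>\<open>B\<close> is controlled at times in \<open>[0, T]\<close> only; extension by 0
  gives joint measurability on the whole line and frees later time integrals from side
  conditions.\<close>

definition B0 :: "real \<Rightarrow> 'a \<Rightarrow> real" where
  "B0 s \<omega> = indicator {0..T} s * B s \<omega>"

definition drift :: "'a \<Rightarrow> real \<Rightarrow> real \<Rightarrow> real" where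
  "drift \<omega> s y = indicator {0..T} s * b s (x0 + B0 s \<omega> + y)"

text \<open>The function \<open>p\<close> of \<open>dissipative_ode\<close>, obtained from the
  linear growth of \<open>b\<close> by the triangle inequality.\<close>

definition envelope :: "'a \<Rightarrow> real \<Rightarrow> real" where
  "envelope \<omega> s = indicator {0..T} s * (C * (1 + \<bar>x0\<bar> + \<bar>B0 s \<omega>\<bar>))"

lemma C_nonneg: "0 \<le> C"
  using order_trans[OF abs_ge_zero b_growth[of 0 0]] T_pos by simp

lemma measurable_b0: "(\<lambda>(s, x). indicator {0..T} s * b s x) \<in> borel_measurable (borel \<Otimes>\<^sub>M borel)"
proof -
  have "(\<lambda>z. indicator ({0..T} \<times> UNIV) z *\<^sub>R (case z of (t, x) \<Rightarrow> b t x)) = (\<lambda>(s, x::real). indicator {0..T} s * b s x)"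
    by (auto simp: fun_eq_iff indicator_def)
  then show ?thesis using b_measurable unfolding set_borel_measurable_def borel_prod by simp
qed

lemma measurable_B0 [measurable]: "(\<lambda>(s, \<omega>). B0 s \<omega>) \<in> borel_measurable (borel \<Otimes>\<^sub>M M)"
proof -
  have B: "(\<lambda>(t, \<omega>). B t \<omega>) \<in> borel_measurable (restrict_space borel {0..T} \<Otimes>\<^sub>M M)"
    using volterra by (simp add: volterra_process_def)
  \<comment> \<open>Clamping maps the line into \<open>[0, T]\<close>, where \<open>B\<close> is
    jointly measurable; the indicator then removes the values at clamped times.\<close>
  have clamp: "(\<lambda>s. max 0 (min T s)) \<in> measurable borel (restrict_space borel {0..T})"
    using T_pos by (intro measurable_restrict_space2) auto
  have "(\<lambda>z. (max 0 (min T (fst z)), snd z)) \<in> measurable (borel \<Otimes>\<^sub>M M) (restrict_space borel {0..T} \<Otimes>\<^sub>M M)"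
    by (intro measurable_Pair measurable_compose[OF measurable_fst clamp] measurable_snd)
  from measurable_compose[OF this B]
  have [measurable]: "(\<lambda>z. B (max 0 (min T (fst z))) (snd z)) \<in> borel_measurable (borel \<Otimes>\<^sub>M M)" by simp
  have "(\<lambda>z. indicator {0..T} (fst z) * B (max 0 (min T (fst z))) (snd z)) \<in> borel_measurable (borel \<Otimes>\<^sub>M M)"
    by measurable
  also have "(\<lambda>z. indicator {0..T} (fst z) * B (max 0 (min T (fst z))) (snd z)) = (\<lambda>(s, \<omega>). B0 s \<omega>)"
    by (auto simp: fun_eq_iff B0_def indicator_def)
  finally show ?thesis .
qed

text \<open>The point \<omega> enters only through the noise. Letting \<omega>, \<open>s\<close> and
  \<open>y\<close> depend on a parameter in an arbitrary space covers fixed \<omega>, fixed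
  \<open>s\<close> over \<open>F t\<close>, and joint measurability at once.\<close>

lemma measurable_drift:
  assumes [measurable]: "s \<in> borel_measurable N" "y \<in> borel_measurable N"
    and "(\<lambda>z. B0 (s z) (\<omega> z)) \<in> borel_measurable N"
  shows "(\<lambda>z. drift (\<omega> z) (s z) (y z)) \<in> borel_measurable N"
proof -
  note [measurable] = assms(3)
  have "(\<lambda>z. (s z, x0 + B0 (s z) (\<omega> z) + y z)) \<in> measurable N (borel \<Otimes>\<^sub>M borel)" by measurable
  from measurable_compose[OF this measurable_b0] show ?thesis unfolding drift_def by simp
qed

lemma B0_adapted:
  assumes "0 \<le> s" "s \<le> t" "t \<le> T"
  shows "B0 s \<in> borel_measurable (F t)"
proof -
  have "B s \<in> borel_measurable (F s)"
    using volterra assms by (intro has_wiener_integral_adapted[of s "K s"]) (auto simp: volterra_process_def)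
  then have "B s \<in> borel_measurable (F t)" using augmented_filtration_mono assms by blast
  then show ?thesis unfolding B0_def by (intro borel_measurable_times borel_measurable_const)
qed

lemma drift_adapted:
  assumes "0 \<le> s" "s \<le> t" "t \<le> T" "y \<in> borel_measurable (F t)"
  shows "(\<lambda>\<omega>. drift \<omega> s (y \<omega>)) \<in> borel_measurable (F t)"
  using assms by (intro measurable_drift B0_adapted) auto

lemma measurable_envelope [measurable]: "(\<lambda>(s, \<omega>). envelope \<omega> s) \<in> borel_measurable (borel \<Otimes>\<^sub>M M)"
  unfolding envelope_def by measurable

lemma envelope_nonneg: "0 \<le> envelope \<omega> s"
  using C_nonneg by (auto simp: envelope_def)

text \<open>The modulus of the noise is at most \<open>1 + (B0 s \<omega>)\<^sup>2\<close>, the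
  second moment is bounded by the kernel, and the square integrability of the kernel makes the time
  integral finite.\<close>

lemma envelope_finite: "(\<integral>\<^sup>+s. \<integral>\<^sup>+\<omega>. ennreal (envelope \<omega> s) \<partial>M \<partial>lborel) < \<infinity>"
proof -
  let ?k = "\<lambda>t. indicator {0..T} t * (\<integral>\<^sup>+s\<in>{0..t}. ennreal ((K t s)\<^sup>2) \<partial>lebesgue)"
  let ?m = "\<lambda>s. (\<integral>\<^sup>+\<omega>. ennreal ((B0 s \<omega>)\<^sup>2) \<partial>M)"
  let ?D = "C * (2 + \<bar>x0\<bar>)"
  have env: "ennreal (envelope \<omega> s) \<le> ennreal ?D * indicator {0..T} s + ennreal C * ennreal ((B0 s \<omega>)\<^sup>2)" for \<omega> s
  proof (cases "s \<in> {0..T}")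
    case True
    have "\<bar>B0 s \<omega>\<bar> \<le> 1 + (B0 s \<omega>)\<^sup>2"
    proof -
      have "0 \<le> (\<bar>B0 s \<omega>\<bar> - 1 / 2)\<^sup>2" by simp
      then show ?thesis by (simp add: power2_eq_square algebra_simps flip: abs_mult)
    qed
    then have "C * (1 + \<bar>x0\<bar> + \<bar>B0 s \<omega>\<bar>) \<le> C * (1 + \<bar>x0\<bar> + (1 + (B0 s \<omega>)\<^sup>2))"
      using C_nonneg by (intro mult_left_mono) auto
    then have "envelope \<omega> s \<le> ?D + C * (B0 s \<omega>)\<^sup>2"
      using True by (simp add: envelope_def algebra_simps)
    then have "ennreal (envelope \<omega> s) \<le> ennreal (?D + C * (B0 s \<omega>)\<^sup>2)" by (rule ennreal_leI)
    also have "\<dots> = ennreal ?D + ennreal C * ennreal ((B0 s \<omega>)\<^sup>2)"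
      using C_nonneg by (subst ennreal_plus) (auto simp: ennreal_mult)
    finally show ?thesis using True by simp
  qed (auto simp: envelope_def)
  have m: "?m s \<le> 4 * ?k s" for s
  proof (cases "s \<in> {0..T}")
    case True
    then show ?thesis using has_wiener_integral_second_moment[of s "K s" "B s"] volterra
      by (auto simp: volterra_process_def B0_def)
  qed (simp add: B0_def)
  have "(\<integral>\<^sup>+s. \<integral>\<^sup>+\<omega>. ennreal (envelope \<omega> s) \<partial>M \<partial>lborel)
      \<le> (\<integral>\<^sup>+s. \<integral>\<^sup>+\<omega>. ennreal ?D * indicator {0..T} s + ennreal C * ennreal ((B0 s \<omega>)\<^sup>2) \<partial>M \<partial>lborel)"
    by (intro nn_integral_mono env)
  also have "\<dots> = (\<integral>\<^sup>+s. ennreal ?D * indicator {0..T} s + ennreal C * ?m s \<partial>lborel)"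
    by (intro nn_integral_cong) (simp add: nn_integral_add nn_integral_cmult emeasure_space_1)
  also have "\<dots> = ennreal ?D * ennreal T + ennreal C * (\<integral>\<^sup>+s. ?m s \<partial>lborel)"
    using T_pos by (subst nn_integral_add) (simp_all add: nn_integral_cmult nn_integral_cmult_indicator)
  also have "\<dots> < \<infinity>"
  proof -
    obtain \<kappa> where \<kappa>: "\<kappa> \<in> borel_measurable lborel" "(\<integral>\<^sup>+t. \<kappa> t \<partial>lborel) < \<infinity>" "AE t in lborel. ?k t \<le> \<kappa> t"
      using L2_kernel_majorant[OF kernel] by blast
    have "AE s in lborel. ?m s \<le> 4 * \<kappa> s"
      using \<kappa>(3) by eventually_elim (rule order_trans[OF m mult_left_mono], auto)
    then have "(\<integral>\<^sup>+s. ?m s \<partial>lborel) \<le> (\<integral>\<^sup>+s. 4 * \<kappa> s \<partial>lborel)" by (rule nn_integral_mono_AE)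
    also have "\<dots> < \<infinity>" using \<kappa>(1,2) by (simp add: nn_integral_cmult ennreal_mult_less_top)
    finally show ?thesis by (simp add: ennreal_mult_less_top)
  qed
  finally show ?thesis .
qed

definition X :: "real \<Rightarrow> 'a \<Rightarrow> real" where
  "X t \<omega> = x0 + euler_limit (drift \<omega>) t + B0 t \<omega>"

lemma dissipative:
  assumes "integrable lborel (envelope \<omega>)" "\<omega> \<in> space M"
  shows "dissipative_ode (drift \<omega>) (envelope \<omega>) C"
proof
  have "(\<lambda>z. B0 (fst z) \<omega>) \<in> borel_measurable (borel \<Otimes>\<^sub>M (borel :: real measure))"
    using assms(2) by measurable
  then show "(\<lambda>(s, y). drift \<omega> s y) \<in> borel_measurable (borel \<Otimes>\<^sub>M borel)"
    unfolding case_prod_unfold by (intro measurable_drift) auto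
  show "antimono (drift \<omega> s)" for s
    using b_antimono[of s] by (auto simp: drift_def antimono_def indicator_def)
  show "\<bar>drift \<omega> s y\<bar> \<le> envelope \<omega> s + C * \<bar>y\<bar>" for s y
  proof (cases "s \<in> {0..T}")
    case True
    then have "\<bar>drift \<omega> s y\<bar> \<le> C * (1 + \<bar>x0 + B0 s \<omega> + y\<bar>)" using b_growth by (simp add: drift_def)
    also have "\<dots> \<le> C * (1 + \<bar>x0\<bar> + \<bar>B0 s \<omega>\<bar> + \<bar>y\<bar>)" using C_nonneg by (intro mult_left_mono) auto
    finally show ?thesis using True by (simp add: envelope_def algebra_simps)
  qed (use C_nonneg in \<open>auto simp: drift_def envelope_def\<close>)
  show "integrable lborel (envelope \<omega>)" by fact
  show "0 \<le> C" by (rule C_nonneg)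
qed

text \<open>By Fubini, the finite mean of the time integral makes the envelope integrable for almost
  every \<omega>. The pathwise theory of the schemes is applied on this event.\<close>

lemma AE_dissipative: "AE \<omega> in M. \<omega> \<in> space M \<and> dissipative_ode (drift \<omega>) (envelope \<omega>) C"
proof -
  interpret P: pair_sigma_finite lborel M by unfold_locales
  have "(\<integral>\<^sup>+\<omega>. \<integral>\<^sup>+s. ennreal (envelope \<omega> s) \<partial>lborel \<partial>M) < \<infinity>"
    using envelope_finite P.Fubini'[of "\<lambda>s \<omega>. ennreal (envelope \<omega> s)"] by simp
  then have "AE \<omega> in M. (\<integral>\<^sup>+s. ennreal (envelope \<omega> s) \<partial>lborel) \<noteq> \<infinity>"
    by (intro nn_integral_PInf_AE) auto
  then show ?thesis using AE_space
  proof eventually_elim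
    case (elim \<omega>)
    have "envelope \<omega> \<in> borel_measurable lborel" using elim(2) by measurable
    then have "integrable lborel (envelope \<omega>)"
      using elim envelope_nonneg by (intro integrableI_bounded) (auto simp: top.not_eq_extremum)
    then show ?case using dissipative elim by simp
  qed
qed

section \<open>Measurability and adaptedness of the schemes\<close>

lemma measurable_euler: "(\<lambda>\<omega>. euler (drift \<omega>) h k) \<in> borel_measurable M"
proof (induction k)
  case (Suc k)
  note [measurable] = Suc
  have [measurable]: "(\<lambda>(\<omega>, s). drift \<omega> s (euler (drift \<omega>) h k)) \<in> borel_measurable (M \<Otimes>\<^sub>M borel)"
    unfolding case_prod_unfold by (intro measurable_drift) measurable
  show ?case unfolding euler.simps set_lebesgue_integral_def by measurable
qed simp

lemma measurable_euler_drift [measurable]: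
  "(\<lambda>(\<omega>, s). euler_drift (drift \<omega>) h s) \<in> borel_measurable (M \<Otimes>\<^sub>M borel)"
proof -
  have [measurable]: "(\<lambda>z. euler (drift (fst z)) h (nat \<lfloor>snd z / h\<rfloor>)) \<in> borel_measurable (M \<Otimes>\<^sub>M borel)"
    by (rule measurable_compose_countable[where f="\<lambda>k z. euler (drift (fst z)) h k" and g="\<lambda>z. nat \<lfloor>snd z / h\<rfloor>"])
      (use measurable_euler in measurable)
  show ?thesis unfolding case_prod_unfold euler_drift_def by (intro measurable_drift) measurable
qed

lemma measurable_euler_path [measurable]:
  "(\<lambda>(\<omega>, t). euler_path (drift \<omega>) h t) \<in> borel_measurable (M \<Otimes>\<^sub>M borel)"
proof -
  have [measurable]: "(\<lambda>x. euler_drift (drift (fst (fst x))) h (snd x)) \<in> borel_measurable ((M \<Otimes>\<^sub>M borel) \<Otimes>\<^sub>M (lborel :: real measure))"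
    using measurable_compose[OF _ measurable_euler_drift, of "\<lambda>x. (fst (fst x), snd x)" "(M \<Otimes>\<^sub>M borel) \<Otimes>\<^sub>M lborel"]
    by simp
  have "(\<lambda>x. if 0 \<le> snd x \<and> snd x < snd (fst x) then euler_drift (drift (fst (fst x))) h (snd x) else 0)
      \<in> borel_measurable ((M \<Otimes>\<^sub>M borel) \<Otimes>\<^sub>M (lborel :: real measure))"
    by measurable
  also have "(\<lambda>x. if 0 \<le> snd x \<and> snd x < snd (fst x) then euler_drift (drift (fst (fst x))) h (snd x) else 0)
      = (\<lambda>(z, s). indicator {0..<snd z} s *\<^sub>R euler_drift (drift (fst z)) h s)"
    by (auto simp: fun_eq_iff indicator_def)
  finally show ?thesis
    using lborel.borel_measurable_lebesgue_integral
    unfolding euler_path_def set_lebesgue_integral_def case_prod_unfold by simp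
qed

lemma measurable_euler_limit [measurable]:
  "(\<lambda>(\<omega>, t). euler_limit (drift \<omega>) t) \<in> borel_measurable (M \<Otimes>\<^sub>M borel)"
  unfolding euler_limit_def case_prod_unfold by measurable

lemma euler_adapted:
  assumes h: "0 < h" and k: "real k * h \<le> T"
  shows "(\<lambda>\<omega>. euler (drift \<omega>) h k) \<in> borel_measurable (F (real k * h))"
  using k
proof (induction k)
  case (Suc k)
  have le: "real k * h \<le> real (Suc k) * h" using h by (simp add: algebra_simps)
  then have IH: "(\<lambda>\<omega>. euler (drift \<omega>) h k) \<in> borel_measurable (F (real (Suc k) * h))"
    using Suc by (intro augmented_filtration_mono[OF le]) auto
  note [measurable] = measurable_euler
  have "(\<lambda>\<omega>. LBINT s:{real k * h..<real (Suc k) * h}. drift \<omega> s (euler (drift \<omega>) h k)) \<in> borel_measurable (F (real (Suc k) * h))"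
  proof (rule integral_adapted)
    show "(\<lambda>(s, \<omega>). drift \<omega> s (euler (drift \<omega>) h k)) \<in> borel_measurable (borel \<Otimes>\<^sub>M M)"
      unfolding case_prod_unfold by (intro measurable_drift) measurable
    show "(\<lambda>\<omega>. drift \<omega> s (euler (drift \<omega>) h k)) \<in> borel_measurable (F (real (Suc k) * h))"
      if "s \<in> {real k * h..<real (Suc k) * h}" for s
      using that h Suc.prems by (intro drift_adapted IH) (auto intro: order_trans[OF _ that[THEN atLeastLessThan_iff[THEN iffD1], THEN conjunct1]])
    show "AE \<omega> in M. set_integrable lborel {real k * h..<real (Suc k) * h} (\<lambda>s. drift \<omega> s (euler (drift \<omega>) h k))"
      using AE_dissipative by eventually_elim (auto intro: dissipative_ode.set_integrable_f)
  qed fact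
  then show ?case unfolding euler.simps using IH by (intro borel_measurable_add)
qed simp

lemma euler_path_adapted:
  assumes h: "0 < h" and t: "t \<in> {0..T}"
  shows "(\<lambda>\<omega>. euler_path (drift \<omega>) h t) \<in> borel_measurable (F t)"
proof -
  define k where "k = nat \<lfloor>t / h\<rfloor>"
  have k: "real k * h \<le> t" using grid_point[of h t] h t by (auto simp: k_def)
  have e: "(\<lambda>\<omega>. euler (drift \<omega>) h k) \<in> borel_measurable (F t)"
    using k t by (intro augmented_filtration_mono[OF k euler_adapted[OF h]]) auto
  note [measurable] = measurable_euler
  have i: "(\<lambda>\<omega>. LBINT s:{real k * h..<t}. drift \<omega> s (euler (drift \<omega>) h k)) \<in> borel_measurable (F t)"
  proof (rule integral_adapted)
    show "(\<lambda>(s, \<omega>). drift \<omega> s (euler (drift \<omega>) h k)) \<in> borel_measurable (borel \<Otimes>\<^sub>M M)"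
      unfolding case_prod_unfold by (intro measurable_drift) measurable
    show "(\<lambda>\<omega>. drift \<omega> s (euler (drift \<omega>) h k)) \<in> borel_measurable (F t)" if "s \<in> {real k * h..<t}" for s
    proof -
      have "0 \<le> real k * h" using h by simp
      then show ?thesis using that t by (intro drift_adapted e) auto
    qed
    show "AE \<omega> in M. set_integrable lborel {real k * h..<t} (\<lambda>s. drift \<omega> s (euler (drift \<omega>) h k))"
      using AE_dissipative by eventually_elim (auto intro: dissipative_ode.set_integrable_f)
  qed (use t in auto)
  have sum: "(\<lambda>\<omega>. euler (drift \<omega>) h k + (LBINT s:{real k * h..<t}. drift \<omega> s (euler (drift \<omega>) h k))) \<in> borel_measurable (F t)"
    using e i by (rule borel_measurable_add)
  show ?thesis
  proof (rule augmented_filtration_AE_cong[OF sum])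
    show "(\<lambda>\<omega>. euler (drift \<omega>) h k + (LBINT s:{real k * h..<t}. drift \<omega> s (euler (drift \<omega>) h k))) \<in> borel_measurable M"
      using t by (intro measurable_F_M[OF _ sum]) auto
    \<comment> \<open>The formula of \<open>euler_path_split\<close> is available on dissipative
      paths, hence almost surely.\<close>
    show "AE \<omega> in M. euler (drift \<omega>) h k + (LBINT s:{real k * h..<t}. drift \<omega> s (euler (drift \<omega>) h k)) = euler_path (drift \<omega>) h t"
      using AE_dissipative
      by eventually_elim (use dissipative_ode.euler_path_split[OF _ h t] in \<open>auto simp: k_def\<close>)
  qed measurable
qed

lemma euler_limit_adapted:
  "t \<in> {0..T} \<Longrightarrow> (\<lambda>\<omega>. euler_limit (drift \<omega>) t) \<in> borel_measurable (F t)"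
  unfolding euler_limit_def by (intro borel_measurable_lim_metric euler_path_adapted) auto

lemma X_adapted: "t \<in> {0..T} \<Longrightarrow> X t \<in> borel_measurable (F t)"
  unfolding X_def[abs_def] by (intro borel_measurable_add euler_limit_adapted B0_adapted borel_measurable_const) auto

section \<open>Absence of atoms at almost every time\<close>

definition dominator :: "'a \<Rightarrow> real \<Rightarrow> real" where
  "dominator \<omega> s = envelope \<omega> s + C * (exp (C * T) * (\<integral>r. envelope \<omega> r \<partial>lborel))"

lemma measurable_dominator [measurable]: "(\<lambda>(s, \<omega>). dominator \<omega> s) \<in> borel_measurable (borel \<Otimes>\<^sub>M M)"
proof -
  have "(\<lambda>(\<omega>, s). envelope \<omega> s) \<in> borel_measurable (M \<Otimes>\<^sub>M lborel)" by measurable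
  from lborel.borel_measurable_lebesgue_integral[OF this]
  have [measurable]: "(\<lambda>\<omega>. \<integral>r. envelope \<omega> r \<partial>lborel) \<in> borel_measurable M" by simp
  show ?thesis unfolding dominator_def by measurable
qed

lemma dominator_finite:
  "(\<integral>\<^sup>+s. indicator {0..T} s * (\<integral>\<^sup>+\<omega>. ennreal (dominator \<omega> s) \<partial>M) \<partial>lborel) < \<infinity>"
proof -
  interpret P: pair_sigma_finite lborel M by unfold_locales
  let ?k = "C * exp (C * T)"
  let ?I = "\<integral>\<^sup>+\<omega>. \<integral>\<^sup>+s. ennreal (envelope \<omega> s) \<partial>lborel \<partial>M"
  let ?e = "\<lambda>s. \<integral>\<^sup>+\<omega>. ennreal (envelope \<omega> s) \<partial>M"
  have I: "?I < \<infinity>"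
    using envelope_finite P.Fubini'[of "\<lambda>s \<omega>. ennreal (envelope \<omega> s)"] by simp
  \<comment> \<open>If the envelope is not integrable, its Bochner integral is 0 by convention, so
    the inequality holds for every \<omega>.\<close>
  have int: "ennreal (\<integral>r. envelope \<omega> r \<partial>lborel) \<le> (\<integral>\<^sup>+r. ennreal (envelope \<omega> r) \<partial>lborel)" for \<omega>
    by (cases "integrable lborel (envelope \<omega>)")
      (simp_all add: nn_integral_eq_integral envelope_nonneg not_integrable_integral_eq)
  have dom: "ennreal (dominator \<omega> s) \<le> ennreal (envelope \<omega> s) + ennreal ?k * (\<integral>\<^sup>+r. ennreal (envelope \<omega> r) \<partial>lborel)" for \<omega> s
  proof -
    have "ennreal (dominator \<omega> s) = ennreal (envelope \<omega> s) + ennreal ?k * ennreal (\<integral>r. envelope \<omega> r \<partial>lborel)"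
      unfolding dominator_def using C_nonneg envelope_nonneg
      by (subst ennreal_plus) (auto simp: integral_nonneg mult.assoc simp flip: ennreal_mult)
    then show ?thesis using int by (simp add: add_left_mono mult_left_mono)
  qed
  have "(\<integral>\<^sup>+s. indicator {0..T} s * (\<integral>\<^sup>+\<omega>. ennreal (dominator \<omega> s) \<partial>M) \<partial>lborel)
      \<le> (\<integral>\<^sup>+s. ?e s + (ennreal ?k * ?I) * indicator {0..T} s \<partial>lborel)"
  proof (intro nn_integral_mono)
    fix s
    have "(\<integral>\<^sup>+\<omega>. ennreal (dominator \<omega> s) \<partial>M)
        \<le> (\<integral>\<^sup>+\<omega>. ennreal (envelope \<omega> s) + ennreal ?k * (\<integral>\<^sup>+r. ennreal (envelope \<omega> r) \<partial>lborel) \<partial>M)"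
      by (intro nn_integral_mono dom)
    also have "\<dots> = ?e s + ennreal ?k * ?I"
      by (simp add: nn_integral_add nn_integral_cmult)
    finally show "indicator {0..T} s * (\<integral>\<^sup>+\<omega>. ennreal (dominator \<omega> s) \<partial>M) \<le> ?e s + (ennreal ?k * ?I) * indicator {0..T} s"
      by (auto simp: indicator_def)
  qed
  also have "\<dots> = (\<integral>\<^sup>+s. ?e s \<partial>lborel) + ennreal ?k * ?I * ennreal T"
    using T_pos by (simp add: nn_integral_add nn_integral_cmult)
  also have "\<dots> < \<infinity>" using I envelope_finite by (simp add: ennreal_mult_less_top)
  finally show ?thesis .
qed

lemma euler_limit_increment:
  assumes "\<omega> \<in> space M" "dissipative_ode (drift \<omega>) (envelope \<omega>) C" and st: "0 \<le> s" "s \<le> t" "t \<le> T"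
  shows "ennreal \<bar>euler_limit (drift \<omega>) t - euler_limit (drift \<omega>) s\<bar> \<le> (\<integral>\<^sup>+r. indicator {s..<t} r * ennreal (dominator \<omega> r) \<partial>lborel)"
proof -
  interpret dissipative_ode "drift \<omega>" "envelope \<omega>" C T by fact
  \<comment> \<open>\<open>dominator\<close> is the majorant of the schemes written outside their
    locale, so that it is defined for every \<omega> and can be averaged.\<close>
  have dom: "dominator \<omega> = bnd" by (simp add: fun_eq_iff bnd_def dominator_def)
  have "ennreal \<bar>euler_limit (drift \<omega>) t - euler_limit (drift \<omega>) s\<bar> \<le> ennreal (LBINT r:{s..<t}. bnd r)"
    using abs_euler_limit_diff_le[OF st] by (rule ennreal_leI)
  also have "\<dots> = (\<integral>\<^sup>+r. ennreal (indicator {s..<t} r *\<^sub>R bnd r) \<partial>lborel)"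
    unfolding set_lebesgue_integral_def using set_integrable_bnd bnd_nonneg
    by (intro nn_integral_eq_integral[symmetric]) (auto simp: set_integrable_def)
  also have "\<dots> = (\<integral>\<^sup>+r. indicator {s..<t} r * ennreal (dominator \<omega> r) \<partial>lborel)"
    unfolding dom by (intro nn_integral_cong) (auto simp: indicator_def)
  finally show ?thesis .
qed

lemma measurable_X [measurable]: "(\<lambda>(t, \<omega>). X t \<omega>) \<in> borel_measurable (borel \<Otimes>\<^sub>M M)"
  unfolding X_def by measurable

lemma kernel_lower_bound:
  assumes "0 < \<epsilon>" "\<epsilon> < t" "t \<le> T"
  shows "ennreal ((c * \<epsilon> powr H)\<^sup>2) \<le> (\<integral>\<^sup>+s\<in>{t-\<epsilon>..t}. ennreal ((K t s)\<^sup>2) \<partial>lebesgue)"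
proof -
  have "has_wiener_integral M W t (K t) (B t)" using volterra assms by (simp add: volterra_process_def)
  then have "set_integrable lebesgue {0..t} (\<lambda>s. (K t s)\<^sup>2)"
    by (simp add: has_wiener_integral_def square_integrable_on_def)
  then have i: "set_integrable lebesgue {t-\<epsilon>..t} (\<lambda>s. (K t s)\<^sup>2)"
    by (rule set_integrable_subset) (use assms in auto)
  have nn: "0 \<le> (LINT s:{t-\<epsilon>..t}|lebesgue. (K t s)\<^sup>2)"
    unfolding set_lebesgue_integral_def by (intro Bochner_Integration.integral_nonneg) auto
  have "c * \<epsilon> powr H \<le> sqrt (LINT s:{t-\<epsilon>..t}|lebesgue. (K t s)\<^sup>2)"
    using nondegenerate assms by auto
  then have "(c * \<epsilon> powr H)\<^sup>2 \<le> (sqrt (LINT s:{t-\<epsilon>..t}|lebesgue. (K t s)\<^sup>2))\<^sup>2"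
    using c_pos by (intro power_mono) auto
  then have "ennreal ((c * \<epsilon> powr H)\<^sup>2) \<le> ennreal (LINT s:{t-\<epsilon>..t}|lebesgue. (K t s)\<^sup>2)"
    using nn by (intro ennreal_leI) simp
  also have "\<dots> = (\<integral>\<^sup>+s. ennreal (indicator {t-\<epsilon>..t} s *\<^sub>R (K t s)\<^sup>2) \<partial>lebesgue)"
    unfolding set_lebesgue_integral_def using i
    by (intro nn_integral_eq_integral[symmetric]) (auto simp: set_integrable_def)
  also have "\<dots> = (\<integral>\<^sup>+s\<in>{t-\<epsilon>..t}. ennreal ((K t s)\<^sup>2) \<partial>lebesgue)"
    by (intro nn_integral_cong) (auto simp: indicator_def)
  finally show ?thesis .
qed

text \<open>If \<open>X t = x\<close>, then \<open>?Z + B t\<close> is minus the drift increment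
  over the last \<epsilon>, and \<open>?Z\<close> is known at \<open>t - \<epsilon>\<close>. An
  increment of at most \<rho> puts \<open>?Z + B t\<close> into a small ball; a larger one is rare
  by Markov's inequality.\<close>

lemma atom_le:
  assumes \<epsilon>: "0 < \<epsilon>" "\<epsilon> < t" "t \<le> T" and \<rho>: "0 < \<rho>"
  shows "emeasure M {\<omega>\<in>space M. X t \<omega> = x} \<le> ennreal (4 * \<rho> / (c * \<epsilon> powr H)) +
     ennreal (1 / \<rho>) * (\<integral>\<^sup>+s. indicator {t-\<epsilon>..<t} s * (\<integral>\<^sup>+\<omega>. ennreal (dominator \<omega> s) \<partial>M) \<partial>lborel)"
proof -
  interpret P: pair_sigma_finite lborel M by unfold_locales
  let ?A = "\<lambda>t \<omega>. euler_limit (drift \<omega>) t"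
  let ?Z = "\<lambda>\<omega>. x0 + ?A (t - \<epsilon>) \<omega> - x"
  let ?J = "\<lambda>\<omega>. \<integral>\<^sup>+s. indicator {t-\<epsilon>..<t} s * ennreal (dominator \<omega> s) \<partial>lborel"
  have Bt: "has_wiener_integral M W t (K t) (B t)" using volterra \<epsilon> by (simp add: volterra_process_def)
  have Z: "?Z \<in> borel_measurable (F (t - \<epsilon>))"
    using \<epsilon> by (intro borel_measurable_diff borel_measurable_add borel_measurable_const euler_limit_adapted) auto
  have [measurable]: "B t \<in> borel_measurable M" using Bt by (simp add: has_wiener_integral_def)
  have B0: "B0 t \<omega> = B t \<omega>" for \<omega> using \<epsilon> by (simp add: B0_def)
  have first: "emeasure M {\<omega>\<in>space M. \<bar>?Z \<omega> + B t \<omega>\<bar> \<le> \<rho>} \<le> ennreal (4 * \<rho> / (c * \<epsilon> powr H))"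
    using \<epsilon> c_pos by (intro has_wiener_integral_small_ball[OF Bt _ _ _ Z _ kernel_lower_bound \<rho>]) auto
  have [measurable]: "?J \<in> borel_measurable M" by measurable
  have "emeasure M {\<omega>\<in>space M. 1 \<le> ennreal (1 / \<rho>) * ?J \<omega>} \<le> ennreal (1 / \<rho>) * (\<integral>\<^sup>+\<omega>. ?J \<omega> * indicator (space M) \<omega> \<partial>M)"
    by (rule nn_integral_Markov_inequality) auto
  also have "(\<integral>\<^sup>+\<omega>. ?J \<omega> * indicator (space M) \<omega> \<partial>M) = (\<integral>\<^sup>+\<omega>. ?J \<omega> \<partial>M)"
    by (intro nn_integral_cong) auto
  also have "\<dots> = (\<integral>\<^sup>+s. \<integral>\<^sup>+\<omega>. indicator {t-\<epsilon>..<t} s * ennreal (dominator \<omega> s) \<partial>M \<partial>lborel)"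
    using P.Fubini'[of "\<lambda>s \<omega>. indicator {t-\<epsilon>..<t} s * ennreal (dominator \<omega> s)"] by simp
  also have "\<dots> = (\<integral>\<^sup>+s. indicator {t-\<epsilon>..<t} s * (\<integral>\<^sup>+\<omega>. ennreal (dominator \<omega> s) \<partial>M) \<partial>lborel)"
    by (intro nn_integral_cong nn_integral_cmult) measurable
  finally have second: "emeasure M {\<omega>\<in>space M. 1 \<le> ennreal (1 / \<rho>) * ?J \<omega>} \<le> ennreal (1 / \<rho>) *
     (\<integral>\<^sup>+s. indicator {t-\<epsilon>..<t} s * (\<integral>\<^sup>+\<omega>. ennreal (dominator \<omega> s) \<partial>M) \<partial>lborel)" .
  have "emeasure M {\<omega>\<in>space M. X t \<omega> = x} \<le>
    emeasure M ({\<omega>\<in>space M. \<bar>?Z \<omega> + B t \<omega>\<bar> \<le> \<rho>} \<union> {\<omega>\<in>space M. 1 \<le> ennreal (1 / \<rho>) * ?J \<omega>})"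
  proof (rule emeasure_mono_AE)
    show "AE \<omega> in M. \<omega> \<in> {\<omega>\<in>space M. X t \<omega> = x} \<longrightarrow>
      \<omega> \<in> {\<omega>\<in>space M. \<bar>?Z \<omega> + B t \<omega>\<bar> \<le> \<rho>} \<union> {\<omega>\<in>space M. 1 \<le> ennreal (1 / \<rho>) * ?J \<omega>}"
      using AE_dissipative
    proof eventually_elim
      case (elim \<omega>)
      have inc: "ennreal \<bar>?A t \<omega> - ?A (t - \<epsilon>) \<omega>\<bar> \<le> ?J \<omega>"
        using elim \<epsilon> by (intro euler_limit_increment) auto
      show ?case
      proof (intro impI)
        assume "\<omega> \<in> {\<omega>\<in>space M. X t \<omega> = x}"
        then have "?Z \<omega> + B t \<omega> = - (?A t \<omega> - ?A (t - \<epsilon>) \<omega>)" by (auto simp: X_def B0)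
        then have abs: "\<bar>?Z \<omega> + B t \<omega>\<bar> = \<bar>?A t \<omega> - ?A (t - \<epsilon>) \<omega>\<bar>" by simp
        show "\<omega> \<in> {\<omega>\<in>space M. \<bar>?Z \<omega> + B t \<omega>\<bar> \<le> \<rho>} \<union> {\<omega>\<in>space M. 1 \<le> ennreal (1 / \<rho>) * ?J \<omega>}"
        proof (cases "\<bar>?A t \<omega> - ?A (t - \<epsilon>) \<omega>\<bar> \<le> \<rho>")
          case False
          then have "ennreal \<rho> \<le> ?J \<omega>" by (intro order_trans[OF ennreal_leI inc]) simp
          then have "ennreal (1 / \<rho>) * ennreal \<rho> \<le> ennreal (1 / \<rho>) * ?J \<omega>" by (rule mult_left_mono) simp
          then show ?thesis using \<rho> elim by (simp flip: ennreal_mult')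
        qed (use elim abs in auto)
      qed
    qed
  qed (use measurable_F_M[OF _ Z] \<epsilon> in measurable)
  also have "\<dots> \<le> emeasure M {\<omega>\<in>space M. \<bar>?Z \<omega> + B t \<omega>\<bar> \<le> \<rho>} + emeasure M {\<omega>\<in>space M. 1 \<le> ennreal (1 / \<rho>) * ?J \<omega>}"
    by (rule emeasure_subadditive) (use measurable_F_M[OF _ Z] \<epsilon> in measurable)
  also have "\<dots> \<le> ennreal (4 * \<rho> / (c * \<epsilon> powr H)) +
     ennreal (1 / \<rho>) * (\<integral>\<^sup>+s. indicator {t-\<epsilon>..<t} s * (\<integral>\<^sup>+\<omega>. ennreal (dominator \<omega> s) \<partial>M) \<partial>lborel)"
    by (intro add_mono first second)
  finally show ?thesis .
qed

text \<open>Integrating over \<open>t\<close> before bounding the drift increment gains the factor \<open>\<epsilon>\<close> by Fubini,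
  although \<open>\<integral>\<bar>B s\<bar> ds\<close> over \<open>[t - \<epsilon>, t]\<close> need not be of order \<open>\<epsilon>\<close> for each single \<open>t\<close>.\<close>

lemma atom_time_integral_le:
  assumes \<epsilon>: "0 < \<epsilon>" and \<rho>: "0 < \<rho>"
  defines "D \<equiv> \<integral>\<^sup>+s. indicator {0..T} s * (\<integral>\<^sup>+\<omega>. ennreal (dominator \<omega> s) \<partial>M) \<partial>lborel"
  shows "(\<integral>\<^sup>+t. indicator {0..T} t * emeasure M {\<omega>\<in>space M. X t \<omega> = x} \<partial>lborel)
    \<le> ennreal \<epsilon> + ennreal (4 * \<rho> / (c * \<epsilon> powr H)) * ennreal T + ennreal (1 / \<rho>) * (ennreal \<epsilon> * D)"
proof -
  let ?g = "\<lambda>s. \<integral>\<^sup>+\<omega>. ennreal (dominator \<omega> s) \<partial>M"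
  let ?E = "ennreal (4 * \<rho> / (c * \<epsilon> powr H))"
  \<comment> \<open>\<open>s\<close> lies in \<open>[t - \<epsilon>, t)\<close> exactly when
    \<open>t\<close> lies in \<open>(s, s + \<epsilon>]\<close>; in the second form the integral
    over \<open>t\<close> at fixed \<open>s\<close> produces the factor \<epsilon>.\<close>
  let ?q = "\<lambda>t s. indicator {0..T} s * ?g s * indicator {s<..s+\<epsilon>} t"
  have qm [measurable]: "(\<lambda>(t, s). ?q t s) \<in> borel_measurable (lborel \<Otimes>\<^sub>M lborel)"
  proof -
    have [measurable]: "?g \<in> borel_measurable borel" by measurable
    have "(\<lambda>(t, s). indicator {0..T} s * ?g s * (if s < t \<and> t \<le> s + \<epsilon> then 1 else 0)) \<in> borel_measurable (lborel \<Otimes>\<^sub>M lborel)"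
      by measurable
    also have "(\<lambda>(t, s). indicator {0..T} s * ?g s * (if s < t \<and> t \<le> s + \<epsilon> then 1 else 0)) = (\<lambda>(t, s). ?q t s)"
      by (auto simp: fun_eq_iff indicator_def)
    finally show ?thesis .
  qed
  have "(\<integral>\<^sup>+t. indicator {0..T} t * emeasure M {\<omega>\<in>space M. X t \<omega> = x} \<partial>lborel)
    \<le> (\<integral>\<^sup>+t. indicator {0..\<epsilon>} t + (?E * indicator {0..T} t + ennreal (1 / \<rho>) * (\<integral>\<^sup>+s. ?q t s \<partial>lborel)) \<partial>lborel)"
  proof (intro nn_integral_mono)
    fix t
    show "indicator {0..T} t * emeasure M {\<omega>\<in>space M. X t \<omega> = x}
      \<le> indicator {0..\<epsilon>} t + (?E * indicator {0..T} t + ennreal (1 / \<rho>) * (\<integral>\<^sup>+s. ?q t s \<partial>lborel))"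
    proof (cases "t \<in> {0..T}")
      case True
      show ?thesis
      proof (cases "t \<le> \<epsilon>")
        case t: True
        have "emeasure M {\<omega>\<in>space M. X t \<omega> = x} \<le> 1 + 0" by (simp add: emeasure_le_1)
        also have "1 + 0 \<le> indicator {0..\<epsilon>} t + (?E * indicator {0..T} t + ennreal (1 / \<rho>) * (\<integral>\<^sup>+s. ?q t s \<partial>lborel))"
          using t True by (intro add_mono) auto
        finally show ?thesis using True by simp
      next
        case False
        have "(\<integral>\<^sup>+s. indicator {t-\<epsilon>..<t} s * ?g s \<partial>lborel) \<le> (\<integral>\<^sup>+s. ?q t s \<partial>lborel)"
          using True False by (intro nn_integral_mono) (auto simp: indicator_def)
        then have "ennreal (1 / \<rho>) * (\<integral>\<^sup>+s. indicator {t-\<epsilon>..<t} s * ?g s \<partial>lborel) \<le> ennreal (1 / \<rho>) * (\<integral>\<^sup>+s. ?q t s \<partial>lborel)"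
          by (rule mult_left_mono) simp
        then have "emeasure M {\<omega>\<in>space M. X t \<omega> = x} \<le> ?E + ennreal (1 / \<rho>) * (\<integral>\<^sup>+s. ?q t s \<partial>lborel)"
          using True False by (intro order_trans[OF atom_le[OF \<epsilon> _ _ \<rho>] add_left_mono]) auto
        then show ?thesis using True False by simp
      qed
    qed simp
  qed
  also have "\<dots> = ennreal \<epsilon> + (?E * ennreal T + ennreal (1 / \<rho>) * (\<integral>\<^sup>+t. \<integral>\<^sup>+s. ?q t s \<partial>lborel \<partial>lborel))"
    using \<epsilon> T_pos by (simp add: nn_integral_add nn_integral_cmult)
  also have "(\<integral>\<^sup>+t. \<integral>\<^sup>+s. ?q t s \<partial>lborel \<partial>lborel) = (\<integral>\<^sup>+s. \<integral>\<^sup>+t. ?q t s \<partial>lborel \<partial>lborel)"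
    using lborel_pair.Fubini'[OF qm] by simp
  also have "\<dots> = (\<integral>\<^sup>+s. ennreal \<epsilon> * (indicator {0..T} s * ?g s) \<partial>lborel)"
    using \<epsilon> by (intro nn_integral_cong) (subst nn_integral_cmult_indicator, auto simp: mult.commute)
  also have "\<dots> = ennreal \<epsilon> * D" unfolding D_def by (intro nn_integral_cmult) measurable
  finally show ?thesis by (simp add: add.assoc)
qed

text \<open>As \<epsilon> tends to 0 the time integral of the probability of \<open>X t = x\<close>
  is forced to be 0, and Fubini turns this into a statement on almost every path. The exceptional
  event depends on \<open>x\<close>.\<close>

lemma AE_no_atom: "AE \<omega> in M. AE s in lborel. s \<in> {0..T} \<longrightarrow> X s \<omega> \<noteq> x"
proof -
  interpret P: pair_sigma_finite lborel M by unfold_locales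
  define D where "D = (\<integral>\<^sup>+s. indicator {0..T} s * (\<integral>\<^sup>+\<omega>. ennreal (dominator \<omega> s) \<partial>M) \<partial>lborel)"
  obtain r where r: "D = ennreal r" "0 \<le> r"
    using dominator_finite unfolding D_def[symmetric] by (cases D) auto
  \<comment> \<open>Then \<open>H + \<delta>\<close> is the midpoint of \<open>H\<close> and 1,
    which balances the two error terms.\<close>
  define \<delta> where "\<delta> = (1 - H) / 2"
  have \<delta>: "0 < \<delta>" using H_less by (simp add: \<delta>_def)
  let ?L = "\<integral>\<^sup>+t. indicator {0..T} t * emeasure M {\<omega>\<in>space M. X t \<omega> = x} \<partial>lborel"
  have le: "?L \<le> ennreal (\<epsilon> + (4 * T / c + r) * \<epsilon> powr \<delta>)" if \<epsilon>: "0 < \<epsilon>" for \<epsilon>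
  proof -
    \<comment> \<open>The radius lies strictly between \<open>\<epsilon>\<close> and \<open>\<epsilon> powr H\<close>, which makes both error terms of order
      \<open>\<epsilon> powr \<delta>\<close>.\<close>
    let ?\<rho> = "\<epsilon> powr (H + \<delta>)"
    have "?L \<le> ennreal \<epsilon> + ennreal (4 * ?\<rho> / (c * \<epsilon> powr H)) * ennreal T + ennreal (1 / ?\<rho>) * (ennreal \<epsilon> * D)"
      unfolding D_def using \<epsilon> by (intro atom_time_integral_le) auto
    also have "4 * ?\<rho> / (c * \<epsilon> powr H) = 4 / c * \<epsilon> powr \<delta>" using \<epsilon> by (simp add: powr_add)
    also have "ennreal (1 / ?\<rho>) * (ennreal \<epsilon> * D) = ennreal (1 / ?\<rho> * \<epsilon> * r)"
      unfolding r(1) using r(2) \<epsilon> by (simp add: mult.assoc flip: ennreal_mult)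
    also have "1 / ?\<rho> * \<epsilon> * r = \<epsilon> powr \<delta> * r"
    proof -
      have "\<epsilon> powr \<delta> * ?\<rho> = \<epsilon> powr 1" unfolding powr_add[symmetric] by (simp add: \<delta>_def field_simps)
      then show ?thesis using \<epsilon> by (simp add: field_simps)
    qed
    also have "ennreal \<epsilon> + ennreal (4 / c * \<epsilon> powr \<delta>) * ennreal T + ennreal (\<epsilon> powr \<delta> * r)
        = ennreal (\<epsilon> + 4 / c * \<epsilon> powr \<delta> * T + \<epsilon> powr \<delta> * r)"
      using \<epsilon> c_pos T_pos r(2) by (simp flip: ennreal_mult ennreal_plus)
    finally show ?thesis by (simp add: algebra_simps)
  qed
  have "(\<lambda>n. ennreal (1 / real (Suc n) + (4 * T / c + r) * (1 / real (Suc n)) powr \<delta>)) \<longlonglongrightarrow> ennreal (0 + (4 * T / c + r) * 0)"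
  proof (intro tendsto_ennrealI tendsto_add tendsto_mult tendsto_const)
    show lim: "(\<lambda>n. 1 / real (Suc n)) \<longlonglongrightarrow> 0" by (rule LIMSEQ_inverse_real_of_nat[unfolded inverse_eq_divide])
    show "(\<lambda>n. (1 / real (Suc n)) powr \<delta>) \<longlonglongrightarrow> 0"
      by (rule tendsto_zero_powrI[OF lim tendsto_const[of \<delta>] _ \<delta>]) simp
  qed
  then have "?L \<le> ennreal (0 + (4 * T / c + r) * 0)"
    using le by (intro LIMSEQ_le_const) auto
  then have "?L = 0" by simp
  moreover have "?L = (\<integral>\<^sup>+t. \<integral>\<^sup>+\<omega>. indicator {0..T} t * indicator {x} (X t \<omega>) \<partial>M \<partial>lborel)"
  proof (intro nn_integral_cong)
    fix t
    have [measurable]: "X t \<in> borel_measurable M" by measurable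
    have "(\<integral>\<^sup>+\<omega>. indicator {0..T} t * indicator {x} (X t \<omega>) \<partial>M) = indicator {0..T} t * (\<integral>\<^sup>+\<omega>. indicator {\<omega>\<in>space M. X t \<omega> = x} \<omega> \<partial>M)"
      by (subst nn_integral_cmult[symmetric]) (auto intro!: nn_integral_cong simp: indicator_def)
    then show "indicator {0..T} t * emeasure M {\<omega>\<in>space M. X t \<omega> = x} = (\<integral>\<^sup>+\<omega>. indicator {0..T} t * indicator {x} (X t \<omega>) \<partial>M)"
      by simp
  qed
  moreover have "\<dots> = (\<integral>\<^sup>+\<omega>. \<integral>\<^sup>+t. indicator {0..T} t * indicator {x} (X t \<omega>) \<partial>lborel \<partial>M)"
    by (rule P.Fubini'[symmetric]) measurable
  ultimately have "(\<integral>\<^sup>+\<omega>. \<integral>\<^sup>+t. indicator {0..T} t * indicator {x} (X t \<omega>) \<partial>lborel \<partial>M) = 0" by simp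
  then have "AE \<omega> in M. (\<integral>\<^sup>+t. indicator {0..T} t * indicator {x} (X t \<omega>) \<partial>lborel) = 0"
    by (subst (asm) nn_integral_0_iff_AE) auto
  then show ?thesis using AE_space
  proof eventually_elim
    case (elim \<omega>)
    note [measurable] = elim(2)
    have "(\<lambda>t. indicator {0..T} t * indicator {x} (X t \<omega>) :: ennreal) \<in> borel_measurable lborel" by measurable
    with elim(1) have "AE t in lborel. indicator {0..T} t * indicator {x} (X t \<omega>) = (0::ennreal)"
      by (subst (asm) nn_integral_0_iff_AE) auto
    then show ?case by eventually_elim (auto simp: indicator_def)
  qed
qed

section \<open>Existence and uniqueness\<close>

lemma X_strong_solution:
  assumes S: "finite S" and cont: "\<And>s x. s \<in> {0..T} \<Longrightarrow> x \<notin> S \<Longrightarrow> isCont (b s) x"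
  shows "strong_solution M F T x0 b B X"
  unfolding strong_solution_def
proof (intro conjI ballI X_adapted)
  \<comment> \<open>Each point of \<open>S\<close> has its own exceptional event; these finitely
    many events have a null union.\<close>
  have "AE \<omega> in M. \<forall>x\<in>S. AE s in lborel. s \<in> {0..T} \<longrightarrow> X s \<omega> \<noteq> x"
    using S AE_no_atom by (intro AE_finite_allI)
  then show "AE \<omega> in M. \<forall>t\<in>{0..T}. set_integrable lebesgue {0..t} (\<lambda>s. b s (X s \<omega>)) \<and>
      X t \<omega> = x0 + (LINT s:{0..t}|lebesgue. b s (X s \<omega>)) + B t \<omega>"
    using AE_dissipative
  proof eventually_elim
    case (elim \<omega>)
    interpret dissipative_ode "drift \<omega>" "envelope \<omega>" C T using elim by simp
    have om [measurable]: "\<omega> \<in> space M" using elim by simp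
    have meas: "euler_limit (drift \<omega>) \<in> borel_measurable borel" by measurable
    have "AE s in lborel. \<forall>x\<in>S. s \<in> {0..T} \<longrightarrow> X s \<omega> \<noteq> x" using S elim(1) by (intro AE_finite_allI) auto
    then have c: "AE s in lborel. s \<in> {0..T} \<longrightarrow> isCont (drift \<omega> s) (euler_limit (drift \<omega>) s)"
    proof eventually_elim
      case (elim s)
      show ?case
      proof
        assume s: "s \<in> {0..T}"
        have "isCont (b s) (X s \<omega>)" using cont[OF s] elim s by blast
        moreover have "isCont (\<lambda>y. x0 + B0 s \<omega> + y) (euler_limit (drift \<omega>) s)"
          by (intro continuous_intros)
        moreover have "x0 + B0 s \<omega> + euler_limit (drift \<omega>) s = X s \<omega>" by (simp add: X_def)
        ultimately have "isCont (\<lambda>y. b s (x0 + B0 s \<omega> + y)) (euler_limit (drift \<omega>) s)"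
          using isCont_o2[where f="\<lambda>y. x0 + B0 s \<omega> + y" and g="b s"] by simp
        then show "isCont (drift \<omega> s) (euler_limit (drift \<omega>) s)" using s by (simp add: drift_def[abs_def])
      qed
    qed
    have eq: "drift \<omega> s (euler_limit (drift \<omega>) s) = b s (X s \<omega>)" if "s \<in> {0..T}" for s
      using that by (simp add: drift_def X_def algebra_simps)
    show ?case
    proof
      fix t assume t: "t \<in> {0..T}"
      note sol = euler_limit_solution[OF t meas c]
      have eqt: "drift \<omega> s (euler_limit (drift \<omega>) s) = b s (X s \<omega>)" if "s \<in> {0..t}" for s
        using that t by (intro eq) auto
      note leb = set_integral_lebesgue_closed[OF sol(1) eqt]
      show "set_integrable lebesgue {0..t} (\<lambda>s. b s (X s \<omega>)) \<and>
        X t \<omega> = x0 + (LINT s:{0..t}|lebesgue. b s (X s \<omega>)) + B t \<omega>"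
        using leb sol(2) t by (simp add: X_def B0_def)
    qed
  qed
qed

lemma strong_solution_unique:
  assumes "strong_solution M F T x0 b B X1" "strong_solution M F T x0 b B X2"
  shows "AE \<omega> in M. \<forall>t\<in>{0..T}. X1 t \<omega> = X2 t \<omega>"
proof -
  have "AE \<omega> in M. \<forall>t\<in>{0..T}. set_integrable lebesgue {0..t} (\<lambda>s. b s (Y s \<omega>)) \<and>
      Y t \<omega> = x0 + (LINT s:{0..t}|lebesgue. b s (Y s \<omega>)) + B t \<omega>" if "Y \<in> {X1, X2}" for Y
    using assms that by (auto simp: strong_solution_def)
  from this[of X1, simplified] this[of X2, simplified] show ?thesis
  proof eventually_elim
    case (elim \<omega>)
    show ?case
    proof (intro ballI antisym)
      fix t assume t: "t \<in> {0..T}"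
      show "X1 t \<omega> \<le> X2 t \<omega>"
        by (rule monotone_solution_le[OF b_antimono _ _ t, where X="\<lambda>t. X1 t \<omega>" and Y="\<lambda>t. X2 t \<omega>" and w="\<lambda>t. B t \<omega>" and z=x0])
          (use elim in auto)
      show "X2 t \<omega> \<le> X1 t \<omega>"
        by (rule monotone_solution_le[OF b_antimono _ _ t, where X="\<lambda>t. X2 t \<omega>" and Y="\<lambda>t. X1 t \<omega>" and w="\<lambda>t. B t \<omega>" and z=x0])
          (use elim in auto)
    qed
  qed
qed

end

theorem corollary1p2:
  fixes M :: "'a measure"
    and W B :: "real \<Rightarrow> 'a \<Rightarrow> real"
    and K b :: "real \<Rightarrow> real \<Rightarrow> real"
    and T H c C x0 :: real
    and m :: nat and a :: "nat \<Rightarrow> real"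
  assumes "0 < T"
    and "prob_space M" and "complete_measure M"
    and "brownian_motion M T W"
    and "L2_kernel T K"
    and "volterra_process M W T K B"
    and "0 < H" and "H < 1" and "0 < c"
    and "\<forall>t\<in>{0<..T}. \<forall>\<epsilon>\<in>{0<..<t}.
           c * \<epsilon> powr H \<le> sqrt (LINT s:{t-\<epsilon>..t}|lebesgue. (K t s)\<^sup>2)"
    and "set_borel_measurable borel ({0..T} \<times> UNIV) (\<lambda>(t, x). b t x)"
    and "1 \<le> m" and "strict_mono_on {1..m} a"
    and "\<forall>t\<in>{0..T}. piecewise_uniformly_continuous m a (b t)"
    and "\<forall>t\<in>{0..T}. \<forall>x. \<bar>b t x\<bar> \<le> C * (1 + \<bar>x\<bar>)"
    and "\<forall>t\<in>{0..T}. antimono (b t)"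
  shows "unique_strong_solution M (augmented_filtration M W) T x0 b B"
proof -
  interpret prob_space M by fact
  interpret volterra_sde M W T K b B H c C x0
    using assms by unfold_locales auto
  have "isCont (b s) x" if "s \<in> {0..T}" "x \<notin> a ` {1..m}" for s x
    using assms that by (intro piecewise_uniformly_continuous_isCont[of m a]) auto
  then have "strong_solution M F T x0 b B X"
    by (intro X_strong_solution[of "a ` {1..m}"]) auto
  then show ?thesis
    unfolding unique_strong_solution_def using strong_solution_unique by blast
qed

end
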